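(* For any integer $2\le x\le n$ and any parameters $d,\alpha\in\Omega(\log n)$, there is a deterministic distributed algorithm that solves the Fuzzy Counting problem in $O\big(\frac{\log n}{\log x}(\frac{\log n}{\log\alpha})^{3}\big)$ rounds, using $O\big(\frac{\log n}{\log x}(\frac{\log n}{\log\alpha})^{4} d\alpha^{2}\, x\log n\big)$ communication bits amortized per process.
   Context: Model: $n$ synchronous processes with unique ids from the commonly known set $[n]$, sharing a global clock (a clock tick is a round), connected by reliable classical point-to-point channels between every pair; in each round a process may send personalized messages to any subset of processes, receives messages sent to it in that round, and computes locally. Processes may crash (permanently stop; a crash during multicast may deliver the message to an adversary-chosen subset of recipients), with crashes chosen online by an adaptive full-information adversary. Fuzzy Counting: each process $p$ has a bit $a_p\in\{0,1\}$ indicating whether it is active; each non-faulty process must return a number between the number of active (non-crashed) processes at the end of the algorithm and the number of active processes at the beginning (outputs may differ across processes). Amortized per process means total number of bits divided by $n$.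
   Formalization: The parameter α is additionally assumed to be at most polynomial in n (log α = O(log n)); for superpolynomial α and x = n the stated round bound tends to 0, yet Fuzzy Counting needs at least one round. *)

theory Defs
  imports Complex_Main "HOL-Library.Landau_Symbols"
begin

text \<open>
  The empty bit string stands for ``no message''. Hence every message that is actually sent
  costs at least one bit.
\<close>

type_synonym message = "bool list"

text \<open>
  A local view lists, for each completed round, the messages received in that round, indexed by
  sender. Because local computation is unrestricted, a deterministic algorithm is a function of
  the identifier, the input bit and the local view; its length is the value of the global clock.
\<close>

type_synonym view = "(nat \<Rightarrow> message) list"

datatype action = Multicast "nat \<Rightarrow> message" | Return nat

type_synonym algorithm = "nat \<Rightarrow> bool \<Rightarrow> view \<Rightarrow> action"

record config =
  crashed :: "nat set"
  views :: "nat \<Rightarrow> view"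

text \<open>
  An adversary sees all configurations up to the current round. For each process it answers
  None (no crash in this round) or Some R (crash in this round, with only the recipients in R
  getting the message addressed to them). Since it is chosen after the algorithm and
  the inputs, it also knows the messages of the current round. The number of crashes is
  not bounded.
\<close>

type_synonym adversary = "config list \<Rightarrow> nat \<Rightarrow> nat set option"

definition sent :: "nat \<Rightarrow> algorithm \<Rightarrow> (nat \<Rightarrow> bool) \<Rightarrow> config \<Rightarrow> nat \<Rightarrow> nat \<Rightarrow> message" where
  "sent n A a c p q =
     (if p \<in> {1..n} - crashed c
      then (case A p (a p) (views c p) of Multicast m \<Rightarrow> m q | Return v \<Rightarrow> [])
      else [])"

definition delivered ::
  "nat \<Rightarrow> algorithm \<Rightarrow> (nat \<Rightarrow> bool) \<Rightarrow> config \<Rightarrow> (nat \<Rightarrow> nat set option) \<Rightarrow> nat \<Rightarrow> nat \<Rightarrow> message" where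
  "delivered n A a c crash p q =
     (case crash p of
        None \<Rightarrow> sent n A a c p q
      | Some R \<Rightarrow> (if q \<in> R then sent n A a c p q else []))"

definition returned :: "algorithm \<Rightarrow> (nat \<Rightarrow> bool) \<Rightarrow> config \<Rightarrow> nat \<Rightarrow> bool" where
  "returned A a c p \<longleftrightarrow> (\<exists>v. A p (a p) (views c p) = Return v)"

text \<open>
  The view of a crashed or returned process is frozen, so that a returned value never changes.
  A returned process can still crash.
\<close>

definition next_config ::
  "nat \<Rightarrow> algorithm \<Rightarrow> (nat \<Rightarrow> bool) \<Rightarrow> config \<Rightarrow> (nat \<Rightarrow> nat set option) \<Rightarrow> config" where
  "next_config n A a c crash =
     (let C = crashed c \<union> {p \<in> {1..n}. crash p \<noteq> None} in
      \<lparr> crashed = C,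
        views = (\<lambda>q. if q \<in> {1..n} - C \<and> \<not> returned A a c q
                     then views c q @ [\<lambda>p. delivered n A a c crash p q]
                     else views c q) \<rparr>)"

primrec history ::
  "nat \<Rightarrow> algorithm \<Rightarrow> (nat \<Rightarrow> bool) \<Rightarrow> adversary \<Rightarrow> nat \<Rightarrow> config list" where
  "history n A a adv 0 = [\<lparr> crashed = {}, views = (\<lambda>_. []) \<rparr>]"
| "history n A a adv (Suc t) =
     (let h = history n A a adv t in h @ [next_config n A a (last h) (adv h)])"

definition config_after ::
  "nat \<Rightarrow> algorithm \<Rightarrow> (nat \<Rightarrow> bool) \<Rightarrow> adversary \<Rightarrow> nat \<Rightarrow> config" where
  "config_after n A a adv t = last (history n A a adv t)"

definition terminated ::
  "nat \<Rightarrow> algorithm \<Rightarrow> (nat \<Rightarrow> bool) \<Rightarrow> adversary \<Rightarrow> nat \<Rightarrow> bool" where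
  "terminated n A a adv t \<longleftrightarrow>
     (let c = config_after n A a adv t in \<forall>p \<in> {1..n} - crashed c. returned A a c p)"

text \<open>Only meaningful for terminating executions.\<close>

definition rounds :: "nat \<Rightarrow> algorithm \<Rightarrow> (nat \<Rightarrow> bool) \<Rightarrow> adversary \<Rightarrow> nat" where
  "rounds n A a adv = (LEAST t. terminated n A a adv t)"

definition final_config ::
  "nat \<Rightarrow> algorithm \<Rightarrow> (nat \<Rightarrow> bool) \<Rightarrow> adversary \<Rightarrow> config" where
  "final_config n A a adv = config_after n A a adv (rounds n A a adv)"

text \<open>
  Every bit that is sent counts, including bits that are lost because the sender crashes in that
  round or because the recipient has crashed.
\<close>

definition total_bits :: "nat \<Rightarrow> algorithm \<Rightarrow> (nat \<Rightarrow> bool) \<Rightarrow> adversary \<Rightarrow> nat" where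
  "total_bits n A a adv =
     (\<Sum>t < rounds n A a adv. \<Sum>p \<in> {1..n}. \<Sum>q \<in> {1..n}.
        length (sent n A a (config_after n A a adv t) p q))"

definition amortized_bits :: "nat \<Rightarrow> algorithm \<Rightarrow> (nat \<Rightarrow> bool) \<Rightarrow> adversary \<Rightarrow> real" where
  "amortized_bits n A a adv = real (total_bits n A a adv) / real n"

definition solves_fuzzy_counting :: "nat \<Rightarrow> algorithm \<Rightarrow> bool" where
  "solves_fuzzy_counting n A \<longleftrightarrow>
     (\<forall>a adv.
        (\<exists>t. terminated n A a adv t) \<and>
        (let c = final_config n A a adv in
         \<forall>p \<in> {1..n} - crashed c. \<exists>v.
           A p (a p) (views c p) = Return v \<and>
           card {q \<in> {1..n} - crashed c. a q} \<le> v \<and>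
           v \<le> card {q \<in> {1..n}. a q}))"

text \<open>
  Pairs (n, x) with n tending to infinity and x ranging freely over 2..n: asymptotic bounds
  along this filter have constants that do not depend on x.
\<close>

definition size_filter :: "(nat \<times> nat) filter" where
  "size_filter = inf (filtercomap fst at_top) (principal {(n, x). 2 \<le> x \<and> x \<le> n})"

end

theory Submission imports Defs "HOL-Real_Asymp.Real_Asymp" begin

text \<open>
  Write the identifiers in base x. Stage l merges the counts of the (at most) x sub-blocks of every block
  of identifiers that agree up to the last l + 1 digits: within a block, every survivor learns
  one valid count of each sub-block that still has a survivor, and adds these counts up. A sub-block it
  hears nothing about has no survivor, so counting it as 0 is valid.

  What remains is dissemination inside a set of processes under crashes. It uses fixed graphs of
  average degree about g b^(i + 8) for i < L, and the complete graph for i = L, where 2^g is about n and b is about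
  the fourth root of \<alpha>. In such a graph the number of edges between any two sets is, up to
  an error of order g times their sizes, proportional to the product of the sizes. An attempt consists of
  three parts.
  (1) Every process settles for the first graph in which it has enough live neighbours; only a fraction b^(-i)
  of all processes gets past the first i graphs, so the messages on graph i stay within the budget.
  (2) The settled processes probe: whoever ever sees too few active neighbours on its own graph becomes
  passive. By expansion, any two processes that remain active have exchanged their information.
  (3) Before and after the probing each process contacts its neighbours in the graph of its personal level,
  and is happy if one of them (or itself) stayed active.
  Two processes that are happy in the same attempt have exchanged their information. The number of live
  processes shrinks by the factor b during fewer than h attempts, where b^h > n. In every other attempt the survivors
  contain a large active core, which is missed on level i by few processes only. So a level is raised only
  after h unhappy attempts: then few processes reach a high level, and nobody is unhappy more than
  h (L + 1) times.
\<close>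

text \<open>The number of survivors is unknown and changes during the run, so processes settle on
  graphs of different densities. Information then has to cross between sets that were probed on
  different graphs; the denser of the two graphs serves as the bridge. The powers of b: the first
  graph has average degree of order \<open>g * b ^ 8\<close>, and settling requires
  \<open>g * b ^ 7\<close> live neighbours, so each graph is passed by fewer processes by a factor
  b. Probing requires only \<open>12 * g * (b + 1)\<close>; the gap of about \<open>b ^ 6\<close>
  absorbs a loss b by crashes and a loss L + 1 by restricting to a single graph. Hence
  \<open>b ^ 5\<close> must exceed a multiple of L + 1. With b about the fourth root of \<alpha>
  this is \<alpha>^(5/4) against log n, which \<alpha> in Omega(log n) just allows, and
  \<open>b ^ 8\<close> becomes \<alpha>^2. A stage has \<open>2 * (h * (L + 1))\<close> attempts of
  O(h) steps, and a step other than the two contacts costs O((L + 1) g b^8) messages per process on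
  average. A message has O(g x) bits. Of the two factors g, one becomes log n and the other is
  bounded by d.\<close>

subsection \<open>Graphs with small discrepancy\<close>

text \<open>If every element of E is kept independently with probability p, the right side is the
  mean of the left; the proof is the method of conditional expectations. The mean factor of the
  element x is first moved into the weights, hence the arbitrary \<open>c\<close>, and whether x is
  kept is decided after the rest of R.\<close>

lemma choose_subset_below_average:
  fixes c y :: "'k \<Rightarrow> real" and F :: "'k \<Rightarrow> 'e set" and p :: real
  assumes "finite E" and "finite I" and p: "0 \<le> p" "p \<le> 1"
  shows "\<exists>R \<subseteq> E. (\<Sum>k\<in>I. c k * y k ^ card (R \<inter> F k))
                 \<le> (\<Sum>k\<in>I. c k * (1 - p + p * y k) ^ card (E \<inter> F k))"
  using \<open>finite E\<close>
proof (induction E arbitrary: c rule: finite_induct)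
  case empty
  show ?case by simp
next
  case (insert x E)
  define c' where "c' k = c k * (if x \<in> F k then 1 - p + p * y k else 1)" for k
  obtain R where R: "R \<subseteq> E" and
    le: "(\<Sum>k\<in>I. c' k * y k ^ card (R \<inter> F k)) \<le> (\<Sum>k\<in>I. c' k * (1 - p + p * y k) ^ card (E \<inter> F k))"
    using insert.IH by blast
  have fin: "finite R" and xR: "x \<notin> R" using R insert.hyps finite_subset by auto
  have rhs: "c' k * (1 - p + p * y k) ^ card (E \<inter> F k)
             = c k * (1 - p + p * y k) ^ card (insert x E \<inter> F k)" for k
    using insert.hyps by (simp add: c'_def)
  have lhs: "c' k * y k ^ card (R \<inter> F k)
             = (1 - p) * (c k * y k ^ card (R \<inter> F k)) + p * (c k * y k ^ card (insert x R \<inter> F k))" for k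
    using fin xR by (simp add: c'_def algebra_simps)
  define f where "f R = (\<Sum>k\<in>I. c k * y k ^ card (R \<inter> F k))" for R
  have mix: "(1 - p) * f R + p * f (insert x R) \<le> (\<Sum>k\<in>I. c k * (1 - p + p * y k) ^ card (insert x E \<inter> F k))"
    using le unfolding rhs lhs f_def by (simp add: sum.distrib sum_distrib_left)
  have "min (f R) (f (insert x R)) \<le> (1 - p) * f R + p * f (insert x R)"
  proof -
    have "(1 - p) * min (f R) (f (insert x R)) + p * min (f R) (f (insert x R))
          \<le> (1 - p) * f R + p * f (insert x R)"
      using p by (intro add_mono mult_left_mono) auto
    thus ?thesis by (simp add: algebra_simps)
  qed
  with mix have "f R \<le> (\<Sum>k\<in>I. c k * (1 - p + p * y k) ^ card (insert x E \<inter> F k)) \<or>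
        f (insert x R) \<le> (\<Sum>k\<in>I. c k * (1 - p + p * y k) ^ card (insert x E \<inter> F k))"
    by linarith
  thus ?case
  proof
    assume "f R \<le> (\<Sum>k\<in>I. c k * (1 - p + p * y k) ^ card (insert x E \<inter> F k))"
    thus ?case using R unfolding f_def by (intro exI[of _ R]) auto
  next
    assume "f (insert x R) \<le> (\<Sum>k\<in>I. c k * (1 - p + p * y k) ^ card (insert x E \<inter> F k))"
    thus ?case using R unfolding f_def by (intro exI[of _ "insert x R"]) auto
  qed
qed

lemma sum_Pow_power_card:
  assumes "finite V"
  shows "(\<Sum>A\<in>Pow V. q ^ card A) = (1 + q :: real) ^ card V"
  using assms
proof (induction V rule: finite_induct)
  case (insert x V)
  have inj: "inj_on (insert x) (Pow V)" using insert.hyps(2) by (auto simp: inj_on_def)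
  have "(\<Sum>A\<in>Pow (insert x V). q ^ card A)
        = (\<Sum>A\<in>Pow V. q ^ card A) + (\<Sum>A\<in>insert x ` Pow V. q ^ card A)"
    unfolding Pow_insert by (rule sum.union_disjoint) (use insert.hyps in auto)
  also have "(\<Sum>A\<in>insert x ` Pow V. q ^ card A) = (\<Sum>A\<in>Pow V. q * q ^ card A)"
    unfolding sum.reindex[OF inj] o_def
  proof (rule sum.cong[OF refl])
    fix A assume "A \<in> Pow V"
    hence "finite A" "x \<notin> A" using insert.hyps finite_subset by auto
    thus "q ^ card (insert x A) = q * q ^ card A" by simp
  qed
  finally show ?case using insert by (simp add: sum_distrib_left[symmetric] algebra_simps)
qed simp

text \<open>Ordered pairs are counted: A and B may overlap, and an edge inside both is then counted
  in both directions.\<close>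

definition edges :: "('a \<Rightarrow> 'a \<Rightarrow> bool) \<Rightarrow> 'a set \<Rightarrow> 'a set \<Rightarrow> nat" where
  "edges E A B = card {(u, v) \<in> A \<times> B. E u v}"

lemma exp_le_two_powr: "z \<ge> 0 \<Longrightarrow> exp z \<le> 2 powr (2 * z)" for z :: real
proof -
  assume z: "z \<ge> 0"
  have "1 / 2 \<le> ln (2::real)" using ln_le_minus_one[of "1 / 2"] by (simp add: ln_div)
  hence "z * 1 \<le> z * (2 * ln 2)" using z by (intro mult_left_mono) auto
  thus ?thesis by (simp add: powr_def algebra_simps)
qed

lemma exp_minus_le_two_powr: "z \<ge> 0 \<Longrightarrow> exp (- z) \<le> 2 powr (- z)" for z :: real
proof -
  assume z: "z \<ge> 0"
  have "ln (2::real) \<le> 1" using ln_le_minus_one[of 2] by simp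
  hence "z * ln 2 \<le> z * 1" using z by (intro mult_left_mono) auto
  thus ?thesis by (simp add: powr_def)
qed

text \<open>
  A G(n,p)-like relation. Every pair (A, B) contributes two weights, proportional to 2 to the
  power of the edge count and of its negative; their total average is below 1.
\<close>

lemma discrepancy_relation:
  fixes p :: real and n g :: nat
  assumes V: "finite V" "card V = n" and n: "2 \<le> n" "n \<le> 2 ^ g" and p: "0 \<le> p" "p \<le> 1"
  shows "\<exists>R \<subseteq> V \<times> V. \<forall>A \<subseteq> V. \<forall>B \<subseteq> V. A \<noteq> {} \<longrightarrow> B \<noteq> {} \<longrightarrow>
           card (R \<inter> A \<times> B) \<le> 2 * p * card A * card B + 3 * g * (card A + card B) \<and>
           p * card A * card B / 2 \<le> card (R \<inter> A \<times> B) + 3 * g * (card A + card B)"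
proof -
  define P where "P = Pow V - {{}}"
  define I where "I = (UNIV :: bool set) \<times> P \<times> P"
  define m where "m A B = p * real (card A) * real (card B)" for A B :: "'a set"
  \<comment> \<open>The slack pays for the union bound over all pairs of sets: as
    \<open>2 ^ g\<close> is at least n, each member of A and of B contributes a factor of at most
    1/n^3 to \<open>2 powr (- s A B)\<close>.\<close>
  define s where "s A B = 3 * real g * (real (card A) + real (card B))" for A B :: "'a set"
  \<comment> \<open>Exponential moments in base 2: doubling per edge has mean at most
    \<open>2 powr (2 * m A B)\<close>, halving per edge has mean at most
    \<open>2 powr (- (m A B / 2))\<close>. The weights cancel these means up to the slack.\<close>
  define c where "c = (\<lambda>(up, A, B). if up then 2 powr (- (2 * m A B) - s A B) else 2 powr (m A B / 2 - s A B))"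
  define y where "y = (\<lambda>(up, A :: 'a set, B :: 'a set). if up then 2 else (1 / 2 :: real))"
  define F where "F = (\<lambda>(up :: bool, A :: 'a set, B :: 'a set). A \<times> B)"
  define q :: real where "q = 2 powr (- (3 * real g))"
  have finP: "finite P" and finI: "finite I" using V by (auto simp: P_def I_def)
  have finA: "finite A" if "A \<in> P" for A using that V finite_subset by (auto simp: P_def)
  obtain R where R: "R \<subseteq> V \<times> V" and
    le: "(\<Sum>k\<in>I. c k * y k ^ card (R \<inter> F k)) \<le> (\<Sum>k\<in>I. c k * (1 - p + p * y k) ^ card ((V \<times> V) \<inter> F k))"
    using choose_subset_below_average[of "V \<times> V" I p c y F] V finI p by auto
  have mean: "c k * (1 - p + p * y k) ^ card ((V \<times> V) \<inter> F k) \<le> q ^ card A * q ^ card B"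
    if k: "k = (up, A, B)" and AB: "A \<in> P" "B \<in> P" for k up A B
  proof -
    have "(V \<times> V) \<inter> F k = A \<times> B" using AB k by (auto simp: F_def P_def)
    hence card: "card ((V \<times> V) \<inter> F k) = card A * card B" by (simp add: card_cartesian_product)
    have q: "q ^ card A * q ^ card B = 2 powr (- s A B)"
      unfolding q_def s_def by (simp add: powr_realpow[symmetric] powr_powr powr_add[symmetric] algebra_simps)
    have m0: "0 \<le> m A B" using p by (simp add: m_def)
    show ?thesis
    proof (cases up)
      case True
      have "(1 + p) ^ (card A * card B) \<le> exp p ^ (card A * card B)"
        using p by (intro power_mono) auto
      also have "\<dots> = exp (m A B)" by (simp add: exp_of_nat_mult[symmetric] m_def mult_ac)
      also have "\<dots> \<le> 2 powr (2 * m A B)" using m0 by (rule exp_le_two_powr)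
      finally have "(1 + p) ^ (card A * card B) \<le> 2 powr (2 * m A B)" .
      hence "2 powr (- (2 * m A B) - s A B) * (1 + p) ^ (card A * card B)
             \<le> 2 powr (- (2 * m A B) - s A B) * 2 powr (2 * m A B)" by (intro mult_left_mono) auto
      also have "\<dots> = 2 powr (- s A B)" by (simp add: powr_add[symmetric])
      finally show ?thesis unfolding q card using True k by (simp add: c_def y_def add.commute)
    next
      case False
      have "(1 - p / 2) ^ (card A * card B) \<le> exp (- (p / 2)) ^ (card A * card B)"
        using p exp_ge_add_one_self[of "- (p / 2)"] by (intro power_mono) auto
      also have "\<dots> = exp (- (m A B / 2))" by (simp add: exp_of_nat_mult[symmetric] m_def mult_ac)
      also have "\<dots> \<le> 2 powr (- (m A B / 2))" using m0 by (intro exp_minus_le_two_powr) auto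
      finally have "(1 - p / 2) ^ (card A * card B) \<le> 2 powr (- (m A B / 2))" .
      hence "2 powr (m A B / 2 - s A B) * (1 - p / 2) ^ (card A * card B)
             \<le> 2 powr (m A B / 2 - s A B) * 2 powr (- (m A B / 2))" by (intro mult_left_mono) auto
      also have "\<dots> = 2 powr (- s A B)" by (simp add: powr_add[symmetric])
      finally show ?thesis unfolding q card using False k by (simp add: c_def y_def algebra_simps)
    qed
  qed
  have sumP: "(\<Sum>A\<in>P. q ^ card A) = (1 + q) ^ n - 1"
  proof -
    have "(\<Sum>A\<in>Pow V. q ^ card A) = q ^ card {} + (\<Sum>A\<in>P. q ^ card A)"
      unfolding P_def using V sum.remove[of "Pow V" "{}" "\<lambda>A. q ^ card A"] by simp
    thus ?thesis using sum_Pow_power_card[OF V(1), of q] V by simp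
  qed
  have "(\<Sum>k\<in>I. c k * (1 - p + p * y k) ^ card ((V \<times> V) \<inter> F k))
        \<le> (\<Sum>(up, A, B)\<in>I. q ^ card A * q ^ card B)"
  proof (rule sum_mono)
    fix k assume k: "k \<in> I"
    obtain up A B where kk: "k = (up, A, B)" by (cases k)
    show "c k * (1 - p + p * y k) ^ card ((V \<times> V) \<inter> F k) \<le> (case k of (up, A, B) \<Rightarrow> q ^ card A * q ^ card B)"
      using mean[OF kk] k kk by (simp add: I_def)
  qed
  also have "\<dots> = 2 * ((\<Sum>A\<in>P. q ^ card A) * (\<Sum>B\<in>P. q ^ card B))"
    unfolding I_def by (simp add: sum.cartesian_product[symmetric] UNIV_bool sum_product)
  also have "\<dots> < 1"
  proof -
    have "q = 1 / real ((2 ^ g) ^ 3)"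
    proof -
      have "q = inverse (2 powr real (3 * g))" by (simp add: q_def powr_minus)
      also have "\<dots> = inverse (2 ^ (3 * g))" by (subst powr_realpow) auto
      finally show ?thesis by (simp add: inverse_eq_divide power_mult[symmetric] mult.commute)
    qed
    moreover have "real (n ^ 3) \<le> real ((2 ^ g) ^ 3)" using n by (intro of_nat_mono power_mono) auto
    moreover have "0 < real (n ^ 3)" using n by simp
    ultimately have "q \<le> 1 / real (n ^ 3)" by (simp add: frac_le)
    hence "real n * q \<le> real n * (1 / real (n ^ 3))" by (intro mult_left_mono) auto
    also have "\<dots> = 1 / real (n ^ 2)" using n by (simp add: power2_eq_square power3_eq_cube)
    also have "\<dots> \<le> 1 / 4"
    proof -
      have "real (2 ^ 2) \<le> real (n ^ 2)" using n by (intro of_nat_mono power_mono) auto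
      thus ?thesis using n by (simp add: divide_simps)
    qed
    finally have nq: "real n * q \<le> 1 / 4" .
    have q0: "0 \<le> q" by (simp add: q_def)
    have "(1 + q) ^ n \<le> exp q ^ n" using q0 by (intro power_mono) auto
    also have "\<dots> = exp (real n * q)" by (simp add: exp_of_nat_mult)
    also have "\<dots> \<le> 1 + real n * q + (real n * q)\<^sup>2" using nq q0 by (intro exp_bound) auto
    also have "\<dots> \<le> 1 + 1 / 4 + (1 / 4)\<^sup>2" using nq q0 by (intro add_mono power_mono) auto
    finally have a: "(1 + q) ^ n - 1 \<le> 5 / 16" by (simp add: power2_eq_square)
    have "1 \<le> (1 + q) ^ n" using q0 by simp
    hence "((1 + q) ^ n - 1) * ((1 + q) ^ n - 1) \<le> 5 / 16 * (5 / 16)" using a by (intro mult_mono) auto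
    thus ?thesis unfolding sumP by simp
  qed
  finally have total: "(\<Sum>k\<in>I. c k * y k ^ card (R \<inter> F k)) < 1" using le by linarith
  \<comment> \<open>The terms are nonnegative, so none of them reaches 1; the logarithm of each is
    one of the two bounds on the edge count.\<close>
  have each: "c k * y k ^ card (R \<inter> F k) < 1" if "k \<in> I" for k
  proof -
    have "c k * y k ^ card (R \<inter> F k) \<le> (\<Sum>k\<in>I. c k * y k ^ card (R \<inter> F k))"
      by (rule member_le_sum) (use that finI in \<open>auto simp: c_def y_def split: prod.splits\<close>)
    thus ?thesis using total by linarith
  qed
  show ?thesis
  proof (intro exI[of _ R] conjI R allI impI)
    fix A B assume AB: "A \<subseteq> V" "B \<subseteq> V" "A \<noteq> {}" "B \<noteq> {}"
    have "2 powr (- (2 * m A B) - s A B) * 2 ^ card (R \<inter> A \<times> B) < 1"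
      using each[of "(True, A, B)"] AB by (simp add: I_def P_def c_def y_def F_def)
    hence "2 powr (- (2 * m A B) - s A B + real (card (R \<inter> A \<times> B))) < 2 powr 0"
      by (simp add: powr_add powr_realpow)
    hence "- (2 * m A B) - s A B + real (card (R \<inter> A \<times> B)) < 0" by (subst (asm) powr_less_cancel_iff) auto
    thus "card (R \<inter> A \<times> B) \<le> 2 * p * card A * card B + 3 * g * (card A + card B)"
      unfolding m_def s_def by (simp add: algebra_simps)
    have "2 powr (m A B / 2 - s A B) * (1 / 2) ^ card (R \<inter> A \<times> B) < 1"
      using each[of "(False, A, B)"] AB by (simp add: I_def P_def c_def y_def F_def)
    hence "2 powr (m A B / 2 - s A B - real (card (R \<inter> A \<times> B))) < 2 powr 0"
      by (simp add: powr_diff powr_realpow power_divide)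
    hence "m A B / 2 - s A B - real (card (R \<inter> A \<times> B)) < 0" by (subst (asm) powr_less_cancel_iff) auto
    thus "p * card A * card B / 2 \<le> card (R \<inter> A \<times> B) + 3 * g * (card A + card B)"
      unfolding m_def s_def by (simp add: algebra_simps)
  qed
qed

text \<open>An edge of the symmetric closure between A and B comes from a pair in A x B or a pair in
  B x A. So symmetrization at most doubles the upper bounds and keeps the lower ones.\<close>

lemma discrepancy_graph:
  fixes p :: real and n g :: nat
  assumes V: "finite V" "card V = n" and n: "2 \<le> n" "n \<le> 2 ^ g" and p: "0 \<le> p" "p \<le> 1"
  shows "\<exists>E. (\<forall>u v. E u v = E v u) \<and> (\<forall>A \<subseteq> V. \<forall>B \<subseteq> V.
           edges E A B \<le> 4 * p * card A * card B + 6 * g * (card A + card B) \<and>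
           p * card A * card B / 2 \<le> edges E A B + 3 * g * (card A + card B))"
proof -
  have "\<exists>R. R \<subseteq> V \<times> V \<and> (\<forall>A \<subseteq> V. \<forall>B \<subseteq> V. A \<noteq> {} \<longrightarrow> B \<noteq> {} \<longrightarrow>
           card (R \<inter> A \<times> B) \<le> 2 * p * card A * card B + 3 * g * (card A + card B) \<and>
           p * card A * card B / 2 \<le> card (R \<inter> A \<times> B) + 3 * g * (card A + card B))"
    by (rule discrepancy_relation[OF assms])
  then obtain R where R: "\<forall>A \<subseteq> V. \<forall>B \<subseteq> V. A \<noteq> {} \<longrightarrow> B \<noteq> {} \<longrightarrow>
           card (R \<inter> A \<times> B) \<le> 2 * p * card A * card B + 3 * g * (card A + card B) \<and>
           p * card A * card B / 2 \<le> card (R \<inter> A \<times> B) + 3 * g * (card A + card B)"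
    by (elim exE conjE)
  define E where "E u v \<longleftrightarrow> (u, v) \<in> R \<or> (v, u) \<in> R" for u v
  have "edges E A B \<le> 4 * p * card A * card B + 6 * g * (card A + card B) \<and>
        p * card A * card B / 2 \<le> edges E A B + 3 * g * (card A + card B)"
    if AB: "A \<subseteq> V" "B \<subseteq> V" for A B
  proof (cases "A = {} \<or> B = {}")
    case True
    thus ?thesis by (auto simp: edges_def)
  next
    case False
    have fin: "finite A" "finite B" using AB V finite_subset by auto
    have eq: "{(u, v) \<in> A \<times> B. E u v} = (R \<inter> A \<times> B) \<union> prod.swap ` (R \<inter> B \<times> A)"
      by (force simp: E_def image_iff)
    have "card (R \<inter> A \<times> B) \<le> edges E A B"
      unfolding edges_def eq by (rule card_mono) (use fin in auto)
    moreover have "edges E A B \<le> card (R \<inter> A \<times> B) + card (prod.swap ` (R \<inter> B \<times> A))"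
      unfolding edges_def eq by (rule card_Un_le)
    moreover have "card (prod.swap ` (R \<inter> B \<times> A)) = card (R \<inter> B \<times> A)"
      by (rule card_image) (auto simp: inj_on_def)
    moreover note R[rule_format, OF AB] R[rule_format, OF AB(2,1)]
    ultimately show ?thesis using False by (simp add: algebra_simps)
  qed
  moreover have "\<forall>u v. E u v = E v u" by (auto simp: E_def)
  ultimately show ?thesis by blast
qed

lemma edges_eq_sum:
  assumes "finite A" "finite B"
  shows "edges E A B = (\<Sum>u\<in>A. card {v \<in> B. E u v})"
proof -
  have "{(u, v) \<in> A \<times> B. E u v} = (SIGMA u:A. {v \<in> B. E u v})" by auto
  thus ?thesis unfolding edges_def using assms by (simp add: card_SigmaI)
qed

lemma edges_insert_left:
  assumes "finite A" "finite B" "q \<notin> A"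
  shows "edges E (insert q A) B = card {v \<in> B. E q v} + edges E A B"
  using assms by (simp add: edges_eq_sum)

lemma edges_mono:
  assumes "finite A" "finite B" "A' \<subseteq> A" "B' \<subseteq> B"
  shows "edges E A' B' \<le> edges E A B"
proof -
  have "{(u, v) \<in> A \<times> B. E u v} \<subseteq> A \<times> B" by auto
  moreover have "finite (A \<times> B)" using assms by simp
  ultimately have "finite {(u, v) \<in> A \<times> B. E u v}" by (rule finite_subset)
  thus ?thesis unfolding edges_def by (rule card_mono) (use assms in auto)
qed

section \<open>Expansion of the overlay graphs\<close>

locale overlay =
  fixes n b g h L :: nat and E :: "nat \<Rightarrow> nat \<Rightarrow> nat \<Rightarrow> bool"
  assumes n_ge: "2 \<le> n" and g_ge: "1 \<le> g" and n_le_pow: "n \<le> 2 ^ g" and b_ge: "8 \<le> b" and b_large: "2000 * (L + 1) \<le> b ^ 5"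
    and n_less: "n < b ^ h" and L_le: "L \<le> h" and n_le: "n \<le> 4 * g * b ^ (L + 8)"
    and degree_le: "\<And>i. i < L \<Longrightarrow> 4 * g * b ^ (i + 8) \<le> n"
    and sym: "\<And>i u v. i < L \<Longrightarrow> E i u v = E i v u"
    and lower: "\<And>i A B. i < L \<Longrightarrow> A \<subseteq> {1..n} \<Longrightarrow> B \<subseteq> {1..n} \<Longrightarrow>
       (4 * g * b ^ (i + 8) / n) * card A * card B / 2 \<le> edges (E i) A B + 3 * g * (card A + card B)"
    and upper: "\<And>i A B. i < L \<Longrightarrow> A \<subseteq> {1..n} \<Longrightarrow> B \<subseteq> {1..n} \<Longrightarrow>
       edges (E i) A B \<le> 4 * (4 * g * b ^ (i + 8) / n) * card A * card B + 6 * g * (card A + card B)"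
begin

text \<open>The edge density that corresponds to average degree
  \<open>4 * g * b ^ (i + 8)\<close>.\<close>

definition p :: "nat \<Rightarrow> real" where "p i = 4 * g * b ^ (i + 8) / n"
text \<open>Settling threshold: below the degree scale of the first graph by a factor b, and above
  \<open>tau\<close> by about \<open>b ^ 6\<close>, which leaves room for the losses in
  \<open>dense_core\<close>.\<close>

definition thr :: nat where "thr = g * b ^ 7"
text \<open>Probing threshold: twice the error \<open>6 * g * (1 + b)\<close> per member of X that
  the upper bound allows in \<open>growth\<close> when Y has fewer than b times as many
  members.\<close>

definition tau :: nat where "tau = 12 * g * (b + 1)"

lemma p_pos: "0 < p i" and p_le: "i < L \<Longrightarrow> p i \<le> 1" and p_mono: "i \<le> j \<Longrightarrow> p i \<le> p j"
proof -
  show "0 < p i" using n_ge g_ge b_ge by (simp add: p_def)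
  show "p i \<le> 1" if "i < L"
  proof -
    have "real (4 * g * b ^ (i + 8)) \<le> real n" using degree_le[OF that] by (rule of_nat_mono)
    thus ?thesis using n_ge by (simp add: p_def)
  qed
  show "p i \<le> p j" if "i \<le> j"
  proof -
    have "real b ^ (i + 8) \<le> real b ^ (j + 8)" using that b_ge by (intro power_increasing) auto
    hence "4 * g * real b ^ (i + 8) \<le> 4 * g * real b ^ (j + 8)" by (intro mult_left_mono) auto
    thus ?thesis unfolding p_def by (simp add: divide_right_mono)
  qed
qed

lemma lower_p: "i < L \<Longrightarrow> A \<subseteq> {1..n} \<Longrightarrow> B \<subseteq> {1..n} \<Longrightarrow>
    p i * card A * card B / 2 \<le> edges (E i) A B + 3 * g * (card A + card B)"
  using lower[of i A B] unfolding p_def by simp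

lemma upper_p: "i < L \<Longrightarrow> A \<subseteq> {1..n} \<Longrightarrow> B \<subseteq> {1..n} \<Longrightarrow>
    edges (E i) A B \<le> 4 * p i * card A * card B + 6 * g * (card A + card B)"
  using upper[of i A B] unfolding p_def by simp

lemma finite_sub: "A \<subseteq> {1..n} \<Longrightarrow> finite A"
  using finite_subset by blast

lemma b_powers: "real (b ^ 5) \<ge> 2000 * (real L + 1)" "real (b ^ 7) \<ge> 64 * real (b ^ 5)" "real b \<ge> 8"
proof -
  show "real (b ^ 5) \<ge> 2000 * (real L + 1)"
    using of_nat_mono[OF b_large, where 'a = real] by (simp add: algebra_simps)
  show "real b \<ge> 8" using b_ge by simp
  hence "8 * 8 \<le> real b * real b" by (intro mult_mono) auto
  hence "64 * real (b ^ 5) \<le> (real b * real b) * real (b ^ 5)" by (intro mult_right_mono) auto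
  thus "real (b ^ 7) \<ge> 64 * real (b ^ 5)" by (simp add: eval_nat_numeral algebra_simps)
qed

text \<open>A larger X would send more than \<open>thr * card S\<close> edges into S by the lower
  bound, while its degrees allow at most \<open>thr * card X\<close>. The bound on X is relative to
  n, no matter how few processes S still contains.\<close>

lemma few_deficient:
  assumes i: "i < L" and S: "X \<subseteq> S" "S \<subseteq> {1..n}" and deg: "\<And>q. q \<in> X \<Longrightarrow> card {v \<in> S. E i q v} < thr"
  shows "card X * b ^ Suc i \<le> n"
proof (rule ccontr)
  assume "\<not> ?thesis"
  hence gt: "real n < real (card X) * real b ^ Suc i"
    by (metis not_le of_nat_less_iff of_nat_mult of_nat_power)
  have fin: "finite S" "finite X" using S finite_sub finite_subset by auto
  define x s where "x = real (card X)" and "s = real (card S)"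
  have xs: "x \<le> s" using card_mono[OF fin(1) S(1)] by (simp add: x_def s_def)
  have "edges (E i) X S \<le> (\<Sum>q\<in>X. thr)"
    unfolding edges_eq_sum[OF fin(2,1)] using deg by (intro sum_mono) (simp add: less_imp_le)
  hence e: "edges (E i) X S \<le> x * thr"
    by (simp add: x_def flip: of_nat_mult)
  have low: "p i * x * s / 2 \<le> edges (E i) X S + 3 * g * (x + s)"
    using lower_p[OF i, of X S] S by (simp add: x_def s_def)
  have px: "4 * (real g * real (b ^ 7)) < p i * x"
  proof -
    have "4 * (real g * real (b ^ 7)) * n < 4 * (real g * real (b ^ 7)) * (x * real b ^ Suc i)"
      using gt g_ge b_ge by (intro mult_strict_left_mono) (auto simp: x_def)
    also have "\<dots> = p i * x * n" using n_ge by (simp add: p_def power_add eval_nat_numeral algebra_simps)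
    finally show ?thesis using n_ge by simp
  qed
  have x0: "0 < x" using px g_ge p_pos[of i] by (metis mult_zero_right not_less of_nat_0_le_iff x_def zero_le_numeral
        mult_nonneg_nonneg less_eq_real_def of_nat_power)
  hence s0: "0 < s" using xs by linarith
  have b7: "real (b ^ 7) \<ge> 8" using power_mono[of 8 "real b" 7] b_ge by simp
  define u v where "u = real g * real (b ^ 7) * s" and "v = real g * s"
  have "4 * (real g * real (b ^ 7)) * s < (p i * x) * s" using px s0 by (rule mult_strict_right_mono)
  hence 1: "4 * u < p i * x * s" by (simp add: u_def)
  have 2: "x * thr \<le> u"
  proof -
    have "x * (real g * real (b ^ 7)) \<le> s * (real g * real (b ^ 7))" using xs by (intro mult_right_mono) auto
    thus ?thesis by (simp add: thr_def u_def mult_ac)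
  qed
  have "3 * g * (x + s) \<le> 3 * g * (2 * s)" using xs by (intro mult_left_mono) auto
  hence 3: "3 * g * (x + s) \<le> 6 * v" by (simp add: v_def)
  have "real g * s * 8 \<le> real g * s * real (b ^ 7)" using b7 s0 by (intro mult_left_mono) auto
  hence 4: "8 * v \<le> u" by (simp add: u_def v_def mult_ac)
  have "0 < v" using g_ge s0 by (simp add: v_def)
  thus False using 1 2 3 4 low e by linarith
qed

text \<open>Without edges the lower bound reads p |A| |C| / 2 \<le> 3 g (|A| + |C|), which fails as
  soon as p |A| and p |C| both exceed 12 g.\<close>

lemma nonadjacent:
  assumes i: "i < L" and AC: "A \<subseteq> {1..n}" "C \<subseteq> {1..n}" and none: "\<And>u v. u \<in> A \<Longrightarrow> v \<in> C \<Longrightarrow> \<not> E i u v"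
  shows "p i * card A \<le> 12 * g \<or> p i * card C \<le> 12 * g"
proof (rule ccontr)
  assume "\<not> ?thesis"
  hence gt: "12 * g < p i * card A" "12 * g < p i * card C" by auto
  define x y where "x = real (card A)" and "y = real (card C)"
  have "{(u, v) \<in> A \<times> C. E i u v} = {}" using none by blast
  hence "edges (E i) A C = 0" unfolding edges_def by (simp only: card.empty)
  hence low: "p i * x * y / 2 \<le> 3 * g * (x + y)" using lower_p[OF i AC] by (simp add: x_def y_def)
  have pos: "0 < x" "0 < y" using gt g_ge by (auto simp: x_def y_def intro!: Nat.gr0I)
  have "12 * g * y < p i * x * y" using gt pos by (simp add: x_def)
  moreover have "12 * g * x < p i * y * x" using gt pos by (simp add: y_def)
  ultimately show False using low by (simp add: algebra_simps)
qed

text \<open>If Y were both small compared with X and sparse, each of the two terms of the upper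
  bound would account for at most half of the \<open>tau * card X\<close> edges, the density term
  for strictly less. The second alternative is saturation: Y is so large that expansion may stop,
  but then \<open>linked_by_edge\<close> applies.\<close>

lemma growth:
  assumes i: "i < L" and XY: "X \<subseteq> {1..n}" "Y \<subseteq> {1..n}"
    and deg: "\<And>q. q \<in> X \<Longrightarrow> tau \<le> card {v \<in> Y. E i q v}"
  shows "b * card X \<le> card Y \<or> tau \<le> 8 * p i * card Y"
proof (rule ccontr)
  assume neg: "\<not> ?thesis"
  define x y where "x = real (card X)" and "y = real (card Y)"
  have "real (card Y) < real (b * card X)" using neg by (simp only: of_nat_less_iff) auto
  hence y: "y < b * x" and py: "8 * p i * y < tau" using neg by (auto simp: x_def y_def)
  have x0: "0 < x" using y b_ge by (auto simp: x_def y_def intro!: Nat.gr0I)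
  have "(\<Sum>q\<in>X. tau) \<le> edges (E i) X Y"
    unfolding edges_eq_sum[OF finite_sub[OF XY(1)] finite_sub[OF XY(2)]] using deg by (intro sum_mono) simp
  hence "x * tau \<le> edges (E i) X Y" by (simp add: x_def flip: of_nat_mult)
  also have "\<dots> \<le> 4 * p i * x * y + 6 * g * (x + y)"
    using upper_p[OF i XY] by (simp add: x_def y_def)
  also have "\<dots> < x * (tau / 2) + 6 * g * (x + b * x)"
  proof -
    have "(8 * p i * y) * x < tau * x" using py x0 by (intro mult_strict_right_mono)
    moreover have "6 * g * (x + y) \<le> 6 * g * (x + b * x)" using y by (intro mult_left_mono) auto
    ultimately show ?thesis by (simp add: algebra_simps)
  qed
  finally show False using x0 by (simp add: tau_def algebra_simps)
qed

lemma linked_by_edge: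
  assumes i: "i < L" and XY: "X \<subseteq> {1..n}" "Y \<subseteq> {1..n}"
    and size: "tau \<le> 8 * p i * card X" "tau \<le> 8 * p i * card Y"
  shows "\<exists>u\<in>X. \<exists>v\<in>Y. E i u v"
proof (rule ccontr)
  assume "\<not> ?thesis"
  hence "p i * card X \<le> 12 * g \<or> p i * card Y \<le> 12 * g" using nonadjacent[OF i XY] by blast
  \<comment> \<open>Since b is at least 8, tau / 8 is at least 13.5 g, above the 12 g of
    \<open>nonadjacent\<close>.\<close>
  moreover have "12 * real g * 9 \<le> tau" unfolding tau_def using b_ge g_ge by (simp add: mult_left_mono)
  ultimately show False using size g_ge by auto
qed

text \<open>
  Members with too few neighbours are discarded one at a time. The discarded set sends few edges into
  the rest, so it cannot become large.
\<close>

lemma dense_core: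
  assumes i: "i < L" and PS: "P \<subseteq> {1..n}" "S \<subseteq> {1..n}" "P \<noteq> {}"
    and S_le: "card S \<le> b * (L + 1) * card P"
    and deg: "\<And>q. q \<in> P \<Longrightarrow> thr \<le> card {v \<in> S. E i q v}"
  shows "\<exists>C \<subseteq> P. card P \<le> 3 * card C \<and> (\<forall>q\<in>C. tau \<le> card {v \<in> C. E i q v})"
proof -
  have fin: "finite P" "finite S" using PS finite_sub by auto
  define x s where "x = real (card P)" and "s = real (card S)"
  have x0: "0 < x" using PS(3) fin by (simp add: x_def card_gt_0_iff)
  define bl where "bl = real b * (real L + 1)"
  have "real (card S) \<le> real (b * (L + 1) * card P)" using S_le by (rule of_nat_mono)
  hence s: "s \<le> bl * x" by (simp add: s_def x_def bl_def algebra_simps)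
  have bl: "8 \<le> bl" "2000 * bl \<le> real b ^ 6" "real b * real b ^ 6 = real (b ^ 7)"
  proof -
    have "8 * 1 \<le> real b * (real L + 1)" using b_powers(3) by (intro mult_mono) auto
    thus "8 \<le> bl" by (simp add: bl_def)
    have "real b * (2000 * (real L + 1)) \<le> real b * real (b ^ 5)" using b_powers(1) by (intro mult_left_mono) auto
    thus "2000 * bl \<le> real b ^ 6" by (simp add: bl_def eval_nat_numeral algebra_simps)
  qed (simp add: eval_nat_numeral)
  have b7: "16000 * bl \<le> real (b ^ 7)"
  proof -
    have "8 * (2000 * bl) \<le> real b * real b ^ 6" using bl b_powers(3) by (intro mult_mono) auto
    thus ?thesis using bl by simp
  qed
  \<comment> \<open>P must be large: S outnumbers P by at most \<open>bl\<close>, and with so few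
    potential neighbours the upper bound permits degree \<open>thr\<close> only if
    \<open>p i * x\<close> is at least a multiple of \<open>g * b\<close>.\<close>
  have "(\<Sum>q\<in>P. thr) \<le> edges (E i) P S"
    unfolding edges_eq_sum[OF fin] using deg by (intro sum_mono) simp
  hence "x * thr \<le> edges (E i) P S" by (simp add: x_def flip: of_nat_mult)
  also have "\<dots> \<le> 4 * p i * x * s + 6 * g * (x + s)"
    using upper_p[OF i PS(1,2)] by (simp add: x_def s_def)
  also have "\<dots> \<le> 4 * p i * x * (bl * x) + 6 * g * (x + bl * x)"
    using s p_pos[of i] x0 by (intro add_mono mult_left_mono) auto
  finally have "x * thr \<le> x * (4 * p i * (bl * x) + 6 * g * (1 + bl))" by (simp add: algebra_simps)
  hence "real thr \<le> 4 * bl * (p i * x) + 6 * g * (1 + bl)" using x0 by (simp add: mult_ac)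
  moreover have "6 * g * (1 + bl) \<le> g * (real (b ^ 7) / 2)"
  proof -
    have "g * (6 * (1 + bl)) \<le> g * (real (b ^ 7) / 2)" using b7 bl by (intro mult_left_mono) auto
    thus ?thesis by (simp add: algebra_simps)
  qed
  ultimately have "g * (real b * real b ^ 6) \<le> 8 * bl * (p i * x)" using bl(3) by (simp add: thr_def)
  moreover have "g * (real b * (2000 * bl)) \<le> g * (real b * real b ^ 6)"
    using bl by (intro mult_left_mono) auto
  ultimately have "bl * (2000 * (g * real b)) \<le> bl * (8 * (p i * x))" by (simp add: mult_ac)
  hence px: "250 * (g * real b) \<le> p i * x" using bl(1) by (subst (asm) mult_le_cancel_left_pos) (auto simp: mult_ac)
  have "2000 \<le> 250 * (real g * real b)"
  proof -
    have "1 * 8 \<le> real g * real b" using g_ge b_ge by (intro mult_mono) auto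
    thus ?thesis by linarith
  qed
  moreover have "p i * x \<le> 1 * x" using p_le[OF i] x0 by (intro mult_right_mono) auto
  ultimately have x_large: "2000 \<le> x" using px by linarith
  \<comment> \<open>The discarding process is replaced by a smallest set with the property it
    maintains: on average every discarded member has at most \<open>tau\<close> edges into what is
    left. The size condition stops it at a third of P.\<close>
  define ok where "ok R \<longleftrightarrow> R \<subseteq> P \<and> card P \<le> 3 * card R \<and> edges (E i) (P - R) R \<le> tau * card (P - R)" for R
  have "ok P" by (simp add: ok_def edges_def)
  then obtain C where C: "ok C" and min: "\<And>R. ok R \<Longrightarrow> card C \<le> card R"
    using ex_has_least_nat[of ok P card] by blast
  have CP: "C \<subseteq> P" and C3: "card P \<le> 3 * card C" and Ce: "edges (E i) (P - C) C \<le> tau * card (P - C)"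
    using C by (auto simp: ok_def)
  have finC: "finite C" using CP fin finite_subset by auto
  have "tau \<le> card {v \<in> C. E i q v}" if q: "q \<in> C" for q
  proof (rule ccontr)
    assume "\<not> ?thesis"
    hence lt: "card {v \<in> C. E i q v} < tau" by simp
    define R where "R = C - {q}"
    have PR: "P - R = insert q (P - C)" using q CP by (auto simp: R_def)
    have finR: "finite R" and qn: "q \<notin> P - C" using finC q by (auto simp: R_def)
    have "edges (E i) (P - R) R = card {v \<in> R. E i q v} + edges (E i) (P - C) R"
      unfolding PR using fin finR qn by (intro edges_insert_left) auto
    also have "\<dots> \<le> tau + tau * card (P - C)"
    proof (rule add_mono)
      have "card {v \<in> R. E i q v} \<le> card {v \<in> C. E i q v}" by (rule card_mono) (use finC in \<open>auto simp: R_def\<close>)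
      thus "card {v \<in> R. E i q v} \<le> tau" using lt by simp
      have "edges (E i) (P - C) R \<le> edges (E i) (P - C) C" using fin finC by (intro edges_mono) (auto simp: R_def)
      thus "edges (E i) (P - C) R \<le> tau * card (P - C)" using Ce by simp
    qed
    also have "\<dots> = tau * card (P - R)"
    proof -
      have "card (P - R) = Suc (card (P - C))" unfolding PR by (rule card_insert_disjoint) (use fin qn in auto)
      thus ?thesis by simp
    qed
    finally have eR: "edges (E i) (P - R) R \<le> tau * card (P - R)" .
    have cR: "card C = Suc (card R)" using card_Suc_Diff1[OF finC q] by (simp add: R_def)
    hence "\<not> ok R" using min by fastforce
    \<comment> \<open>The edge condition holds for R, so by minimality of C the size condition must
      fail. Hence R has about a third of P and P - R the rest; the lower bound between two such
      large sets contradicts the few edges between them.\<close>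
    hence lt3: "3 * card R < card P" using eR CP by (auto simp: ok_def R_def)
    define r a where "r = real (card R)" and "a = real (card (P - R))"
    have RP: "R \<subseteq> P" using CP by (auto simp: R_def)
    have "card (P - R) = card P - card R" "card R \<le> card P" using RP fin finR
      by (auto simp: card_Diff_subset card_mono)
    hence ax: "a = x - r" by (simp add: a_def x_def r_def of_nat_diff)
    have r3: "3 * r < x" "x \<le> 3 * r + 3" using lt3 C3 cR by (auto simp: r_def x_def)
    have a0: "2 * x \<le> 3 * a" using ax r3 by linarith
    have r4: "x \<le> 4 * r" using r3 x_large by linarith
    have "p i * a * r / 2 \<le> edges (E i) (P - R) R + 3 * g * (a + r)"
      using lower_p[OF i, of "P - R" R] PS RP by (simp add: a_def r_def) blast
    also have "\<dots> \<le> tau * a + 3 * g * (3 / 2 * a)"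
    proof (rule add_mono)
      show "edges (E i) (P - R) R \<le> tau * a" using eR by (simp add: a_def flip: of_nat_mult)
      show "3 * g * (a + r) \<le> 3 * g * (3 / 2 * a)" using ax a0 by (intro mult_left_mono) auto
    qed
    finally have "a * (p i * r / 2) \<le> a * (tau + 9 / 2 * g)" by (simp add: algebra_simps)
    hence "p i * r / 2 \<le> tau + 9 / 2 * g" using a0 x_large by (subst (asm) mult_le_cancel_left_pos) auto
    moreover have "p i * x \<le> p i * (4 * r)" using r4 p_pos[of i] by (intro mult_left_mono) auto
    moreover have "real g * 8 \<le> real g * real b" using b_ge by (intro mult_left_mono) auto
    moreover have "1 \<le> real g" using g_ge by simp
    moreover have "real tau = 12 * (real g * real b) + 12 * real g" by (simp add: tau_def algebra_simps)
    ultimately show False using px by linarith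
  qed
  thus ?thesis using CP C3 by blast
qed

text \<open>From index L on the condition is void, which makes this the complete graph.\<close>

definition nbr :: "nat \<Rightarrow> nat \<Rightarrow> nat set" where
  "nbr i q = {v. i < L \<longrightarrow> E i q v}"

text \<open>The fraction c / b^i of senders cancels the growth of the degrees, leaving p |X| \<le> 4
  c g b^8; the additive error is harmless because X is contained in W. On the complete graph,
  \<open>n_le\<close> bounds |X| directly. The result is proportional to |W| so that the costs of
  disjoint blocks can be added up.\<close>

lemma volume:
  fixes c :: real
  assumes i: "i \<le> L" and XW: "X \<subseteq> W" "W \<subseteq> {1..n}" and X: "card X * real b ^ i \<le> c * n" and c: "1 \<le> c"
  shows "(\<Sum>q\<in>X. card (nbr i q \<inter> W)) \<le> 28 * c * (g * real b ^ 8) * card W"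
proof -
  have fin: "finite W" "finite X" using XW finite_sub finite_subset by auto
  define x w where "x = real (card X)" and "w = real (card W)"
  have "real g * 1 \<le> real g * real b ^ 8" using b_ge by (intro mult_left_mono one_le_power) auto
  hence bg: "real g \<le> real g * real b ^ 8" by simp
  show ?thesis
  proof (cases "i < L")
    case True
    have px: "p i * x \<le> 4 * c * (g * real b ^ 8)"
    proof -
      have "4 * g * real b ^ 8 * (x * real b ^ i) \<le> 4 * g * real b ^ 8 * (c * n)"
        using X by (intro mult_left_mono) (auto simp: x_def)
      thus ?thesis using n_ge by (simp add: p_def power_add field_simps)
    qed
    have "(\<Sum>q\<in>X. card (nbr i q \<inter> W)) = edges (E i) X W"
      unfolding edges_eq_sum[OF fin(2,1)] using True by (intro sum.cong refl arg_cong[where f = card]) (auto simp: nbr_def)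
    hence "(\<Sum>q\<in>X. real (card (nbr i q \<inter> W))) = real (edges (E i) X W)"
      by (simp flip: of_nat_sum)
    also have "real (edges (E i) X W) \<le> 4 * p i * x * w + 6 * g * (x + w)"
      using upper_p[OF True, of X W] XW by (simp add: x_def w_def) 
    also have "\<dots> \<le> 16 * c * (g * real b ^ 8) * w + 12 * c * (g * real b ^ 8) * w"
    proof (rule add_mono)
      have "4 * (p i * x) * w \<le> 4 * (4 * c * (g * real b ^ 8)) * w"
        using px by (intro mult_right_mono mult_left_mono) (auto simp: w_def)
      thus "4 * p i * x * w \<le> 16 * c * (g * real b ^ 8) * w" by (simp add: mult_ac)
      have xw: "x \<le> w" using card_mono[OF fin(1) XW(1)] by (simp add: x_def w_def)
      have "1 * real g \<le> c * (g * real b ^ 8)" using c bg by (intro mult_mono) auto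
      hence "6 * real g * (x + w) \<le> 6 * (c * (g * real b ^ 8)) * (w + w)"
        using xw c by (intro mult_mono) (auto simp: x_def w_def)
      thus "6 * g * (x + w) \<le> 12 * c * (g * real b ^ 8) * w" by (simp add: algebra_simps)
    qed
    finally show ?thesis by (simp add: w_def algebra_simps)
  next
    case False
    hence iL: "i = L" using i by simp
    have "x * real b ^ L \<le> c * (4 * g * real b ^ (L + 8))"
    proof -
      have "real n \<le> real (4 * g * b ^ (L + 8))" using n_le by (rule of_nat_mono)
      hence "c * n \<le> c * (4 * g * real b ^ (L + 8))" using c by (intro mult_left_mono) auto
      thus ?thesis using X iL by (simp add: x_def)
    qed
    also have "\<dots> = (4 * c * (g * real b ^ 8)) * real b ^ L" by (simp add: power_add)
    finally have "x \<le> 4 * c * (g * real b ^ 8)" using b_ge by simp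
    hence "x * w \<le> 4 * c * (g * real b ^ 8) * w" by (intro mult_right_mono) (auto simp: w_def)
    also have "\<dots> \<le> 28 * c * (g * real b ^ 8) * w" using c by (intro mult_right_mono) (auto simp: w_def)
    finally have "x * w \<le> 28 * c * (g * real b ^ 8) * w" .
    moreover have "(\<Sum>q\<in>X. card (nbr i q \<inter> W)) = card X * card W" using False by (simp add: nbr_def)
    ultimately show ?thesis by (simp add: x_def w_def)
  qed
qed

end

subsection \<open>A single attempt\<close>

context overlay begin

text \<open>
  The positions of an attempt: 0, ..., L - 1 are the steps in which the processes settle, L is the first
  contact on the personal level l, then follow 2 h + 1 probing steps, and last_pos is the second contact.
  The estimate e is the index of the graph under consideration, act says that a process has not become passive.
\<close>

definition last_pos :: nat where "last_pos = L + 2 * h + 2"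

definition target :: "nat \<Rightarrow> nat \<Rightarrow> nat \<Rightarrow> nat \<Rightarrow> bool \<Rightarrow> nat set" where
  "target t l q e act =
     (if t < L then (if e = t then nbr t q else {})
      else if t = L \<or> t = last_pos then nbr l q
      else if act then nbr e q else {})"

end

text \<open>One attempt without messages and configurations. Contact works in both directions
  because requests are answered. Full delivery is guaranteed only between processes that survive the
  step; what is heard from a process crashing in the step is up to the adversary, within
  \<open>heard_alive\<close> and \<open>heard_only\<close>.\<close>

locale attempt = overlay +
  fixes W :: "nat set" and S :: "nat \<Rightarrow> nat set" and H :: "nat \<Rightarrow> nat \<Rightarrow> nat set"
    and est :: "nat \<Rightarrow> nat \<Rightarrow> nat" and ok :: "nat \<Rightarrow> nat \<Rightarrow> bool" and lev :: "nat \<Rightarrow> nat"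
  assumes W: "W \<subseteq> {1..n}" "S 0 \<subseteq> W"
    and S_Suc: "\<And>t. t \<le> last_pos \<Longrightarrow> S (Suc t) \<subseteq> S t"
    and heard: "\<And>t q u. t \<le> last_pos \<Longrightarrow> q \<in> S (Suc t) \<Longrightarrow> u \<in> S (Suc t) \<Longrightarrow>
        u \<in> target t (lev q) q (est t q) (ok t q) \<or> q \<in> target t (lev u) u (est t u) (ok t u) \<Longrightarrow> u \<in> H t q"
    and heard_alive: "\<And>t q u. t \<le> last_pos \<Longrightarrow> q \<in> S (Suc t) \<Longrightarrow> u \<in> H t q \<Longrightarrow> u \<in> S t"
    and heard_only: "\<And>t q u. t \<le> last_pos \<Longrightarrow> q \<in> S (Suc t) \<Longrightarrow> u \<in> H t q \<Longrightarrow>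
        u \<in> target t (lev q) q (est t q) (ok t q) \<or> q \<in> target t (lev u) u (est t u) (ok t u)"
    and est_0: "\<And>q. q \<in> S 0 \<Longrightarrow> est 0 q = 0" and ok_0: "\<And>q. q \<in> S 0 \<Longrightarrow> ok 0 q"
    and est_step: "\<And>t q. t < L \<Longrightarrow> q \<in> S (Suc t) \<Longrightarrow>
        est (Suc t) q = (if est t q = t \<and> card (H t q \<inter> nbr t q) < thr then Suc t else est t q)"
    and est_const: "\<And>t q. L \<le> t \<Longrightarrow> t < last_pos \<Longrightarrow> q \<in> S (Suc t) \<Longrightarrow> est (Suc t) q = est t q"
    and ok_const: "\<And>t q. t \<le> L \<Longrightarrow> q \<in> S (Suc t) \<Longrightarrow> ok (Suc t) q = ok t q"
    and ok_step: "\<And>t q. L < t \<Longrightarrow> t < last_pos \<Longrightarrow> q \<in> S (Suc t) \<Longrightarrow>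
        ok (Suc t) q = (ok t q \<and> (est t q = L \<or>
          tau \<le> card {u \<in> H t q \<inter> nbr (est t q) q. est t u = est t q \<and> ok t u}))"
begin

definition happy :: "nat \<Rightarrow> bool" where
  "happy q \<longleftrightarrow> ok last_pos q \<or> (\<exists>u\<in>H last_pos q. ok last_pos u)"

lemma S_mono: "s \<le> t \<Longrightarrow> t \<le> Suc last_pos \<Longrightarrow> S t \<subseteq> S s"
proof (induction t rule: dec_induct)
  case (step t)
  thus ?case using S_Suc[of t] by auto
qed simp

lemma S_sub: "t \<le> Suc last_pos \<Longrightarrow> S t \<subseteq> W" "t \<le> Suc last_pos \<Longrightarrow> S t \<subseteq> {1..n}"
  using S_mono[of 0 t] W by auto

lemma finite_S: "t \<le> Suc last_pos \<Longrightarrow> finite (S t)" and finite_W: "finite W"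
  using S_sub(2) W finite_sub by auto

lemma finite_H: "t \<le> last_pos \<Longrightarrow> q \<in> S (Suc t) \<Longrightarrow> finite (H t q)"
  using finite_subset[of "H t q" "S t"] heard_alive finite_S[of t] by auto

lemma est_le: "t \<le> L \<Longrightarrow> q \<in> S t \<Longrightarrow> est t q \<le> t"
proof (induction t)
  case (Suc t)
  have "q \<in> S t" using S_Suc[of t] Suc.prems by (auto simp: last_pos_def)
  thus ?case using Suc est_step[of t q] by (auto simp: le_Suc_eq)
qed (simp add: est_0)

lemma est_L: "L \<le> t \<Longrightarrow> t \<le> last_pos \<Longrightarrow> q \<in> S t \<Longrightarrow> est t q = est L q"
proof (induction t rule: dec_induct)
  case (step t)
  have "q \<in> S t" using S_Suc[of t] step.prems step.hyps by auto
  thus ?case using step est_const[of t q] by simp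
qed simp

lemma est_le_L: "L \<le> t \<Longrightarrow> t \<le> last_pos \<Longrightarrow> q \<in> S t \<Longrightarrow> est t q \<le> L"
  using est_L[of t q] est_le[of L q] S_mono[of L t] by auto

text \<open>An estimate moves only when it equals the clock, and then by one. A process that gets to
  i has therefore climbed in every step before i.\<close>

lemma est_reached:
  assumes "i \<le> t" "t \<le> L" "q \<in> S t" "i \<le> est t q"
  shows "est i q = i"
  using assms
proof (induction t rule: dec_induct)
  case base
  thus ?case using est_le[of i q] by simp
next
  case (step t)
  have q: "q \<in> S t" using S_Suc[of t] step.prems by (auto simp: last_pos_def)
  have "i \<le> est t q" using est_step[of t q] step by (auto split: if_splits)
  thus ?case using step q by simp
qed

lemma raised_deficient:
  assumes "i < t" "t \<le> L" "q \<in> S t" "i < est t q"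
  shows "card (H i q \<inter> nbr i q) < thr"
proof -
  have q: "q \<in> S (Suc i)" using assms S_mono[of "Suc i" t] by (auto simp: last_pos_def)
  have "est (Suc i) q = Suc i" using est_reached[of "Suc i" t q] assms by simp
  moreover have "est i q = i" using est_reached[of i t q] assms by simp
  ultimately show ?thesis using est_step[of i q] q assms by (auto split: if_splits)
qed

lemma settled_dense:
  assumes "i < t" "t \<le> L" "q \<in> S t" "est t q = i"
  shows "thr \<le> card (H i q \<inter> nbr i q)"
proof -
  have q: "q \<in> S (Suc i)" using assms S_mono[of "Suc i" t] by (auto simp: last_pos_def)
  have i: "est i q = i" using est_reached[of i t q] assms by simp
  show ?thesis
  proof (rule ccontr)
    assume "\<not> ?thesis"
    hence 1: "est (Suc i) q = Suc i" using est_step[of i q] q assms i by simp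
    have "Suc i \<le> est s q" if "Suc i \<le> s" "s \<le> t" for s
      using that
    proof (induction s rule: dec_induct)
      case (step s)
      have "q \<in> S (Suc s)" using assms step S_mono[of "Suc s" t] by (auto simp: last_pos_def)
      thus ?case using est_step[of s q] step assms by auto
    qed (use 1 in simp)
    from this[of t] show False using assms by simp
  qed
qed

text \<open>Whoever got past graph i - 1 heard fewer than \<open>thr\<close> neighbours there.
  Survivors of a later position were all heard at that time, so the degree into the present set of
  survivors is small as well, and \<open>few_deficient\<close> applies to that set.\<close>

lemma few_est:
  assumes t: "t \<le> last_pos" and i: "i \<le> L"
  shows "card {q \<in> S t. i \<le> est t q} * b ^ i \<le> n"
proof (cases i)
  case 0
  have "card (S t) \<le> card {1..n}" using S_sub(2)[of t] t by (intro card_mono) auto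
  thus ?thesis using 0 by simp
next
  case (Suc j)
  define X where "X = {q \<in> S t. i \<le> est t q}"
  define s where "s = min t L"
  have s: "s \<le> L" "s \<le> t" "s \<le> last_pos" using t by (auto simp: s_def)
  have XS: "q \<in> S s \<and> i \<le> est s q" if "q \<in> X" for q
  proof -
    have q: "q \<in> S t" "i \<le> est t q" using that by (auto simp: X_def)
    hence "q \<in> S s" using S_mono[of s t] s t by auto
    moreover have "est t q = est s q" using est_L[of t q] q t by (auto simp: s_def min_def)
    ultimately show ?thesis using q by simp
  qed
  show ?thesis
  proof (cases "i \<le> s")
    case False
    hence "X = {}" using XS est_le[OF s(1)] by fastforce
    hence "card X * b ^ i \<le> n" by simp
    thus ?thesis unfolding X_def .
  next
    case True
    have "card {v \<in> S t. E j q v} < thr" if q: "q \<in> X" for q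
    proof -
      have qs: "q \<in> S s" "j < est s q" "q \<in> S t" using XS[OF q] Suc q by (auto simp: X_def)
      have j: "j < s" "j < L" "j \<le> last_pos" "Suc j \<le> t" "Suc j \<le> s" using True Suc i s by auto
      have low: "card (H j q \<inter> nbr j q) < thr" using raised_deficient[of j s q] qs j s by simp
      have qj: "q \<in> S (Suc j)" using S_mono[of "Suc j" t] qs j t by auto
      have e: "est j q = j" using est_reached[of j s q] qs j s by simp
      have "{v \<in> S t. E j q v} \<subseteq> H j q \<inter> nbr j q"
      proof
        fix v assume v: "v \<in> {v \<in> S t. E j q v}"
        have "v \<in> S (Suc j)" using S_mono[of "Suc j" t] v j t by auto
        moreover have "v \<in> nbr j q" using v by (simp add: nbr_def)
        ultimately show "v \<in> H j q \<inter> nbr j q"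
          using heard[of j q v] qj j e by (simp add: target_def)
      qed
      hence "card {v \<in> S t. E j q v} \<le> card (H j q \<inter> nbr j q)"
        using finite_H[of j q] qj j by (intro card_mono) auto
      thus ?thesis using low by simp
    qed
    moreover have "X \<subseteq> S t" by (auto simp: X_def)
    ultimately have "card X * b ^ Suc j \<le> n"
      using few_deficient[of j X "S t"] Suc i t S_sub(2)[of t] by simp
    thus ?thesis using Suc by (simp add: X_def)
  qed
qed

text \<open>Away from the two contacts a process addresses at most its neighbours on graph
  \<open>est t q\<close>. Each of the L + 1 classes of equal estimate stays within the same budget
  by \<open>few_est\<close>.\<close>

lemma quiet_volume:
  assumes t: "t < last_pos" "t \<noteq> L"
  shows "(\<Sum>q\<in>S t. card (target t (lev q) q (est t q) (ok t q) \<inter> W)) \<le> (L + 1) * (28 * (g * real b ^ 8) * card W)"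
proof -
  define X where "X i = {q \<in> S t. est t q = i}" for i
  have fin: "finite (S t)" using finite_S t by simp
  have le: "est t q \<le> L" if "q \<in> S t" for q
  proof (cases "t < L")
    case True
    thus ?thesis using est_le[of t q] that by simp
  next
    case False
    thus ?thesis using est_le_L[of t q] that t by simp
  qed
  have "card (target t (lev q) q (est t q) (ok t q) \<inter> W) \<le> card (nbr (est t q) q \<inter> W)" for q
    by (rule card_mono) (use finite_W t in \<open>auto simp: target_def split: if_splits\<close>)
  hence "(\<Sum>q\<in>S t. real (card (target t (lev q) q (est t q) (ok t q) \<inter> W)))
         \<le> (\<Sum>q\<in>S t. real (card (nbr (est t q) q \<inter> W)))" by (intro sum_mono) simp
  also have "\<dots> = (\<Sum>i\<le>L. \<Sum>q\<in>X i. real (card (nbr i q \<inter> W)))"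
  proof -
    have "(\<Sum>q\<in>S t. real (card (nbr (est t q) q \<inter> W)))
          = (\<Sum>i\<le>L. \<Sum>q\<in>{q \<in> S t. est t q = i}. real (card (nbr (est t q) q \<inter> W)))"
      by (rule sum.group[symmetric]) (use fin le in auto)
    thus ?thesis by (simp add: X_def)
  qed
  also have "\<dots> \<le> (\<Sum>i\<le>L. 28 * 1 * (g * real b ^ 8) * card W)"
  proof (rule sum_mono)
    fix i assume i: "i \<in> {..L}"
    have "card (X i) \<le> card {q \<in> S t. i \<le> est t q}" by (rule card_mono) (use fin in \<open>auto simp: X_def\<close>)
    hence "card (X i) * b ^ i \<le> card {q \<in> S t. i \<le> est t q} * b ^ i" by (rule mult_right_mono) simp
    also have "\<dots> \<le> n" using few_est[of t i] t i by simp
    finally have "real (card (X i) * b ^ i) \<le> real n" by (rule of_nat_mono)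
    moreover have "X i \<subseteq> W" using S_sub(1)[of t] t by (auto simp: X_def)
    ultimately show "(\<Sum>q\<in>X i. real (card (nbr i q \<inter> W))) \<le> 28 * 1 * (g * real b ^ 8) * card W"
      using volume[of i "X i" W 1] i W by simp
  qed
  finally show ?thesis by simp
qed

section \<open>Survival of an active core\<close>

lemma ok_antimono:
  assumes "s \<le> t" "t \<le> last_pos" "q \<in> S t" "ok t q"
  shows "ok s q"
  using assms
proof (induction t rule: dec_induct)
  case (step t)
  have "q \<in> S t" using S_Suc[of t] step.prems step.hyps by auto
  moreover have "ok t q"
    using ok_const[of t q] ok_step[of t q] step.prems by (cases "t \<le> L") auto
  ultimately show ?case using step by simp
qed

lemma ok_until_L: "t \<le> Suc L \<Longrightarrow> q \<in> S t \<Longrightarrow> ok t q"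
proof (induction t)
  case (Suc t)
  have "q \<in> S t" using S_Suc[of t] Suc.prems by (auto simp: last_pos_def)
  thus ?case using Suc ok_const[of t q] by simp
qed (simp add: ok_0)

text \<open>C supports itself: its members survive the attempt, probe the same graph and hear each
  other in every step, so the degrees inside C alone keep all of them active. On the complete graph
  no threshold is imposed.\<close>

lemma ok_persists:
  assumes C: "C \<subseteq> S (Suc last_pos)" and e: "\<And>q. q \<in> C \<Longrightarrow> est L q = e"
    and deg: "e = L \<or> (\<forall>q\<in>C. tau \<le> card {v \<in> C. E e q v})" and e_le: "e \<le> L"
    and t: "t \<le> last_pos"
  shows "\<forall>q\<in>C. ok t q"
proof (cases "t \<le> Suc L")
  case True
  thus ?thesis using ok_until_L S_mono[of t "Suc last_pos"] C t by auto
next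
  case False
  hence "Suc L \<le> t" by simp
  thus ?thesis using t
  proof (induction t rule: dec_induct)
    case base
    thus ?case using ok_until_L[of "Suc L"] S_mono[of "Suc L" "Suc last_pos"] C by auto
  next
    case (step t)
    have ih: "\<forall>q\<in>C. ok t q" using step by simp
    have CS: "C \<subseteq> S (Suc t)" "C \<subseteq> S t" using S_mono[of "Suc t" "Suc last_pos"] S_mono[of t "Suc last_pos"] C step.prems by auto
    have et: "est t q = e" if "q \<in> C" for q using est_L[of t q] e[OF that] CS that step by auto
    show ?case
    proof
      fix q assume q: "q \<in> C"
      have "e = L \<or> tau \<le> card {u \<in> H t q \<inter> nbr e q. est t u = e \<and> ok t u}"
      proof (cases "e = L")
        case False
        have "{v \<in> C. E e q v} \<subseteq> {u \<in> H t q \<inter> nbr e q. est t u = e \<and> ok t u}"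
        proof
          fix v assume v: "v \<in> {v \<in> C. E e q v}"
          hence nb: "v \<in> nbr e q" by (simp add: nbr_def)
          have "v \<in> target t (lev q) q (est t q) (ok t q)"
            using nb et[OF q] ih q step by (auto simp: target_def)
          hence "v \<in> H t q" using heard[of t q v] CS q v step by auto
          thus "v \<in> {u \<in> H t q \<inter> nbr e q. est t u = e \<and> ok t u}" using nb v et ih by auto
        qed
        moreover have "finite (H t q)" using finite_H[of t q] CS q step by auto
        ultimately have "card {v \<in> C. E e q v} \<le> card {u \<in> H t q \<inter> nbr e q. est t u = e \<and> ok t u}"
          by (intro card_mono) auto
        thus ?thesis using deg q False by force
      qed simp
      thus "ok (Suc t) q" using ok_step[of t q] et[OF q] ih q CS step by auto
    qed
  qed
qed

text \<open>Some estimate is shared by a fraction 1 / (L + 1) of the survivors. These had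
  \<open>thr\<close> neighbours that were alive at the start, and the start set is larger by at most
  b (L + 1), which is what \<open>dense_core\<close> requires. The core keeps another third.\<close>

lemma core:
  assumes good: "card (S 0) \<le> b * card (S (Suc last_pos))" and ne: "S (Suc last_pos) \<noteq> {}"
  shows "\<exists>C \<subseteq> S (Suc last_pos). (\<forall>q\<in>C. ok last_pos q) \<and> card (S (Suc last_pos)) \<le> 3 * (L + 1) * card C"
proof -
  define T where "T = S (Suc last_pos)"
  have L_le_pos: "L \<le> Suc last_pos" "L \<le> last_pos" by (auto simp: last_pos_def)
  have T: "finite T" "T \<noteq> {}" "T \<subseteq> S L" "T \<subseteq> {1..n}"
    using finite_S[of "Suc last_pos"] ne S_mono[of L "Suc last_pos"] S_sub(2)[of "Suc last_pos"] L_le_pos by (auto simp: T_def)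
  define P where "P e = {q \<in> T. est L q = e}" for e
  have "card T = (\<Sum>e\<le>L. card (P e))"
  proof -
    have "(\<Sum>q\<in>T. 1) = (\<Sum>e\<le>L. \<Sum>q\<in>{q \<in> T. est L q = e}. 1::nat)"
      by (rule sum.group[symmetric]) (use T est_le[of L] in auto)
    thus ?thesis by (simp add: P_def)
  qed
  have "\<exists>e\<le>L. card T \<le> (L + 1) * card (P e)"
  proof (rule ccontr)
    assume "\<not> ?thesis"
    hence "(L + 1) * card (P e) < card T" if "e \<le> L" for e using that by auto
    hence "(\<Sum>e\<le>L. (L + 1) * card (P e)) < (\<Sum>e\<le>L. card T)" by (intro sum_strict_mono) auto
    moreover have "(\<Sum>e\<le>L. (L + 1) * card (P e)) = (L + 1) * card T"
      unfolding \<open>card T = _\<close> by (rule sum_distrib_left[symmetric])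
    ultimately show False by simp
  qed
  then obtain e where e: "e \<le> L" and pop: "card T \<le> (L + 1) * card (P e)" by blast
  have PT: "P e \<subseteq> T" by (auto simp: P_def)
  have "0 < card T" using T by (simp add: card_gt_0_iff)
  hence Pne: "P e \<noteq> {}" using pop by auto
  have "\<exists>C \<subseteq> P e. card (P e) \<le> 3 * card C \<and> (e = L \<or> (\<forall>q\<in>C. tau \<le> card {v \<in> C. E e q v}))"
  proof (cases "e = L")
    case False
    hence eL: "e < L" using e by simp
    have "card (S 0) \<le> b * ((L + 1) * card (P e))"
      using good mult_le_mono2[OF pop, of b] unfolding T_def by (rule order_trans)
    hence S0: "card (S 0) \<le> b * (L + 1) * card (P e)" by (simp only: mult.assoc)
    have deg: "thr \<le> card {v \<in> S 0. E e q v}" if q: "q \<in> P e" for q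
    proof -
      have qL: "q \<in> S L" "est L q = e" using q T by (auto simp: P_def)
      have "q \<in> S (Suc e)" using S_mono[of "Suc e" "Suc last_pos"] q PT eL by (auto simp: T_def last_pos_def)
      hence "H e q \<subseteq> S 0" using heard_alive[of e q] S_mono[of 0 e] eL by (auto simp: last_pos_def)
      hence "H e q \<inter> nbr e q \<subseteq> {v \<in> S 0. E e q v}" using eL by (auto simp: nbr_def)
      hence "card (H e q \<inter> nbr e q) \<le> card {v \<in> S 0. E e q v}" using finite_S[of 0] by (intro card_mono) auto
      thus ?thesis using settled_dense[OF eL _ qL] by simp
    qed
    have sub: "P e \<subseteq> {1..n}" "S 0 \<subseteq> {1..n}" using PT T S_sub(2)[of 0] by auto
    show ?thesis using dense_core[OF eL sub Pne S0 deg] by blast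
  next
    case True
    show ?thesis by (intro exI[of _ "P e"]) (simp add: True)
  qed
  then obtain C where C: "C \<subseteq> P e" "card (P e) \<le> 3 * card C" "e = L \<or> (\<forall>q\<in>C. tau \<le> card {v \<in> C. E e q v})"
    by blast
  have "\<forall>q\<in>C. ok last_pos q"
    by (rule ok_persists[OF _ _ C(3) e]) (use C PT in \<open>auto simp: T_def P_def\<close>)
  moreover have "card T \<le> 3 * (L + 1) * card C"
  proof -
    have "card T \<le> (L + 1) * (3 * card C)"
      using pop mult_le_mono2[OF C(2), of "L + 1"] by (rule order_trans)
    also have "\<dots> = 3 * (L + 1) * card C" by (simp only: mult_ac)
    finally show ?thesis .
  qed
  moreover have "C \<subseteq> S (Suc last_pos)" using C PT by (auto simp: T_def)
  ultimately show ?thesis unfolding T_def by (intro exI[of _ C] conjI)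
qed

text \<open>Information is abstracted to a family of informed sets that is closed under hearing; the
  eventual instance is knowledge of one entry of the table of counts.\<close>

definition spreads :: "(nat \<Rightarrow> nat set) \<Rightarrow> bool" where
  "spreads I \<longleftrightarrow> (\<forall>t q. t \<le> last_pos \<longrightarrow> q \<in> S (Suc t) \<longrightarrow> (\<exists>u\<in>insert q (H t q). u \<in> I t) \<longrightarrow> q \<in> I (Suc t))"

lemma spread: "spreads I \<Longrightarrow> t \<le> last_pos \<Longrightarrow> q \<in> S (Suc t) \<Longrightarrow> u \<in> insert q (H t q) \<Longrightarrow> u \<in> I t \<Longrightarrow> q \<in> I (Suc t)"
  unfolding spreads_def by blast

text \<open>
  Surviving the probing steps with threshold tau forces a large ball of nodes around v that were alive
  and active long enough to learn from v early and to inform v late.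
\<close>

lemma ball:
  assumes sp: "spreads I"
    and v: "v \<in> S last_pos" "ok last_pos v" and e: "est L v = e" "e < L"
  shows "r \<le> h \<Longrightarrow> \<exists>B. B \<subseteq> S (last_pos - r) \<and> (\<forall>w\<in>B. ok (last_pos - r) w \<and> est L w = e) \<and>
           (b ^ r \<le> card B \<or> tau \<le> 8 * p e * card B) \<and>
           (v \<in> I (L + 1) \<longrightarrow> B \<subseteq> I (L + 1 + r)) \<and> (B \<inter> I (last_pos - r) \<noteq> {} \<longrightarrow> v \<in> I last_pos)"
proof (induction r)
  case 0
  show ?case by (intro exI[of _ "{v}"]) (use v e in auto)
next
  case (Suc r)
  \<comment> \<open>The ball is built backwards in time: a member w that is active at
    \<open>Suc s\<close> must have heard \<open>tau\<close> active neighbours at s, and these form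
    the next layer.\<close>
  define s where "s = last_pos - Suc r"
  have s: "Suc s = last_pos - r" "s < last_pos" "L < s" "L + 2 + r \<le> s"
    using Suc.prems by (auto simp: s_def last_pos_def)
  obtain B where B: "B \<subseteq> S (Suc s)" and Bok: "\<And>w. w \<in> B \<Longrightarrow> ok (Suc s) w \<and> est L w = e"
    and Bsize: "b ^ r \<le> card B \<or> tau \<le> 8 * p e * card B"
    and Bfwd: "v \<in> I (L + 1) \<Longrightarrow> B \<subseteq> I (L + 1 + r)" and Bbwd: "B \<inter> I (Suc s) \<noteq> {} \<Longrightarrow> v \<in> I last_pos"
    using Suc unfolding s(1) by auto
  define N where "N w = {u \<in> H s w \<inter> nbr e w. est s u = e \<and> ok s u}" for w
  define B' where "B' = (\<Union>w\<in>B. N w)"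
  have NS: "N w \<subseteq> S s" if "w \<in> B" for w using heard_alive[of s w] B that s by (auto simp: N_def)
  have B'S: "B' \<subseteq> S s" using NS by (auto simp: B'_def)
  have B'ok: "ok s u \<and> est L u = e" if "u \<in> B'" for u
    using that B'S est_L[of s u] s by (auto simp: B'_def N_def)
  have Bs: "est s w = e" "w \<in> S s" if "w \<in> B" for w
  proof -
    show "w \<in> S s" using that B S_Suc[of s] s by auto
    thus "est s w = e" using est_L[of s w] Bok[OF that] s by simp
  qed
  have deg: "tau \<le> card {u \<in> B'. E e w u}" if w: "w \<in> B" for w
  proof -
    have "tau \<le> card (N w)"
      using ok_step[of s w] Bok[OF w] B w s Bs[OF w] e by (auto simp: N_def)
    also have "\<dots> \<le> card {u \<in> B'. E e w u}"
    proof (rule card_mono)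
      show "finite {u \<in> B'. E e w u}" using finite_subset[OF B'S finite_S] s by simp
      show "N w \<subseteq> {u \<in> B'. E e w u}" using w e by (auto simp: B'_def N_def nbr_def)
    qed
    finally show ?thesis .
  qed
  \<comment> \<open>If B' is not saturated, \<open>growth\<close> makes it larger than B by the
    factor b. Then B was not saturated either, so its size was at least
    \<open>b ^ r\<close>.\<close>
  have size: "b ^ Suc r \<le> card B' \<or> tau \<le> 8 * p e * card B'"
  proof (cases "tau \<le> 8 * p e * card B'")
    case False
    have sub: "B \<subseteq> {1..n}" "B' \<subseteq> {1..n}" using B B'S S_sub(2)[of "Suc s"] S_sub(2)[of s] s by auto
    have bB: "b * card B \<le> card B'" using growth[OF e(2) sub deg] False by auto
    moreover have "1 * card B \<le> b * card B" using b_ge by (intro mult_right_mono) auto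
    ultimately have "card B \<le> card B'" by linarith
    hence "8 * p e * card B \<le> 8 * p e * card B'" using p_pos[of e] by (intro mult_left_mono) auto
    hence "b ^ r \<le> card B" using Bsize False by linarith
    hence "b * b ^ r \<le> b * card B" by (rule mult_le_mono2)
    hence "b ^ Suc r \<le> card B'" using bB by (simp only: power_Suc)
    thus ?thesis ..
  qed simp
  \<comment> \<open>The edges found late are reused early: whoever is active at a late position was
    active at position L + 1 + r too, and contacted the same neighbours then.\<close>
  have fwd: "B' \<subseteq> I (L + 1 + Suc r)" if vI: "v \<in> I (L + 1)"
  proof
    fix u assume "u \<in> B'"
    then obtain w where w: "w \<in> B" "u \<in> N w" by (auto simp: B'_def)
    define t where "t = L + 1 + r"
    have t: "L < t" "t < last_pos" "Suc t \<le> s" using s by (auto simp: t_def)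
    have alive: "w \<in> S (Suc t)" "u \<in> S (Suc t)"
      using Bs[OF w(1)] NS[OF w(1)] w S_mono[of "Suc t" s] t s by auto
    have wt: "w \<in> S t" using alive S_Suc[of t] t by auto
    have "ok t w" using ok_antimono[of t "Suc s" w] Bok[OF w(1)] B w t s by auto
    moreover have "est t w = e" using est_L[of t w] wt Bok[OF w(1)] t by simp
    moreover have "u \<in> nbr e w" using w by (simp add: N_def)
    ultimately have "u \<in> target t (lev w) w (est t w) (ok t w)" using t by (simp add: target_def)
    hence "w \<in> H t u" using heard[of t u w] alive t by simp
    moreover have "w \<in> I t" using Bfwd[OF vI] w by (auto simp: t_def)
    ultimately show "u \<in> I (L + 1 + Suc r)" using spread[OF sp, of t u w] alive t by (simp add: t_def)
  qed
  have bwd: "v \<in> I last_pos" if ne: "B' \<inter> I s \<noteq> {}"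
  proof -
    obtain u w where uw: "u \<in> I s" "w \<in> B" "u \<in> N w" using ne unfolding B'_def by blast
    hence "w \<in> I (Suc s)" using spread[OF sp, of s w u] B s by (auto simp: N_def)
    thus ?thesis using Bbwd uw by auto
  qed
  show ?case
    unfolding s_def[symmetric]
  proof (intro exI[of _ B'] conjI ballI impI)
    show "B' \<subseteq> S s" by (rule B'S)
    show "b ^ Suc r \<le> card B' \<or> tau \<le> 8 * p e * card B'" by (rule size)
    show "ok s w" "est L w = e" if "w \<in> B'" for w using B'ok[OF that] by auto
    show "B' \<subseteq> I (L + 1 + Suc r)" if "v \<in> I (L + 1)" by (rule fwd[OF that])
    show "v \<in> I last_pos" if "B' \<inter> I s \<noteq> {}" by (rule bwd[OF that])
  qed
qed

text \<open>Size \<open>b ^ h\<close> exceeds n, so after h layers the ball must be saturated. A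
  process that settled for the complete graph is its own ball. The times L + 1 + h and L + 2 + h
  delimit the middle probing step, in which two balls meet.\<close>

lemma stable_ball:
  assumes sp: "spreads I"
    and v: "v \<in> S last_pos" "ok last_pos v"
  shows "\<exists>B. B \<noteq> {} \<and> B \<subseteq> S (L + 2 + h) \<and> (\<forall>w\<in>B. ok (L + 1 + h) w \<and> est (L + 1 + h) w = est L v) \<and>
           (est L v < L \<longrightarrow> tau \<le> 8 * p (est L v) * card B) \<and>
           (v \<in> I (L + 1) \<longrightarrow> B \<subseteq> I (L + 1 + h)) \<and> (B \<inter> I (L + 2 + h) \<noteq> {} \<longrightarrow> v \<in> I last_pos)"
proof (cases "est L v < L")
  case True
  have lp: "last_pos - h = L + 2 + h" by (simp add: last_pos_def)
  obtain B where B: "B \<subseteq> S (L + 2 + h)" and Bok: "\<forall>w\<in>B. ok (L + 2 + h) w \<and> est L w = est L v" and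
     size: "b ^ h \<le> card B \<or> tau \<le> 8 * p (est L v) * card B" and
     I: "v \<in> I (L + 1) \<longrightarrow> B \<subseteq> I (L + 1 + h)" "B \<inter> I (L + 2 + h) \<noteq> {} \<longrightarrow> v \<in> I last_pos"
    using ball[OF sp v refl True, of h, unfolded lp] by auto
  have "card B \<le> card {1..n}"
    using B S_sub(2)[of "L + 2 + h"] by (intro card_mono) (auto simp: last_pos_def)
  hence size': "tau \<le> 8 * p (est L v) * card B" using size n_less by simp
  moreover have "0 < tau" using g_ge by (simp add: tau_def)
  ultimately have "B \<noteq> {}" by auto
  moreover have "ok (L + 1 + h) w \<and> est (L + 1 + h) w = est L v" if w: "w \<in> B" for w
  proof -
    have "w \<in> S (L + 2 + h)" using w B by auto
    moreover have "w \<in> S (L + 1 + h)" using calculation S_Suc[of "L + 1 + h"] by (auto simp: last_pos_def)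
    ultimately show ?thesis using ok_antimono[of "L + 1 + h" "L + 2 + h" w] est_L[of "L + 1 + h" w] Bok w
      by (auto simp: last_pos_def)
  qed
  ultimately show ?thesis using B I size' by (intro exI[of _ B] conjI ballI impI) auto
next
  case False
  have vS: "v \<in> S t" if "t \<le> last_pos" for t using S_mono[of t last_pos] v that by auto
  have up: "v \<in> I t" if "s \<le> t" "t \<le> last_pos" "v \<in> I s" for s t
    using that
  proof (induction t rule: dec_induct)
    case (step t)
    thus ?case using spread[OF sp, of t v v] vS[of "Suc t"] by simp
  qed simp
  have le: "L + 2 + h \<le> last_pos" by (simp add: last_pos_def)
  have "v \<in> S (L + 2 + h)" "ok (L + 1 + h) v" "est (L + 1 + h) v = est L v"
    using vS ok_antimono[of "L + 1 + h" last_pos v] v est_L[of "L + 1 + h" v] le by auto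
  thus ?thesis
    using False up[of "L + 1" "L + 1 + h"] up[of "L + 2 + h" last_pos] le by (intro exI[of _ "{v}"]) auto
qed

text \<open>The information fills the ball of v in h steps, crosses to the ball of w in the middle
  step, and is collected by w in h more; hence \<open>2 * h + 1\<close> probing steps. If v and w
  use different graphs, both balls are also saturated in the denser one, and the ball probing that
  graph uses the connecting edge. As contact is mutual, it does not matter which of the two that
  is.\<close>

lemma flagged_chain:
  assumes sp: "spreads I"
    and v: "v \<in> S last_pos" "ok last_pos v" and w: "w \<in> S last_pos" "ok last_pos w"
    and I: "v \<in> I (L + 1)"
  shows "w \<in> I last_pos"
proof -
  define t where "t = L + 1 + h"
  have t: "L < t" "t < last_pos" by (auto simp: t_def last_pos_def)
  have st: "L + 2 + h = Suc t" "L + 1 + h = t" by (simp_all add: t_def)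
  obtain B where B: "B \<noteq> {}" "B \<subseteq> S (Suc t)" "\<forall>w\<in>B. ok t w \<and> est t w = est L v"
       "est L v < L \<longrightarrow> tau \<le> 8 * p (est L v) * card B" and "v \<in> I (L + 1) \<longrightarrow> B \<subseteq> I t"
    using stable_ball[OF sp v, unfolded st] by (elim exE conjE) (rule that; assumption)
  hence BI: "B \<subseteq> I t" using I by simp
  obtain B' where B': "B' \<noteq> {}" "B' \<subseteq> S (Suc t)" "\<forall>v\<in>B'. ok t v \<and> est t v = est L w"
       "est L w < L \<longrightarrow> tau \<le> 8 * p (est L w) * card B'" "B' \<inter> I (Suc t) \<noteq> {} \<longrightarrow> w \<in> I last_pos"
    using stable_ball[OF sp w, unfolded st] by (elim exE conjE) (rule that; assumption)
  have sub: "B \<subseteq> {1..n}" "B' \<subseteq> {1..n}" using B(2) B'(2) S_sub(2)[of "Suc t"] t by auto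
  have le: "est L v \<le> L" "est L w \<le> L"
    using est_le_L[of L v] est_le_L[of L w] v w S_mono[of L last_pos] by (auto simp: last_pos_def)
  have "\<exists>x\<in>B. \<exists>y\<in>B'. y \<in> nbr (est L v) x \<or> x \<in> nbr (est L w) y"
  proof (cases "est L v = L \<or> est L w = L")
    case True
    thus ?thesis using B(1) B'(1) by (auto simp: nbr_def)
  next
    case False
    hence lt: "est L v < L" "est L w < L" using le by auto
    define m where "m = max (est L v) (est L w)"
    have m: "m < L" using lt by (simp add: m_def)
    have "8 * p (est L v) * card B \<le> 8 * p m * card B" "8 * p (est L w) * card B' \<le> 8 * p m * card B'"
      using p_mono[of "est L v" m] p_mono[of "est L w" m] by (auto intro!: mult_right_mono simp: m_def)
    hence "tau \<le> 8 * p m * card B" "tau \<le> 8 * p m * card B'" using B(4) B'(4) lt by auto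
    then obtain x y where xy: "x \<in> B" "y \<in> B'" "E m x y" using linked_by_edge[OF m sub] by blast
    hence "y \<in> nbr m x" "x \<in> nbr m y" using sym[OF m] by (auto simp: nbr_def)
    moreover have "m = est L v \<or> m = est L w" by (simp add: m_def max_def)
    ultimately show ?thesis using xy by metis
  qed
  then obtain x y where xy: "x \<in> B" "y \<in> B'" "y \<in> nbr (est L v) x \<or> x \<in> nbr (est L w) y" by blast
  hence "y \<in> target t (lev x) x (est t x) (ok t x) \<or> x \<in> target t (lev y) y (est t y) (ok t y)"
    using B(3) B'(3) t by (auto simp: target_def)
  hence "x \<in> H t y" using heard[of t y x] xy B(2) B'(2) t by auto
  hence "y \<in> I (Suc t)" using spread[OF sp, of t y x] xy BI B'(2) t by auto
  thus ?thesis using B'(5) xy by auto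
qed

text \<open>The active partner v of r is discovered only in the second contact, but the first
  contact used the same personal levels and both were alive then. So r had already informed v before
  the probing started. On the side of q the second contact fetches the information.\<close>

lemma happy_chain:
  assumes sp: "spreads I"
    and r: "r \<in> S (Suc last_pos)" "happy r" and q: "q \<in> S (Suc last_pos)" "happy q"
    and I: "r \<in> I 0"
  shows "q \<in> I (Suc last_pos)"
proof -
  have up: "x \<in> I t" if "s \<le> t" "t \<le> Suc last_pos" "x \<in> I s" "x \<in> S (Suc last_pos)" for x s t
    using that
  proof (induction t rule: dec_induct)
    case (step t)
    thus ?case using spread[OF sp, of t x x] S_mono[of "Suc t" "Suc last_pos"] by auto
  qed simp
  have L: "L \<le> last_pos" "L < last_pos" by (auto simp: last_pos_def)
  obtain v where v: "v \<in> S last_pos" "ok last_pos v" "v = r \<or> v \<in> H last_pos r"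
    using r S_Suc[of last_pos] heard_alive[of last_pos r] by (auto simp: happy_def)
  obtain w where w: "w \<in> S last_pos" "ok last_pos w" "w = q \<or> w \<in> H last_pos q"
    using q S_Suc[of last_pos] heard_alive[of last_pos q] by (auto simp: happy_def)
  have "v \<in> I (L + 1)"
  proof (cases "v = r")
    case True
    thus ?thesis using up[of 0 "L + 1" r] I r L by simp
  next
    case False
    hence "v \<in> target last_pos (lev r) r (est last_pos r) (ok last_pos r) \<or>
           r \<in> target last_pos (lev v) v (est last_pos v) (ok last_pos v)"
      using v heard_only[of last_pos r v] r by simp
    hence "r \<in> target L (lev r) r (est L r) (ok L r) \<or> v \<in> target L (lev r) r (est L r) (ok L r) \<or>
           r \<in> target L (lev v) v (est L v) (ok L v)"
      using L by (auto simp: target_def)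
    moreover have "r \<in> S (Suc L)" "v \<in> S (Suc L)" using S_mono[of "Suc L" last_pos] S_Suc[of last_pos] r v L by auto
    ultimately have "r \<in> H L v" using heard[of L v r] L False v heard_only[of last_pos r v] r
      by (auto simp: target_def)
    moreover have "r \<in> I L" using up[of 0 L r] I r L by simp
    ultimately show ?thesis using spread[OF sp, of L v r] \<open>v \<in> S (Suc L)\<close> L by simp
  qed
  hence wI: "w \<in> I last_pos" using flagged_chain[OF sp v(1,2) w(1,2)] by blast
  show ?thesis
    using w(3) wI spread[OF sp, of last_pos q w] spread[OF sp, of last_pos q q] q by auto
qed

end

subsection \<open>Dissemination by repeated attempts\<close>

context overlay begin

definition len :: nat where "len = Suc last_pos"

text \<open>Each of two surviving processes is unhappy in fewer than \<open>h * (L + 1)\<close>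
  attempts, so in at least one attempt both are happy.\<close>

definition attempts :: nat where "attempts = 2 * (h * (L + 1))"

definition level :: "nat \<Rightarrow> nat" where "level c = min (c div h) L"

text \<open>At \<open>last_pos\<close> this function and \<open>step_ok\<close> restore the initial
  values for the next attempt; only the number of unhappy attempts is carried over.\<close>

definition step_est :: "nat \<Rightarrow> nat \<Rightarrow> nat \<Rightarrow> nat" where
  "step_est t e c = (if t < L then (if e = t \<and> c < thr then Suc t else e) else if t < last_pos then e else 0)"

definition step_ok :: "nat \<Rightarrow> nat \<Rightarrow> bool \<Rightarrow> nat \<Rightarrow> bool" where
  "step_ok t e a c = (if t \<le> L then a else if t < last_pos then a \<and> (e = L \<or> tau \<le> c) else True)"

definition step_cnt :: "nat \<Rightarrow> nat \<Rightarrow> bool \<Rightarrow> nat" where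
  "step_cnt t k happy = (if t < last_pos \<or> happy then k else Suc k)"

lemma h_pos: "0 < h"
  using n_less n_ge by (cases h) auto

end

locale stage = overlay +
  fixes W :: "nat set" and S :: "nat \<Rightarrow> nat set" and H :: "nat \<Rightarrow> nat \<Rightarrow> nat set"
    and est :: "nat \<Rightarrow> nat \<Rightarrow> nat" and ok :: "nat \<Rightarrow> nat \<Rightarrow> bool" and cnt :: "nat \<Rightarrow> nat \<Rightarrow> nat"
  assumes W_sub: "W \<subseteq> {1..n}" and S_0: "S 0 \<subseteq> W"
    and S_step: "\<And>t. t < attempts * len \<Longrightarrow> S (Suc t) \<subseteq> S t"
    and H_complete: "\<And>t q u. t < attempts * len \<Longrightarrow> q \<in> S (Suc t) \<Longrightarrow> u \<in> S (Suc t) \<Longrightarrow>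
        u \<in> target (t mod len) (level (cnt t q)) q (est t q) (ok t q) \<or>
        q \<in> target (t mod len) (level (cnt t u)) u (est t u) (ok t u) \<Longrightarrow> u \<in> H t q"
    and H_alive: "\<And>t q u. t < attempts * len \<Longrightarrow> q \<in> S (Suc t) \<Longrightarrow> u \<in> H t q \<Longrightarrow> u \<in> S t"
    and H_sound: "\<And>t q u. t < attempts * len \<Longrightarrow> q \<in> S (Suc t) \<Longrightarrow> u \<in> H t q \<Longrightarrow>
        u \<in> target (t mod len) (level (cnt t q)) q (est t q) (ok t q) \<or>
        q \<in> target (t mod len) (level (cnt t u)) u (est t u) (ok t u)"
    and init: "\<And>q. q \<in> S 0 \<Longrightarrow> est 0 q = 0 \<and> ok 0 q \<and> cnt 0 q = 0"
    and est_Suc: "\<And>t q. t < attempts * len \<Longrightarrow> q \<in> S (Suc t) \<Longrightarrow>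
        est (Suc t) q = step_est (t mod len) (est t q) (card (H t q \<inter> nbr (t mod len) q))"
    and ok_Suc: "\<And>t q. t < attempts * len \<Longrightarrow> q \<in> S (Suc t) \<Longrightarrow>
        ok (Suc t) q = step_ok (t mod len) (est t q) (ok t q)
           (card {u \<in> H t q \<inter> nbr (est t q) q. est t u = est t q \<and> ok t u})"
    and cnt_Suc: "\<And>t q. t < attempts * len \<Longrightarrow> q \<in> S (Suc t) \<Longrightarrow>
        cnt (Suc t) q = step_cnt (t mod len) (cnt t q) (ok t q \<or> (\<exists>u\<in>H t q. ok t u))"
begin

definition A :: "nat \<Rightarrow> nat set" where "A a = S (a * len)"
definition cn :: "nat \<Rightarrow> nat \<Rightarrow> nat" where "cn a q = cnt (a * len) q"

lemma attempt_time: "a < attempts \<Longrightarrow> t \<le> last_pos \<Longrightarrow> a * len + t < attempts * len"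
  and attempt_mod: "t \<le> last_pos \<Longrightarrow> (a * len + t) mod len = t"
proof -
  assume a: "a < attempts" "t \<le> last_pos"
  have "a * len + t < Suc a * len" using a by (simp add: len_def)
  also have "\<dots> \<le> attempts * len" using a by (intro mult_right_mono) auto
  finally show "a * len + t < attempts * len" .
next
  assume "t \<le> last_pos"
  hence "t < len" by (simp add: len_def)
  thus "(a * len + t) mod len = t" by simp
qed

lemma S_antimono: "s \<le> t \<Longrightarrow> t \<le> attempts * len \<Longrightarrow> S t \<subseteq> S s"
proof (induction t rule: dec_induct)
  case (step t)
  thus ?case using S_step[of t] by auto
qed simp

lemma A_antimono: "a \<le> a' \<Longrightarrow> a' \<le> attempts \<Longrightarrow> A a' \<subseteq> A a"
  unfolding A_def by (intro S_antimono mult_right_mono) auto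

lemma A_sub: "a \<le> attempts \<Longrightarrow> A a \<subseteq> W" "a \<le> attempts \<Longrightarrow> A a \<subseteq> {1..n}" "a \<le> attempts \<Longrightarrow> finite (A a)"
proof -
  show "A a \<subseteq> W" if "a \<le> attempts" using A_antimono[of 0 a] S_0 that by (auto simp: A_def)
  thus "A a \<subseteq> {1..n}" if "a \<le> attempts" using that W_sub by blast
  thus "finite (A a)" if "a \<le> attempts" using that finite_sub by blast
qed

lemma attempt_start:
  assumes "a < attempts" "q \<in> A a"
  shows "est (a * len) q = 0" "ok (a * len) q"
proof -
  have "est (a * len) q = 0 \<and> ok (a * len) q"
  proof (cases a)
    case 0
    thus ?thesis using init assms by (simp add: A_def)
  next
    case (Suc a')
    define t where "t = a' * len + last_pos"
    have t: "Suc t = a * len" by (simp add: t_def Suc len_def)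
    have "t < attempts * len" "t mod len = last_pos"
      using attempt_time[of a' last_pos] attempt_mod[of last_pos a'] assms Suc by (auto simp: t_def)
    moreover have "q \<in> S (Suc t)" using assms t by (simp add: A_def)
    ultimately show ?thesis using est_Suc[of t q] ok_Suc[of t q] t
      by (simp add: step_est_def step_ok_def last_pos_def)
  qed
  thus "est (a * len) q = 0" "ok (a * len) q" by auto
qed

lemma cnt_const:
  assumes a: "a < attempts"
  shows "t \<le> last_pos \<Longrightarrow> q \<in> S (a * len + t) \<Longrightarrow> cnt (a * len + t) q = cn a q"
proof (induction t)
  case (Suc t)
  have t: "a * len + t < attempts * len" "(a * len + t) mod len = t"
    using attempt_time[of a t] attempt_mod[of t a] a Suc.prems by auto
  have "q \<in> S (a * len + t)" using S_step[of "a * len + t"] t Suc.prems by auto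
  thus ?case using Suc cnt_Suc[of "a * len + t" q] t by (simp add: step_cnt_def)
qed (simp add: cn_def)

lemma attempt:
  assumes a: "a < attempts"
  shows "attempt n b g h L E W (\<lambda>t. S (a * len + t)) (\<lambda>t. H (a * len + t)) (\<lambda>t. est (a * len + t))
           (\<lambda>t. ok (a * len + t)) (\<lambda>q. level (cn a q))"
proof -
  note time = attempt_time[OF a] and tmod = attempt_mod
  have c: "cnt (a * len + t) q = cn a q" if "t \<le> last_pos" "q \<in> S (Suc (a * len + t))" for t q
    using cnt_const[OF a, of t q] S_step[OF time[OF that(1)]] that by auto
  show ?thesis
  proof
    show "W \<subseteq> {1..n}" by (rule W_sub)
    show "S (a * len + 0) \<subseteq> W" using A_sub(1)[of a] a by (simp add: A_def)
  next
    fix t assume "t \<le> last_pos"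
    thus "S (a * len + Suc t) \<subseteq> S (a * len + t)" using S_step[OF time] by simp
  next
    fix t q u assume t: "t \<le> last_pos" and q: "q \<in> S (a * len + Suc t)" "u \<in> S (a * len + Suc t)"
      and T: "u \<in> target t (level (cn a q)) q (est (a * len + t) q) (ok (a * len + t) q) \<or>
         q \<in> target t (level (cn a u)) u (est (a * len + t) u) (ok (a * len + t) u)"
    thus "u \<in> H (a * len + t) q"
      using H_complete[OF time[OF t], of q u] tmod[OF t, of a] c[OF t] by simp
  next
    fix t q u assume t: "t \<le> last_pos" and q: "q \<in> S (a * len + Suc t)" "u \<in> H (a * len + t) q"
    have u: "u \<in> S (a * len + t)" using H_alive[OF time[OF t], of q u] q by simp
    thus "u \<in> S (a * len + t)" .
    show "u \<in> target t (level (cn a q)) q (est (a * len + t) q) (ok (a * len + t) q) \<or>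
         q \<in> target t (level (cn a u)) u (est (a * len + t) u) (ok (a * len + t) u)"
      using H_sound[OF time[OF t], of q u] tmod[OF t, of a] c[OF t, of q] cnt_const[OF a t u] q by simp
  next
    fix q assume "q \<in> S (a * len + 0)"
    thus "est (a * len + 0) q = 0" "ok (a * len + 0) q" using attempt_start[OF a, of q] by (auto simp: A_def)
  next
    fix t q assume t: "t < L" and q: "q \<in> S (a * len + Suc t)"
    have t': "t \<le> last_pos" using t by (simp add: last_pos_def)
    show "est (a * len + Suc t) q = (if est (a * len + t) q = t \<and> card (H (a * len + t) q \<inter> nbr t q) < thr
            then Suc t else est (a * len + t) q)"
      using est_Suc[OF time[OF t'], of q] tmod[OF t', of a] q t by (simp add: step_est_def)
  next
    fix t q assume t: "L \<le> t" "t < last_pos" and q: "q \<in> S (a * len + Suc t)"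
    thus "est (a * len + Suc t) q = est (a * len + t) q"
      using est_Suc[OF time[of t], of q] tmod[of t a] by (simp add: step_est_def)
  next
    fix t q assume t: "t \<le> L" and q: "q \<in> S (a * len + Suc t)"
    thus "ok (a * len + Suc t) q = ok (a * len + t) q"
      using ok_Suc[OF time[of t], of q] tmod[of t a] by (simp add: step_ok_def last_pos_def)
  next
    fix t q assume t: "L < t" "t < last_pos" and q: "q \<in> S (a * len + Suc t)"
    thus "ok (a * len + Suc t) q = (ok (a * len + t) q \<and> (est (a * len + t) q = L \<or>
          tau \<le> card {u \<in> H (a * len + t) q \<inter> nbr (est (a * len + t) q) q.
                      est (a * len + t) u = est (a * len + t) q \<and> ok (a * len + t) u}))"
      using ok_Suc[OF time[of t], of q] tmod[of t a] by (simp add: step_ok_def)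
  qed
qed

definition hap :: "nat \<Rightarrow> nat \<Rightarrow> bool" where
  "hap a q \<longleftrightarrow> ok (a * len + last_pos) q \<or> (\<exists>u\<in>H (a * len + last_pos) q. ok (a * len + last_pos) u)"

section \<open>Unhappiness and personal levels\<close>

definition good :: "nat \<Rightarrow> bool" where "good a \<longleftrightarrow> card (A a) \<le> b * card (A (Suc a))"

lemma next_start: "Suc a * len = a * len + Suc last_pos"
  by (simp add: len_def)

lemma A_Suc: "A (Suc a) = S (a * len + Suc last_pos)"
  unfolding A_def next_start ..

lemma cn_0: "q \<in> A 0 \<Longrightarrow> cn 0 q = 0"
  using init by (simp add: A_def cn_def)

lemma cn_Suc:
  assumes a: "a < attempts" and q: "q \<in> A (Suc a)"
  shows "cn (Suc a) q = (if hap a q then cn a q else Suc (cn a q))"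
proof -
  define t where "t = a * len + last_pos"
  have t: "t < attempts * len" "t mod len = last_pos"
    using attempt_time[of a last_pos] attempt_mod[of last_pos a] a by (auto simp: t_def)
  have q': "q \<in> S (Suc t)" using q unfolding A_Suc t_def by simp
  hence "cnt t q = cn a q" using cnt_const[OF a, of last_pos q] S_step[OF t(1)] by (auto simp: t_def)
  moreover have "cn (Suc a) q = cnt (Suc t) q" unfolding cn_def t_def next_start by simp
  ultimately show ?thesis using cnt_Suc[OF t(1) q'] t by (simp add: step_cnt_def hap_def t_def)
qed

text \<open>A survivor with a core member among its personal neighbours hears this member in the
  second contact, and the core is still active then. So the unhappy ones have no neighbour in the
  core.\<close>

lemma good_core:
  assumes a: "a < attempts" and g: "good a" and ne: "A (Suc a) \<noteq> {}"
  shows "\<exists>C \<subseteq> A (Suc a). card (A (Suc a)) \<le> 3 * (L + 1) * card C \<and>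
           (\<forall>q\<in>A (Suc a). \<not> hap a q \<longrightarrow> C \<inter> nbr (level (cn a q)) q = {})"
proof -
  interpret attempt n b g h L E W "\<lambda>t. S (a * len + t)" "\<lambda>t. H (a * len + t)" "\<lambda>t. est (a * len + t)"
    "\<lambda>t. ok (a * len + t)" "\<lambda>q. level (cn a q)" by (rule attempt[OF a])
  obtain C where C: "C \<subseteq> A (Suc a)" "\<forall>q\<in>C. ok (a * len + last_pos) q" "card (A (Suc a)) \<le> 3 * (L + 1) * card C"
    using core g ne unfolding good_def A_Suc by (auto simp: A_def)
  have "C \<inter> nbr (level (cn a q)) q = {}" if q: "q \<in> A (Suc a)" and un: "\<not> hap a q" for q
  proof (rule ccontr)
    assume "\<not> ?thesis"
    then obtain c where c: "c \<in> C" "c \<in> nbr (level (cn a q)) q" by auto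
    hence "c \<in> H (a * len + last_pos) q"
      using heard[of last_pos q c] q C(1) unfolding A_Suc by (auto simp: target_def last_pos_def)
    thus False using un C(2) c by (auto simp: hap_def)
  qed
  thus ?thesis using C by blast
qed

text \<open>The invariant is that b^k times the number of survivors is at most n, where k counts the
  attempts so far that were not good.\<close>

lemma few_bad:
  assumes a: "a \<le> attempts" and ne: "A a \<noteq> {}"
  shows "card {a'. a' < a \<and> \<not> good a'} < h"
proof -
  have "b ^ card {a'. a' < a \<and> \<not> good a'} * card (A a) \<le> n" using a
  proof (induction a)
    case 0
    have "card (A 0) \<le> card {1..n}" using A_sub(2)[of 0] by (intro card_mono) auto
    thus ?case by simp
  next
    case (Suc a)
    have ih: "b ^ card {a'. a' < a \<and> \<not> good a'} * card (A a) \<le> n" using Suc by simp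
    show ?case
    proof (cases "good a")
      case True
      hence "{a'. a' < Suc a \<and> \<not> good a'} = {a'. a' < a \<and> \<not> good a'}" by (auto simp: less_Suc_eq)
      moreover have "card (A (Suc a)) \<le> card (A a)"
        using A_antimono[of a "Suc a"] A_sub(3)[of a] Suc.prems by (intro card_mono) auto
      ultimately show ?thesis using ih mult_le_mono2 order_trans by metis
    next
      case False
      hence "{a'. a' < Suc a \<and> \<not> good a'} = insert a {a'. a' < a \<and> \<not> good a'}" by (auto simp: less_Suc_eq)
      hence "card {a'. a' < Suc a \<and> \<not> good a'} = Suc (card {a'. a' < a \<and> \<not> good a'})" by simp
      moreover have "b * card (A (Suc a)) \<le> card (A a)" using False by (simp add: good_def)
      hence "b ^ card {a'. a' < a \<and> \<not> good a'} * (b * card (A (Suc a))) \<le> b ^ card {a'. a' < a \<and> \<not> good a'} * card (A a)"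
        by (rule mult_le_mono2)
      ultimately show ?thesis using ih by (simp only: power_Suc mult_ac)
    qed
  qed
  moreover have "0 < card (A a)" using ne A_sub(3)[OF a] by (simp add: card_gt_0_iff)
  hence "b ^ card {a'. a' < a \<and> \<not> good a'} * 1 \<le> b ^ card {a'. a' < a \<and> \<not> good a'} * card (A a)"
    by (intro mult_le_mono2) simp
  ultimately have "b ^ card {a'. a' < a \<and> \<not> good a'} < b ^ h" using n_less by linarith
  thus ?thesis using b_ge by (simp add: power_strict_increasing_iff)
qed

lemma cn_hit:
  assumes "a \<le> attempts" "q \<in> A a" "c < cn a q"
  shows "\<exists>a'<a. cn a' q = c \<and> \<not> hap a' q"
  using assms
proof (induction a)
  case 0
  thus ?case using cn_0 by simp
next
  case (Suc a)
  have q: "q \<in> A a" using Suc.prems A_antimono[of a "Suc a"] by auto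
  show ?case
  proof (cases "c < cn a q")
    case True
    thus ?thesis using Suc q by (meson Suc_leD less_SucI)
  next
    case False
    hence "\<not> hap a q \<and> cn a q = c" using cn_Suc[of a q] Suc.prems by (auto split: if_splits)
    thus ?thesis by blast
  qed
qed

text \<open>The counter passes through all h values that belong to level i, each time by an unhappy
  attempt. Fewer than h of these can fail to be good.\<close>

lemma good_miss:
  assumes a: "a \<le> attempts" "q \<in> A a" and c: "h * Suc i \<le> cn a q"
  shows "\<exists>a'<a. good a' \<and> cn a' q div h = i \<and> \<not> hap a' q"
proof (rule ccontr)
  assume neg: "\<not> ?thesis"
  have "\<forall>c\<in>{h * i..<h * Suc i}. \<exists>a'<a. cn a' q = c \<and> \<not> hap a' q"
    using cn_hit[OF a] c by auto
  then obtain f where f: "\<And>c. c \<in> {h * i..<h * Suc i} \<Longrightarrow> f c < a \<and> cn (f c) q = c \<and> \<not> hap (f c) q"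
    by metis
  have "inj_on f {h * i..<h * Suc i}" by (rule inj_onI) (metis f)
  hence "card (f ` {h * i..<h * Suc i}) = h" by (simp add: card_image)
  moreover have "f ` {h * i..<h * Suc i} \<subseteq> {a'. a' < a \<and> \<not> good a'}"
  proof
    fix y assume "y \<in> f ` {h * i..<h * Suc i}"
    then obtain c where c: "c \<in> {h * i..<h * Suc i}" "y = f c" by auto
    have "c div h = i" using c(1) h_pos by (intro div_nat_eqI) (auto simp: mult.commute)
    thus "y \<in> {a'. a' < a \<and> \<not> good a'}" using f[OF c(1)] c(2) neg by auto
  qed
  moreover have "finite {a'. a' < a \<and> \<not> good a'}" by simp
  ultimately have "h \<le> card {a'. a' < a \<and> \<not> good a'}" by (metis card_mono)
  thus False using few_bad[OF a(1)] a(2) by fastforce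
qed

text \<open>On level L the personal graph is complete, and missing the core of a good attempt is
  impossible.\<close>

lemma cn_less:
  assumes a: "a \<le> attempts" "q \<in> A a"
  shows "cn a q < h * (L + 1)"
proof (rule ccontr)
  assume "\<not> ?thesis"
  hence "h * Suc L \<le> cn a q" by simp
  then obtain a' where a': "a' < a" "good a'" "cn a' q div h = L" "\<not> hap a' q"
    using good_miss[OF a] by blast
  have q: "q \<in> A (Suc a')" using A_antimono[of "Suc a'" a] a a' by auto
  then obtain C where C: "C \<subseteq> A (Suc a')" "card (A (Suc a')) \<le> 3 * (L + 1) * card C"
      "C \<inter> nbr (level (cn a' q)) q = {}"
    using good_core[of a'] a a' by fastforce
  have "level (cn a' q) = L" using a' by (simp add: level_def)
  hence "C = {}" using C(3) by (simp add: nbr_def)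
  hence "card (A (Suc a')) = 0" using C(2) by simp
  thus False using q A_sub(3)[of "Suc a'"] a a' by auto
qed

lemma card_unhappy: "a \<le> attempts \<Longrightarrow> q \<in> A a \<Longrightarrow> card {a'. a' < a \<and> \<not> hap a' q} = cn a q"
proof (induction a)
  case 0
  thus ?case using cn_0 by simp
next
  case (Suc a)
  have q: "q \<in> A a" using Suc.prems A_antimono[of a "Suc a"] by auto
  have fin: "finite {a'. a' < a \<and> \<not> hap a' q}" by simp
  have "{a'. a' < Suc a \<and> \<not> hap a' q} = (if hap a q then {} else {a}) \<union> {a'. a' < a \<and> \<not> hap a' q}"
    by (auto simp: less_Suc_eq)
  hence "card {a'. a' < Suc a \<and> \<not> hap a' q} = (if hap a q then 0 else 1) + card {a'. a' < a \<and> \<not> hap a' q}"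
    using fin by simp
  thus ?case using Suc q cn_Suc[of a q] by simp
qed

lemma dissemination:
  assumes I: "\<And>t q u. t < attempts * len \<Longrightarrow> q \<in> S (Suc t) \<Longrightarrow> u \<in> insert q (H t q) \<Longrightarrow> u \<in> I t \<Longrightarrow> q \<in> I (Suc t)"
    and r: "r \<in> S (attempts * len)" "r \<in> I 0" and q: "q \<in> S (attempts * len)"
  shows "q \<in> I (attempts * len)"
proof -
  have up: "x \<in> I t" if "s \<le> t" "t \<le> attempts * len" "x \<in> I s" and x: "x \<in> S (attempts * len)" for x s t
    using that(1-3)
  proof (induction t rule: dec_induct)
    case base
    show ?case by fact
  next
    case (step t)
    have t: "t < attempts * len" "Suc t \<le> attempts * len" using step.prems(1) by (simp_all only: Suc_le_eq)
    have xS: "x \<in> S (Suc t)" by (rule subsetD[OF S_antimono[OF t(2) order_refl] x])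
    have "x \<in> I t" by (rule step.IH) (use t step.prems in \<open>simp_all only: less_imp_le\<close>)
    thus ?case by (rule I[OF t(1) xS insertI1])
  qed
  have rq: "r \<in> A attempts" "q \<in> A attempts" unfolding A_def by (rule r(1), rule q)
  define U where "U = {a. a < attempts \<and> \<not> hap a r} \<union> {a. a < attempts \<and> \<not> hap a q}"
  have lt: "card U < attempts"
  proof -
    have "card U \<le> cn attempts r + cn attempts q"
      unfolding U_def card_unhappy[OF order_refl rq(1), symmetric] card_unhappy[OF order_refl rq(2), symmetric]
      by (rule card_Un_le)
    thus ?thesis using cn_less[OF order_refl rq(1)] cn_less[OF order_refl rq(2)] by (simp add: attempts_def)
  qed
  have "U \<noteq> {..<attempts}"
  proof
    assume eq: "U = {..<attempts}"
    show False using lt unfolding eq by simp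
  qed
  moreover have "U \<subseteq> {..<attempts}" unfolding U_def by blast
  ultimately obtain a where "a < attempts" "a \<notin> U" by blast
  hence a: "a < attempts" "hap a r" "hap a q" unfolding U_def by simp_all
  interpret attempt n b g h L E W "\<lambda>t. S (a * len + t)" "\<lambda>t. H (a * len + t)" "\<lambda>t. est (a * len + t)"
    "\<lambda>t. ok (a * len + t)" "\<lambda>q. level (cn a q)" by (rule attempt[OF a(1)])
  have sub: "A attempts \<subseteq> S (a * len + Suc last_pos)"
    using A_antimono[of "Suc a" attempts] a(1) unfolding A_Suc by simp
  have le: "a * len \<le> attempts * len" "a * len + Suc last_pos \<le> attempts * len"
    using a(1) attempt_time[OF a(1), of last_pos] by auto
  have "q \<in> I (a * len + Suc last_pos)"
  proof (rule happy_chain[where I = "\<lambda>t. I (a * len + t)" and r = r and q = q])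
    show "spreads (\<lambda>t. I (a * len + t))"
      unfolding spreads_def add_Suc_right using I[OF attempt_time[OF a(1)]] by blast
    show "r \<in> S (a * len + Suc last_pos)" "q \<in> S (a * len + Suc last_pos)" using sub rq by auto
    show "happy r" "happy q" using a by (auto simp: happy_def hap_def)
    show "r \<in> I (a * len + 0)" using up[of 0 "a * len" r] r le by simp
  qed
  thus ?thesis using up[of "a * len + Suc last_pos" "attempts * len" q] le q by simp
qed

text \<open>To leave level i - 1 a process must have missed, on that graph, the core of a good
  attempt. As long as many processes survive, such a core is too large to be missed by more than 12
  g / p processes. Summing over all attempts costs the factor \<open>2 * (h * (L + 1))\<close>, of
  which all but h is swallowed by \<open>b ^ 7\<close>.\<close>

lemma few_high_level:
  assumes a: "a < attempts" and i: "i \<le> L"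
  shows "card {q \<in> A a. i \<le> level (cn a q)} * real b ^ i \<le> (h + 1) * real n"
proof (cases i)
  case 0
  have "card {q \<in> A a. i \<le> level (cn a q)} \<le> card {1..n}" using A_sub(2)[of a] a by (intro card_mono) auto
  hence "real (card {q \<in> A a. i \<le> level (cn a q)}) \<le> real n" by simp
  also have "1 * real n \<le> (h + 1) * real n" by (intro mult_right_mono) auto
  finally show ?thesis using 0 by simp
next
  case (Suc j)
  define Y where "Y = {q \<in> A a. i \<le> level (cn a q)}"
  have j: "j < L" using Suc i by simp
  have fin: "finite (A a)" "finite Y" using A_sub(3)[of a] a by (auto simp: Y_def)
  have bi: "0 < real b ^ i" using b_ge by simp
  show ?thesis
  \<comment> \<open>With few survivors the cores may be too small for \<open>nonadjacent\<close>,
    but then the claim holds for the whole set of survivors.\<close>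
  proof (cases "card (A a) * real b ^ i \<le> n")
    case True
    have "card Y \<le> card (A a)" using fin by (intro card_mono) (auto simp: Y_def)
    hence "card Y * real b ^ i \<le> card (A a) * real b ^ i" using bi by (intro mult_right_mono) auto
    also have "\<dots> \<le> 1 * real n" using True by simp
    also have "\<dots> \<le> (h + 1) * real n" by (intro mult_right_mono) auto
    finally show ?thesis by (simp add: Y_def)
  next
    case False
    hence big: "real n < card (A a) * real b ^ i" by simp
    define Z where "Z a' = {q \<in> Y. \<not> hap a' q \<and> level (cn a' q) = j}" for a'
    have cover: "Y \<subseteq> (\<Union>a'\<in>{a'. a' < a \<and> good a'}. Z a')"
    proof
      fix q assume q: "q \<in> Y"
      hence qA: "q \<in> A a" and "i \<le> cn a q div h" by (auto simp: Y_def level_def)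
      hence "h * Suc j \<le> cn a q" using Suc h_pos by (simp add: less_eq_div_iff_mult_less_eq mult.commute)
      then obtain a' where a': "a' < a" "good a'" "cn a' q div h = j" "\<not> hap a' q"
        using good_miss[of a q j] qA a by auto
      thus "q \<in> (\<Union>a'\<in>{a'. a' < a \<and> good a'}. Z a')" using q j by (auto simp: Z_def level_def)
    qed
    have small: "p j * card (Z a') \<le> 12 * g" if a': "a' < a" "good a'" for a'
    proof -
      have le: "Suc a' \<le> attempts" using a a' by simp
      have AA: "A a \<subseteq> A (Suc a')" using A_antimono[of "Suc a'" a] a a' by simp
      have "0 < card (A a)" using big n_ge by (auto intro!: Nat.gr0I)
      hence ne: "A (Suc a') \<noteq> {}" using AA by auto
      obtain C where C: "C \<subseteq> A (Suc a')" "card (A (Suc a')) \<le> 3 * (L + 1) * card C"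
        "\<And>q. q \<in> A (Suc a') \<Longrightarrow> \<not> hap a' q \<Longrightarrow> C \<inter> nbr (level (cn a' q)) q = {}"
        using good_core[of a'] a' a ne by auto
      have sub: "Z a' \<subseteq> {1..n}" "C \<subseteq> {1..n}"
        using A_sub(2)[of a] A_sub(2)[OF le] a C(1) by (auto simp: Z_def Y_def)
      have "\<not> E j u v" if u: "u \<in> Z a'" and v: "v \<in> C" for u v
      proof -
        have "u \<in> A (Suc a')" "\<not> hap a' u" "level (cn a' u) = j" using u AA by (auto simp: Z_def Y_def)
        hence "v \<notin> nbr j u" using C(3)[of u] v by auto
        thus ?thesis using j by (simp add: nbr_def)
      qed
      hence "p j * card (Z a') \<le> 12 * g \<or> p j * card C \<le> 12 * g"
        using nonadjacent[OF j sub] by blast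
      moreover have "12 * g < p j * card C"
      proof -
        have "card (A a) \<le> card (A (Suc a'))" using AA A_sub(3)[OF le] by (intro card_mono) auto
        hence "card (A a) \<le> 3 * (L + 1) * card C" using C(2) by simp
        hence "real (card (A a)) \<le> real (3 * (L + 1) * card C)" by (rule of_nat_mono)
        hence "card (A a) * real b ^ i \<le> 3 * (real L + 1) * card C * real b ^ i"
          using bi by (intro mult_right_mono) (auto simp: algebra_simps)
        hence "real n < 3 * (real L + 1) * card C * real b ^ i" using big by linarith
        hence "(4 * g * real b ^ 7) * n < (4 * g * real b ^ 7) * (3 * (real L + 1) * card C * real b ^ i)"
          using g_ge b_ge by (intro mult_strict_left_mono) auto
        also have "\<dots> = (3 * (real L + 1)) * (p j * card C) * n"
          using n_ge by (simp add: p_def Suc power_add eval_nat_numeral field_simps)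
        finally have lt: "4 * g * real b ^ 7 < (3 * (real L + 1)) * (p j * card C)" using n_ge by simp
        have "64 * (2000 * (real L + 1)) \<le> real b ^ 7" using b_powers(1,2) by simp
        hence "(4 * real g) * (64 * (2000 * (real L + 1))) \<le> (4 * real g) * real b ^ 7" by (intro mult_left_mono) auto
        hence big7: "4 * real g * (64 * (2000 * (real L + 1))) \<le> 4 * g * real b ^ 7" by simp
        have "(3 * (real L + 1)) * (12 * g) \<le> 4 * g * real b ^ 7"
        proof -
          have "(real L + 1) * (36 * real g) \<le> (real L + 1) * (512000 * real g)" by (intro mult_left_mono) auto
          also have "\<dots> = 4 * real g * (64 * (2000 * (real L + 1)))" by simp
          also note big7
          finally show ?thesis by (simp add: mult_ac)
        qed
        hence "(3 * (real L + 1)) * (12 * g) < (3 * (real L + 1)) * (p j * card C)" using lt by linarith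
        thus ?thesis by (subst (asm) mult_less_cancel_left_pos) auto
      qed
      ultimately show ?thesis by linarith
    qed
    have "card Y \<le> card (\<Union>a'\<in>{a'. a' < a \<and> good a'}. Z a')"
      using cover fin by (intro card_mono) (auto simp: Z_def)
    also have "\<dots> \<le> (\<Sum>a'\<in>{a'. a' < a \<and> good a'}. card (Z a'))" by (rule card_UN_le) simp
    finally have "p j * card Y \<le> p j * (\<Sum>a'\<in>{a'. a' < a \<and> good a'}. real (card (Z a')))"
      using p_pos[of j] by (intro mult_left_mono) (auto simp flip: of_nat_sum)
    also have "\<dots> = (\<Sum>a'\<in>{a'. a' < a \<and> good a'}. p j * card (Z a'))" by (rule sum_distrib_left)
    also have "\<dots> \<le> (\<Sum>a'\<in>{a'. a' < a \<and> good a'}. 12 * real g)" using small by (intro sum_mono) auto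
    also have "\<dots> = card {a'. a' < a \<and> good a'} * (12 * real g)" by simp
    also have "\<dots> \<le> attempts * (12 * real g)"
    proof (rule mult_right_mono)
      have "card {a'. a' < a \<and> good a'} \<le> card {..<attempts}" using a by (intro card_mono) auto
      thus "real (card {a'. a' < a \<and> good a'}) \<le> real attempts" by simp
    qed simp
    finally have pY: "p j * card Y \<le> attempts * (12 * real g)" .
    have "4 * (g * real b ^ 7) * (card Y * real b ^ i) = (p j * card Y) * n"
      using n_ge by (simp add: p_def Suc power_add eval_nat_numeral field_simps)
    also have "\<dots> \<le> attempts * (12 * real g) * n" using pY by (intro mult_right_mono) auto
    also have "\<dots> = 12 * real g * (2 * (h * (real L + 1))) * n" by (simp add: attempts_def algebra_simps)
    also have "\<dots> \<le> 4 * (g * real b ^ 7) * ((h + 1) * real n)"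
    proof -
      have "6 * (real L + 1) \<le> real b ^ 7" using b_powers(1,2) by simp
      hence "(g * real h * real n) * (6 * (real L + 1)) \<le> (g * real h * real n) * real b ^ 7" by (intro mult_left_mono) auto
      also have "\<dots> \<le> g * real b ^ 7 * ((h + 1) * real n)" by (simp add: algebra_simps)
      finally show ?thesis by (simp add: algebra_simps)
    qed
    finally have "card Y * real b ^ i \<le> (h + 1) * real n"
      using g_ge b_ge by (subst (asm) mult_le_cancel_left_pos) auto
    thus ?thesis by (simp add: Y_def)
  qed
qed

lemma inquiry_volume:
  assumes a: "a < attempts" and T: "T \<subseteq> A a"
  shows "(\<Sum>q\<in>T. card (nbr (level (cn a q)) q \<inter> W)) \<le> (L + 1) * (28 * (h + 1) * (g * real b ^ 8) * card W)"
proof -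
  have fin: "finite T" "finite (A a)" using T A_sub(3)[of a] a finite_subset by auto
  define X where "X i = {q \<in> T. level (cn a q) = i}" for i
  have "(\<Sum>q\<in>T. real (card (nbr (level (cn a q)) q \<inter> W)))
          = (\<Sum>i\<le>L. \<Sum>q\<in>{q \<in> T. level (cn a q) = i}. real (card (nbr (level (cn a q)) q \<inter> W)))"
    by (rule sum.group[symmetric]) (use fin in \<open>auto simp: level_def\<close>)
  also have "\<dots> = (\<Sum>i\<le>L. \<Sum>q\<in>X i. real (card (nbr i q \<inter> W)))" by (simp add: X_def)
  also have "\<dots> \<le> (\<Sum>i\<le>L. 28 * (real h + 1) * (g * real b ^ 8) * card W)"
  proof (rule sum_mono)
    fix i assume i: "i \<in> {..L}"
    have "card (X i) \<le> card {q \<in> A a. i \<le> level (cn a q)}"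
      by (rule card_mono) (use fin T in \<open>auto simp: X_def\<close>)
    hence "card (X i) * real b ^ i \<le> card {q \<in> A a. i \<le> level (cn a q)} * real b ^ i" by (intro mult_right_mono) auto
    also have "\<dots> \<le> (real h + 1) * n" using few_high_level[OF a, of i] i by (simp add: add.commute)
    finally have "card (X i) * real b ^ i \<le> (real h + 1) * n" .
    moreover have "X i \<subseteq> W" using T A_sub(1)[of a] a by (auto simp: X_def)
    ultimately show "(\<Sum>q\<in>X i. real (card (nbr i q \<inter> W))) \<le> 28 * (real h + 1) * (g * real b ^ 8) * card W"
      using volume[of i "X i" W "real h + 1"] i W_sub by simp
  qed
  finally show ?thesis by (simp add: algebra_simps)
qed

text \<open>Only requests are counted; a reply is charged to its request in
  \<open>bits_le\<close>.\<close>

definition load :: "nat \<Rightarrow> nat" where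
  "load t = (\<Sum>q\<in>S t. card (target (t mod len) (level (cnt t q)) q (est t q) (ok t q) \<inter> W))"

text \<open>The contacts may cost h + 1 times as much as any other step, but there are only two of
  them among L + 2 h + 3 steps, so they do not raise the order of the total. The constant 140 is 5
  times the 28 of \<open>volume\<close>.\<close>

lemma attempt_load:
  assumes a: "a < attempts"
  shows "(\<Sum>t<len. load (a * len + t)) \<le> 140 * (h + 1) * (L + 1) * (g * real b ^ 8) * card W"
proof -
  interpret attempt n b g h L E W "\<lambda>t. S (a * len + t)" "\<lambda>t. H (a * len + t)" "\<lambda>t. est (a * len + t)"
    "\<lambda>t. ok (a * len + t)" "\<lambda>q. level (cn a q)" by (rule attempt[OF a])
  define M where "M = 28 * (g * real b ^ 8) * card W * (real L + 1)"
  have M0: "0 \<le> M" by (simp add: M_def)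
  have Lp: "L < last_pos" by (simp add: last_pos_def)
  have load: "load (a * len + t) = (\<Sum>q\<in>S (a * len + t).
      card (target t (level (cn a q)) q (est (a * len + t) q) (ok (a * len + t) q) \<inter> W))"
    if t: "t \<le> last_pos" for t
    unfolding load_def attempt_mod[OF t] by (rule sum.cong) (use cnt_const[OF a t] in auto)
  have quiet: "load (a * len + t) \<le> M" if t: "t < last_pos" "t \<noteq> L" for t
    using quiet_volume[OF t] load[of t] t by (simp add: M_def algebra_simps)
  have busy: "load (a * len + t) \<le> (real h + 1) * M" if t: "t = L \<or> t = last_pos" for t
  proof -
    have le: "t \<le> last_pos" using t Lp by auto
    have "S (a * len + t) \<subseteq> A a" using S_mono[of 0 t] le by (simp add: A_def)
    moreover have "target t (level (cn a q)) q e act = nbr (level (cn a q)) q" for q e act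
      using t by (auto simp: target_def last_pos_def)
    ultimately show ?thesis using inquiry_volume[OF a, of "S (a * len + t)"] load[OF le] 
      by (simp add: M_def algebra_simps)
  qed
  have "(\<Sum>t<len. real (load (a * len + t))) = (\<Sum>t<last_pos. real (load (a * len + t))) + load (a * len + last_pos)"
    by (simp add: len_def)
  also have "(\<Sum>t<last_pos. real (load (a * len + t))) = load (a * len + L) + (\<Sum>t\<in>{..<last_pos} - {L}. real (load (a * len + t)))"
    by (rule sum.remove) (use Lp in auto)
  also have "\<dots> + load (a * len + last_pos) \<le> (real h + 1) * M + (\<Sum>t\<in>{..<last_pos} - {L}. M) + (real h + 1) * M"
    by (intro add_mono sum_mono busy quiet) auto
  also have "(\<Sum>t\<in>{..<last_pos} - {L}. M) = (L + 2 * real h + 1) * M" using Lp by (simp add: last_pos_def)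
  also have "(real h + 1) * M + (L + 2 * real h + 1) * M + (real h + 1) * M = (L + 4 * real h + 3) * M"
    by (simp add: algebra_simps)
  also have "\<dots> \<le> (5 * (real h + 1)) * M" using L_le M0 by (intro mult_right_mono) auto
  finally show ?thesis by (simp add: M_def algebra_simps)
qed

lemma stage_load:
  "(\<Sum>t<attempts * len. load t) \<le> 280 * (real h + 1) ^ 2 * (real L + 1) ^ 2 * (g * real b ^ 8) * card W"
proof -
  have split: "(\<Sum>t<m * len. real (load t)) = (\<Sum>a<m. \<Sum>t<len. real (load (a * len + t)))" for m
  proof (induction m)
    case (Suc m)
    have "(\<Sum>t<Suc m * len. real (load t)) = (\<Sum>t<m * len. real (load t)) + (\<Sum>t\<in>{m * len..<m * len + len}. real (load t))"
      by (subst sum.union_disjoint[symmetric]) (auto intro!: sum.cong)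
    also have "(\<Sum>t\<in>{m * len..<m * len + len}. real (load t)) = (\<Sum>t<len. real (load (m * len + t)))"
      using sum.shift_bounds_nat_ivl[of "\<lambda>t. real (load t)" 0 "m * len" len]
      by (simp add: atLeast0LessThan add.commute)
    finally show ?case using Suc by simp
  qed simp
  have "(\<Sum>t<attempts * len. real (load t)) \<le> (\<Sum>a<attempts. 140 * (real h + 1) * (real L + 1) * (g * real b ^ 8) * card W)"
    unfolding split using attempt_load by (intro sum_mono) (simp add: algebra_simps)
  also have "\<dots> = attempts * (140 * (real h + 1) * (real L + 1) * (g * real b ^ 8) * card W)" by simp
  also have "\<dots> \<le> (2 * ((real h + 1) * (real L + 1))) * (140 * (real h + 1) * (real L + 1) * (g * real b ^ 8) * card W)"
  proof (rule mult_right_mono)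
    have "real attempts = 2 * (real h * (real L + 1))" by (simp add: attempts_def algebra_simps)
    also have "\<dots> \<le> 2 * ((real h + 1) * (real L + 1))" by (intro mult_left_mono mult_right_mono) auto
    finally show "real attempts \<le> 2 * ((real h + 1) * (real L + 1))" .
  qed simp
  also have "\<dots> = 280 * (real h + 1) ^ 2 * (real L + 1) ^ 2 * (g * real b ^ 8) * card W"
  proof -
    have "2 * (x * y) * (140 * x * y * z * w) = 280 * x ^ 2 * y ^ 2 * z * w" for x y z w :: real
      by (simp add: power2_eq_square)
    thus ?thesis by blast
  qed
  finally show ?thesis by simp
qed

end

subsection \<open>Protocols with request-and-reply steps\<close>

text \<open>
  One step of a protocol takes two rounds: a process sends its message to its targets, and in the
  next round it answers everybody from whom it has just received something.
\<close>

locale protocol =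
  fixes n N len_msg :: nat and enc :: "'m \<Rightarrow> message" and dec :: "message \<Rightarrow> 'm" and msg :: "'s \<Rightarrow> 'm"
    and init :: "nat \<Rightarrow> bool \<Rightarrow> 's" and tgt :: "nat \<Rightarrow> nat \<Rightarrow> 's \<Rightarrow> nat set"
    and upd :: "nat \<Rightarrow> nat \<Rightarrow> 's \<Rightarrow> (nat \<Rightarrow> 'm option) \<Rightarrow> 's" and res :: "'s \<Rightarrow> nat" and Valid :: "'s set"
  assumes init_valid: "\<And>p x. init p x \<in> Valid"
    and upd_valid: "\<And>t p s f. s \<in> Valid \<Longrightarrow> (\<And>u m. f u = Some m \<Longrightarrow> m \<in> msg ` Valid) \<Longrightarrow> upd t p s f \<in> Valid"
    and dec_enc: "\<And>s. s \<in> Valid \<Longrightarrow> dec (enc (msg s)) = msg s"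
    and length_enc: "\<And>s. s \<in> Valid \<Longrightarrow> length (enc (msg s)) = len_msg"
    and len_msg_pos: "0 < len_msg"
begin

text \<open>The state changes only after the second round, so a request and a reply of the same
  sender carry the same content and either may be decoded.\<close>

definition hear :: "(nat \<Rightarrow> message) \<Rightarrow> (nat \<Rightarrow> message) \<Rightarrow> nat \<Rightarrow> 'm option" where
  "hear m1 m2 u = (if m1 u \<noteq> [] then Some (dec (m1 u)) else if m2 u \<noteq> [] then Some (dec (m2 u)) else None)"

text \<open>An algorithm is a function of the view, so the state is recomputed from it; two entries
  of the view make up one step.\<close>

primrec state :: "nat \<Rightarrow> nat \<Rightarrow> bool \<Rightarrow> view \<Rightarrow> 's" where
  "state 0 p x v = init p x"
| "state (Suc t) p x v = upd t p (state t p x v) (hear (v ! (2 * t)) (v ! (2 * t + 1)))"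

definition alg :: algorithm where
  "alg p x v =
     (let t = length v div 2; s = state t p x v in
      if N \<le> t then Return (res s)
      else if even (length v) then Multicast (\<lambda>q. if q \<in> tgt t p s then enc (msg s) else [])
      else Multicast (\<lambda>q. if (v ! (2 * t)) q \<noteq> [] then enc (msg s) else []))"

lemma state_append: "2 * t \<le> length v \<Longrightarrow> state t p x (v @ w) = state t p x v"
  by (induction t) (auto simp: nth_append)

end

locale protocol_run = protocol n N len_msg enc dec msg init tgt upd res Valid
  for n N len_msg :: nat and enc :: "'m \<Rightarrow> message" and dec :: "message \<Rightarrow> 'm" and msg :: "'s \<Rightarrow> 'm"
    and init :: "nat \<Rightarrow> bool \<Rightarrow> 's" and tgt :: "nat \<Rightarrow> nat \<Rightarrow> 's \<Rightarrow> nat set"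
    and upd :: "nat \<Rightarrow> nat \<Rightarrow> 's \<Rightarrow> (nat \<Rightarrow> 'm option) \<Rightarrow> 's" and res :: "'s \<Rightarrow> nat" and Valid :: "'s set" +
  fixes a :: "nat \<Rightarrow> bool" and adv :: adversary
begin

definition cfg :: "nat \<Rightarrow> config" where "cfg k = config_after n alg a adv k"
definition alive :: "nat \<Rightarrow> nat set" where "alive k = {1..n} - crashed (cfg k)"
definition crash :: "nat \<Rightarrow> nat \<Rightarrow> nat set option" where "crash k = adv (history n alg a adv k)"
definition del :: "nat \<Rightarrow> nat \<Rightarrow> nat \<Rightarrow> message" where "del k p q = delivered n alg a (cfg k) (crash k) p q"
definition snt :: "nat \<Rightarrow> nat \<Rightarrow> nat \<Rightarrow> message" where "snt k p q = sent n alg a (cfg k) p q"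
definition S :: "nat \<Rightarrow> nat set" where "S t = alive (2 * t)"
definition st :: "nat \<Rightarrow> nat \<Rightarrow> 's" where "st t p = state t p (a p) (views (cfg (2 * t)) p)"
definition heard :: "nat \<Rightarrow> nat \<Rightarrow> nat \<Rightarrow> 'm option" where
  "heard t q = hear (\<lambda>u. del (2 * t) u q) (\<lambda>u. del (2 * t + 1) u q)"

lemma cfg_Suc: "cfg (Suc k) = next_config n alg a (cfg k) (crash k)"
  unfolding cfg_def crash_def config_after_def by (simp add: Let_def)

lemma cfg_0: "cfg 0 = \<lparr> crashed = {}, views = (\<lambda>_. []) \<rparr>"
  by (simp add: cfg_def config_after_def)

lemma alive_Suc: "p \<in> alive (Suc k) \<longleftrightarrow> p \<in> alive k \<and> crash k p = None"
  unfolding alive_def cfg_Suc next_config_def Let_def by auto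

lemma alive_antimono: "j \<le> k \<Longrightarrow> alive k \<subseteq> alive j"
  by (induction k rule: dec_induct) (auto simp: alive_Suc)

lemma alive_sub: "alive k \<subseteq> {1..n}"
  by (auto simp: alive_def)

lemma not_returned: "length (views (cfg k) p) < 2 * N \<Longrightarrow> \<not> returned alg a (cfg k) p"
  by (auto simp: returned_def alg_def Let_def)

lemma views_Suc:
  assumes "p \<in> alive (Suc k)" "length (views (cfg k) p) < 2 * N"
  shows "views (cfg (Suc k)) p = views (cfg k) p @ [\<lambda>u. del k u p]"
  using assms not_returned[OF assms(2)]
  unfolding alive_def cfg_Suc next_config_def Let_def del_def by auto

lemma views_length: "k \<le> 2 * N \<Longrightarrow> p \<in> alive k \<Longrightarrow> length (views (cfg k) p) = k"
proof (induction k)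
  case (Suc k)
  hence "length (views (cfg k) p) = k" by (auto simp: alive_Suc)
  thus ?case using views_Suc[of p k] Suc.prems by simp
qed (simp add: cfg_0)

lemma views_Suc': "k < 2 * N \<Longrightarrow> p \<in> alive (Suc k) \<Longrightarrow> views (cfg (Suc k)) p = views (cfg k) p @ [\<lambda>u. del k u p]"
  using views_Suc[of p k] views_length[of k p] by (auto simp: alive_Suc)

lemma st_0: "st 0 p = init p (a p)"
  by (simp add: st_def)

lemma st_Suc:
  assumes t: "t < N" and p: "p \<in> S (Suc t)"
  shows "st (Suc t) p = upd t p (st t p) (heard t p)"
proof -
  have p2: "p \<in> alive (Suc (Suc (2 * t)))" using p by (simp add: S_def)
  hence p1: "p \<in> alive (Suc (2 * t))" and p0: "p \<in> alive (2 * t)" by (auto simp: alive_Suc)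
  define v where "v = views (cfg (2 * t)) p"
  have len: "length v = 2 * t" using views_length[of "2 * t" p] p0 t by (simp add: v_def)
  have "views (cfg (2 * Suc t)) p = v @ [\<lambda>u. del (2 * t) u p, \<lambda>u. del (2 * t + 1) u p]"
    using views_Suc'[of "2 * t" p] views_Suc'[of "Suc (2 * t)" p] p1 p2 t by (simp add: v_def)
  thus ?thesis using len
    by (simp add: st_def v_def[symmetric] state_append heard_def nth_append)
qed

lemma snt_even:
  "t < N \<Longrightarrow> snt (2 * t) p q = (if p \<in> S t \<and> q \<in> tgt t p (st t p) then enc (msg (st t p)) else [])"
  using views_length[of "2 * t" p]
  by (auto simp: snt_def sent_def S_def alive_def alg_def st_def Let_def)

lemma snt_odd:
  assumes t: "t < N"
  shows "snt (Suc (2 * t)) p q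
         = (if p \<in> alive (Suc (2 * t)) \<and> del (2 * t) q p \<noteq> [] then enc (msg (st t p)) else [])"
proof (cases "p \<in> alive (Suc (2 * t))")
  case True
  hence p0: "p \<in> alive (2 * t)" by (simp add: alive_Suc)
  define v where "v = views (cfg (2 * t)) p"
  have len: "length v = 2 * t" using views_length[of "2 * t" p] p0 t by (simp add: v_def)
  have "views (cfg (Suc (2 * t))) p = v @ [\<lambda>u. del (2 * t) u p]"
    using views_Suc'[of "2 * t" p] True t by (simp add: v_def)
  thus ?thesis using True len t
    by (auto simp: snt_def sent_def alive_def alg_def st_def Let_def v_def[symmetric] state_append nth_append)
next
  case False
  thus ?thesis by (auto simp: snt_def sent_def alive_def)
qed

lemma del_sub: "del k p q = [] \<or> del k p q = snt k p q"
  and del_alive: "p \<in> alive (Suc k) \<Longrightarrow> del k p q = snt k p q"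
  by (auto simp: del_def delivered_def snt_def alive_Suc split: option.splits)

lemma S_Suc: "S (Suc t) \<subseteq> alive (Suc (2 * t))" "S (Suc t) \<subseteq> S t"
  using alive_antimono[of "Suc (2 * t)" "Suc (Suc (2 * t))"] alive_antimono[of "2 * t" "Suc (Suc (2 * t))"]
  by (auto simp: S_def)

text \<open>Decoding is correct only for valid states, and states remain valid only if what is heard
  is valid. Validity at time t is therefore assumed here, and the induction in
  \<open>st_valid\<close> closes the circle.\<close>

lemma heard_valid:
  assumes t: "t < N" and valid: "\<And>u. u \<in> S t \<Longrightarrow> st t u \<in> Valid" and m: "heard t q u = Some m"
  shows "u \<in> S t \<and> m = msg (st t u) \<and> (q \<in> tgt t u (st t u) \<or> u \<in> tgt t q (st t q))"
proof (cases "del (2 * t) u q = []")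
  case False
  hence "del (2 * t) u q = snt (2 * t) u q" using del_sub[of "2 * t" u q] by auto
  thus ?thesis using False m snt_even[OF t, of u q] dec_enc valid
    by (auto simp: heard_def hear_def split: if_splits)
next
  case True
  hence ne: "del (Suc (2 * t)) u q \<noteq> []" and md: "m = dec (del (Suc (2 * t)) u q)"
    using m by (auto simp: heard_def hear_def split: if_splits)
  have "del (Suc (2 * t)) u q = snt (Suc (2 * t)) u q" using del_sub[of "Suc (2 * t)" u q] ne by auto
  hence u: "u \<in> alive (Suc (2 * t))" "del (2 * t) q u \<noteq> []" "m = dec (enc (msg (st t u)))"
    using ne md snt_odd[OF t, of u q] by (auto split: if_splits)
  hence "snt (2 * t) q u \<noteq> []" using del_sub[of "2 * t" q u] by auto
  hence "u \<in> tgt t q (st t q)" using snt_even[OF t, of q u] by (auto split: if_splits)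
  moreover have "u \<in> S t" using u(1) by (simp add: S_def alive_Suc)
  ultimately show ?thesis using u(3) dec_enc valid by auto
qed

lemma st_valid: "t \<le> N \<Longrightarrow> p \<in> S t \<Longrightarrow> st t p \<in> Valid"
proof (induction t arbitrary: p)
  case (Suc t)
  have t: "t < N" using Suc.prems by simp
  have valid: "\<And>u. u \<in> S t \<Longrightarrow> st t u \<in> Valid" using Suc.IH t by simp
  have "p \<in> S t" using Suc.prems S_Suc(2)[of t] by auto
  thus ?case unfolding st_Suc[OF t Suc.prems(2)]
    using upd_valid valid heard_valid[OF t valid] by blast
qed (simp add: st_0 init_valid)

lemma heard_sound:
  assumes "t < N" and "heard t q u = Some m"
  shows "u \<in> S t" "m = msg (st t u)" "q \<in> tgt t u (st t u) \<or> u \<in> tgt t q (st t q)"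
  using heard_valid[OF assms(1) _ assms(2)] st_valid[of t] assms(1) by auto

lemma heard_complete:
  assumes t: "t < N" and q: "q \<in> S (Suc t)" and u: "u \<in> S (Suc t)"
    and T: "q \<in> tgt t u (st t u) \<or> u \<in> tgt t q (st t q)"
  shows "heard t q u \<noteq> None"
proof -
  have ne: "enc (msg (st t x)) \<noteq> []" if "x \<in> S (Suc t)" for x
    using length_enc[of "st t x"] st_valid[of t x] S_Suc(2)[of t] that t len_msg_pos by fastforce
  have even: "del (2 * t) x y \<noteq> []" if "x \<in> S (Suc t)" "y \<in> tgt t x (st t x)" for x y
  proof -
    have "x \<in> alive (Suc (2 * t))" "x \<in> S t" using S_Suc[of t] that(1) by blast+
    thus ?thesis using del_alive snt_even[OF t, of x y] ne[OF that(1)] that(2) by simp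
  qed
  show ?thesis
  proof (cases "q \<in> tgt t u (st t u)")
    case True
    thus ?thesis using even[OF u] by (simp add: heard_def hear_def)
  next
    case False
    hence "del (2 * t) q u \<noteq> []" using T even[OF q] by simp
    hence "snt (Suc (2 * t)) u q \<noteq> []" using snt_odd[OF t, of u q] ne[OF u] S_Suc(1)[of t] u by auto
    moreover have "u \<in> alive (Suc (Suc (2 * t)))" using u by (simp add: S_def)
    ultimately have "del (Suc (2 * t)) u q \<noteq> []" using del_alive by simp
    thus ?thesis by (simp add: heard_def hear_def)
  qed
qed

lemma returned_final: "p \<in> S N \<Longrightarrow> alg p (a p) (views (cfg (2 * N)) p) = Return (res (st N p))"
  using views_length[of "2 * N" p] by (simp add: S_def alg_def st_def)

lemma terminated_final: "terminated n alg a adv (2 * N)"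
  using returned_final unfolding terminated_def Let_def returned_def
  by (auto simp: S_def alive_def cfg_def)

lemma rounds_le: "rounds n alg a adv \<le> 2 * N"
  unfolding rounds_def by (rule Least_le) (rule terminated_final)

text \<open>A live process does not return before time 2 N, so the least terminated time can be
  smaller only if everybody has crashed.\<close>

lemma early_termination:
  assumes "rounds n alg a adv < 2 * N"
  shows "alive (rounds n alg a adv) = {}"
proof (rule ccontr)
  assume "alive (rounds n alg a adv) \<noteq> {}"
  then obtain p where p: "p \<in> alive (rounds n alg a adv)" by auto
  have "terminated n alg a adv (rounds n alg a adv)"
    unfolding rounds_def by (rule LeastI[where P = "terminated n alg a adv"], rule terminated_final)
  hence "returned alg a (cfg (rounds n alg a adv)) p"
    using p unfolding terminated_def Let_def by (auto simp: alive_def cfg_def)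
  moreover have "length (views (cfg (rounds n alg a adv)) p) < 2 * N" using views_length[OF _ p] assms by simp
  ultimately show False using not_returned by blast
qed

lemma bits_le:
  "total_bits n alg a adv \<le> (\<Sum>t<N. 2 * len_msg * (\<Sum>p\<in>S t. card (tgt t p (st t p) \<inter> {1..n})))"
proof -
  define f where "f k = (\<Sum>p\<in>{1..n}. \<Sum>q\<in>{1..n}. length (snt k p q))" for k
  have "total_bits n alg a adv = (\<Sum>k<rounds n alg a adv. f k)"
    unfolding total_bits_def f_def snt_def cfg_def ..
  also have "\<dots> \<le> (\<Sum>k<2 * N. f k)" using rounds_le by (intro sum_mono2) auto
  also have "\<dots> = (\<Sum>t<N. f (2 * t) + f (Suc (2 * t)))" by (induction N) auto
  also have "\<dots> \<le> (\<Sum>t<N. 2 * len_msg * (\<Sum>p\<in>S t. card (tgt t p (st t p) \<inter> {1..n})))"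
  proof (rule sum_mono)
    fix t assume "t \<in> {..<N}"
    hence t: "t < N" by simp
    define w where "w p q = (if p \<in> S t \<and> q \<in> tgt t p (st t p) then len_msg else 0)" for p q
    have len: "length (enc (msg (st t p))) = len_msg" if "p \<in> S t" for p
      using length_enc st_valid[of t p] t that by simp
    have even: "length (snt (2 * t) p q) \<le> w p q" for p q
      using snt_even[OF t, of p q] len by (auto simp: w_def)
    \<comment> \<open>A reply from p to q presupposes a request from q to p and has the same length,
      hence the swapped arguments of \<open>w\<close>.\<close>
    have odd: "length (snt (Suc (2 * t)) p q) \<le> w q p" for p q
    proof (cases "p \<in> alive (Suc (2 * t)) \<and> del (2 * t) q p \<noteq> []")
      case True
      hence "snt (2 * t) q p \<noteq> []" using del_sub[of "2 * t" q p] by auto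
      hence "w q p = len_msg" using snt_even[OF t, of q p] by (auto simp: w_def split: if_splits)
      moreover have "p \<in> S t" using True by (simp add: S_def alive_Suc)
      ultimately show ?thesis using snt_odd[OF t, of p q] len by auto
    qed (use snt_odd[OF t, of p q] in auto)
    have w: "(\<Sum>p\<in>{1..n}. \<Sum>q\<in>{1..n}. w p q) = len_msg * (\<Sum>p\<in>S t. card (tgt t p (st t p) \<inter> {1..n}))"
    proof -
      have sub: "S t \<subseteq> {1..n}" using alive_sub by (simp add: S_def)
      have row: "(\<Sum>q\<in>{1..n}. w p q) = (if p \<in> S t then len_msg * card (tgt t p (st t p) \<inter> {1..n}) else 0)" for p
      proof (cases "p \<in> S t")
        case True
        have "(\<Sum>q\<in>{1..n}. w p q) = (\<Sum>q\<in>{1..n}. if q \<in> tgt t p (st t p) then len_msg else 0)"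
          using True by (simp add: w_def)
        also have "\<dots> = (\<Sum>q\<in>{1..n} \<inter> tgt t p (st t p). len_msg)" by (rule sum.inter_restrict[symmetric]) simp
        finally show ?thesis using True by (simp add: Int_commute)
      qed (simp add: w_def)
      have "(\<Sum>p\<in>{1..n}. \<Sum>q\<in>{1..n}. w p q) = (\<Sum>p\<in>S t. len_msg * card (tgt t p (st t p) \<inter> {1..n}))"
        unfolding row using sub by (intro sum.mono_neutral_cong_right) auto
      thus ?thesis by (simp add: sum_distrib_left)
    qed
    have "f (2 * t) \<le> (\<Sum>p\<in>{1..n}. \<Sum>q\<in>{1..n}. w p q)" unfolding f_def by (intro sum_mono even)
    moreover have "f (Suc (2 * t)) \<le> (\<Sum>p\<in>{1..n}. \<Sum>q\<in>{1..n}. w q p)" unfolding f_def by (intro sum_mono odd)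
    moreover have "(\<Sum>p\<in>{1..n}. \<Sum>q\<in>{1..n}. w q p) = (\<Sum>p\<in>{1..n}. \<Sum>q\<in>{1..n}. w p q)" by (rule sum.swap)
    ultimately show "f (2 * t) + f (Suc (2 * t)) \<le> 2 * len_msg * (\<Sum>p\<in>S t. card (tgt t p (st t p) \<inter> {1..n}))"
      unfolding w by simp
  qed
  finally show ?thesis .
qed

end

lemma (in protocol) solves:
  assumes "\<And>a adv p. p \<in> protocol_run.S n N enc dec msg init tgt upd res a adv N \<Longrightarrow>
      card {q \<in> protocol_run.S n N enc dec msg init tgt upd res a adv N. a q}
        \<le> res (protocol_run.st n N enc dec msg init tgt upd res a adv N p) \<and>
      res (protocol_run.st n N enc dec msg init tgt upd res a adv N p) \<le> card {q \<in> {1..n}. a q}"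
  shows "solves_fuzzy_counting n alg"
  unfolding solves_fuzzy_counting_def Let_def
proof (intro allI conjI ballI)
  fix a adv
  interpret run: protocol_run n N len_msg enc dec msg init tgt upd res Valid a adv by unfold_locales
  show "\<exists>t. terminated n alg a adv t" using run.terminated_final by blast
  fix p assume p: "p \<in> {1..n} - crashed (final_config n alg a adv)"
  have fin: "final_config n alg a adv = run.cfg (rounds n alg a adv)" by (simp add: final_config_def run.cfg_def)
  \<comment> \<open>The existence of the live process p excludes early termination.\<close>
  have "rounds n alg a adv = 2 * N"
    using run.rounds_le run.early_termination p unfolding fin run.alive_def by fastforce
  hence fin': "final_config n alg a adv = run.cfg (2 * N)" using fin by simp
  hence "p \<in> run.S N" using p by (simp add: run.S_def run.alive_def)
  moreover have "run.S N = {1..n} - crashed (final_config n alg a adv)" unfolding fin' by (simp add: run.S_def run.alive_def)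
  ultimately show "\<exists>v. alg p (a p) (views (final_config n alg a adv) p) = Return v \<and>
      card {q \<in> {1..n} - crashed (final_config n alg a adv). a q} \<le> v \<and> v \<le> card {q \<in> {1..n}. a q}"
    using assms[of p a adv] run.returned_final[of p] fin' by auto
qed

subsection \<open>Counting by stages\<close>

text \<open>A message consists of the table of counts by slot, the estimate and the activity flag.
  The counter of unhappy attempts stays local.\<close>

type_synonym content = "(nat \<Rightarrow> nat option) \<times> nat \<times> bool"
type_synonym local_state = "content \<times> nat"

locale counting = overlay +
  fixes x s :: nat
  assumes x_ge: "2 \<le> x" and n_less_x: "n < x ^ s"
begin

definition stage_len :: nat where "stage_len = attempts * len"

text \<open>Digit l of an identifier in base x, and its leading digits from digit l on.\<close>

definition slot :: "nat \<Rightarrow> nat \<Rightarrow> nat" where "slot l r = r div x ^ l mod x"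

definition block :: "nat \<Rightarrow> nat \<Rightarrow> nat" where "block l r = r div x ^ l"

definition single :: "nat \<Rightarrow> nat \<Rightarrow> nat \<Rightarrow> nat option" where
  "single j v = (\<lambda>i. if i = j then Some v else None)"

text \<open>The cap keeps the value encodable for arbitrary valid tables. In a run it changes
  nothing, because the sum never exceeds the number of identifiers in the block.\<close>

definition total :: "(nat \<Rightarrow> nat option) \<Rightarrow> nat" where
  "total k = min n (\<Sum>j<x. case k j of None \<Rightarrow> 0 | Some v \<Rightarrow> v)"

text \<open>Different correct counts of the same sub-block may circulate. Each lies between the
  required bounds, so any of them may be adopted, and a known one is kept.\<close>

definition merge :: "(nat \<Rightarrow> nat option) \<Rightarrow> (nat \<Rightarrow> content option) \<Rightarrow> nat \<Rightarrow> nat option" where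
  "merge k f = (\<lambda>j. if k j = None \<and> (\<exists>u m v. f u = Some m \<and> fst m j = Some v)
                    then Some (SOME v. \<exists>u m. f u = Some m \<and> fst m j = Some v) else k j)"

definition first_state :: "nat \<Rightarrow> bool \<Rightarrow> local_state" where
  "first_state r a = ((single (slot 0 r) (if a then 1 else 0), 0, True), 0)"

definition targets :: "nat \<Rightarrow> nat \<Rightarrow> local_state \<Rightarrow> nat set" where
  "targets t r st = target (t mod len) (level (snd st)) r (fst (snd (fst st))) (snd (snd (fst st)))
       \<inter> {q. block (Suc (t div stage_len)) q = block (Suc (t div stage_len)) r}"

definition happy_state :: "local_state \<Rightarrow> (nat \<Rightarrow> content option) \<Rightarrow> bool" where
  "happy_state st f \<longleftrightarrow> snd (snd (fst st)) \<or> (\<exists>u m. f u = Some m \<and> snd (snd m))"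

definition update :: "nat \<Rightarrow> nat \<Rightarrow> local_state \<Rightarrow> (nat \<Rightarrow> content option) \<Rightarrow> local_state" where
  "update t r st f =
     (let m = t mod len; k = merge (fst (fst st)) f; e = fst (snd (fst st)); act = snd (snd (fst st));
          e' = step_est m e (card ({u. f u \<noteq> None} \<inter> nbr m r));
          act' = step_ok m e act (card {u \<in> {u. f u \<noteq> None} \<inter> nbr e r. fst (snd (the (f u))) = e \<and> snd (snd (the (f u)))})
      in if Suc t mod stage_len = 0
         then ((single (slot (Suc t div stage_len) r) (total k), e', act'), 0)
         else ((k, e', act'), step_cnt m (snd st) (happy_state st f)))"

definition result :: "local_state \<Rightarrow> nat" where
  "result st = (case fst (fst st) 0 of None \<Rightarrow> 0 | Some v \<Rightarrow> v)"

definition contents :: "content set" where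
  "contents = {k. (\<forall>j. j \<ge> x \<longrightarrow> k j = None) \<and> (\<forall>j v. k j = Some v \<longrightarrow> v \<le> n)} \<times> {..L} \<times> UNIV"

definition Valid :: "local_state set" where "Valid = contents \<times> UNIV"

text \<open>There are x entries with n + 2 possible values each (a count or \<open>None\<close>), at
  most \<open>2 ^ h\<close> estimates, and one flag.\<close>

definition bits :: nat where "bits = (g + 1) * x + h + 1"

lemma stage_len_pos: "0 < stage_len"
  using h_pos by (simp add: stage_len_def attempts_def len_def)

lemma slot_less: "slot l r < x"
  using x_ge by (simp add: slot_def)

lemma block_slot: "block l r = x * block (Suc l) r + slot l r"
proof -
  have "r div x ^ Suc l = r div x ^ l div x" by (simp only: power_Suc2 div_mult2_eq)
  thus ?thesis unfolding block_def slot_def by (metis mult_div_mod_eq)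
qed

lemma finite_contents: "finite contents" and card_contents: "card contents \<le> 2 ^ bits"
proof -
  define K where "K = {k :: nat \<Rightarrow> nat option. (\<forall>j. j \<ge> x \<longrightarrow> k j = None) \<and> (\<forall>j v. k j = Some v \<longrightarrow> v \<le> n)}"
  define code where "code k = map (\<lambda>j. case k j of None \<Rightarrow> 0 | Some v \<Rightarrow> Suc v) [0..<x]" for k :: "nat \<Rightarrow> nat option"
  define C where "C = {xs. set xs \<subseteq> {..Suc n} \<and> length xs = x}"
  have inj: "inj_on code K"
  proof (rule inj_onI)
    fix k k' assume k: "k \<in> K" "k' \<in> K" "code k = code k'"
    show "k = k'"
    proof
      fix j
      show "k j = k' j"
      proof (cases "j < x")
        case True
        hence "code k ! j = code k' ! j" using k by simp
        thus ?thesis using True by (simp add: code_def split: option.splits)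
      next
        case False
        thus ?thesis using k by (simp add: K_def)
      qed
    qed
  qed
  have sub: "code ` K \<subseteq> C"
    by (force simp: code_def C_def K_def split: option.splits)
  have finC: "finite C" unfolding C_def by (rule finite_lists_length_eq) simp
  have finK: "finite K" using finite_imageD[OF finite_subset[OF sub finC] inj] .
  have cK: "card K \<le> (n + 2) ^ x"
  proof -
    have "card K = card (code ` K)" using inj by (simp add: card_image)
    also have "\<dots> \<le> card C" using sub finC by (rule card_mono[rotated])
    also have "\<dots> = (n + 2) ^ x" unfolding C_def by (subst card_lists_length_eq) auto
    finally show ?thesis .
  qed
  have contents: "contents = K \<times> {..L} \<times> UNIV" by (simp add: contents_def K_def)
  show "finite contents" unfolding contents using finK by simp
  have "card contents = card K * ((L + 1) * 2)"
    unfolding contents by (simp add: card_cartesian_product)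
  also have "\<dots> \<le> (2 ^ (g + 1)) ^ x * (2 ^ h * 2)"
  proof (intro mult_le_mono)
    have "n + 2 \<le> 2 ^ (g + 1)"
    proof -
      have "(2::nat) ^ 1 \<le> 2 ^ g" using g_ge by (intro power_increasing) auto
      thus ?thesis using n_le_pow by simp
    qed
    thus "card K \<le> (2 ^ (g + 1)) ^ x" using cK power_mono[of "n + 2" "2 ^ (g + 1)" x] by linarith
    have "h < 2 ^ h" by (rule less_exp)
    thus "L + 1 \<le> 2 ^ h" using L_le by linarith
  qed simp
  also have "\<dots> = 2 ^ bits" by (simp add: bits_def power_add power_mult algebra_simps)
  finally show "card contents \<le> 2 ^ bits" .
qed

lemma exists_encoding: "\<exists>enc :: content \<Rightarrow> message. inj_on enc contents \<and> (\<forall>m\<in>contents. length (enc m) = bits)"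
proof -
  have fin: "finite {bs :: message. set bs \<subseteq> UNIV \<and> length bs = bits}" by (rule finite_lists_length_eq) simp
  have "card contents \<le> card {bs :: message. set bs \<subseteq> UNIV \<and> length bs = bits}"
    using card_contents by (subst card_lists_length_eq) auto
  then obtain f where "f ` contents \<subseteq> {bs :: message. set bs \<subseteq> UNIV \<and> length bs = bits}" "inj_on f contents"
    using card_le_inj[OF finite_contents fin] by blast
  thus ?thesis by (intro exI[of _ f]) auto
qed

definition encode :: "content \<Rightarrow> message" where
  "encode = (SOME enc. inj_on enc contents \<and> (\<forall>m\<in>contents. length (enc m) = bits))"

lemma encode: "inj_on encode contents" "m \<in> contents \<Longrightarrow> length (encode m) = bits"
  using someI_ex[OF exists_encoding] unfolding encode_def[symmetric] by auto

lemma merge_None: "merge k f j = None \<longleftrightarrow> k j = None \<and> (\<forall>u m. f u = Some m \<longrightarrow> fst m j = None)"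
  by (auto simp: merge_def)

lemma merge_Some: "merge k f j = Some v \<Longrightarrow> k j = Some v \<or> (\<exists>u m. f u = Some m \<and> fst m j = Some v)"
proof -
  assume *: "merge k f j = Some v"
  show ?thesis
  proof (cases "k j = None \<and> (\<exists>u m v. f u = Some m \<and> fst m j = Some v)")
    case True
    hence "\<exists>v u m. f u = Some m \<and> fst m j = Some v" by blast
    from someI_ex[OF this] show ?thesis using * True by (simp add: merge_def)
  next
    case False
    show ?thesis using * unfolding merge_def if_not_P[OF False] by blast
  qed
qed

sublocale protocol n "s * stage_len" bits encode "inv_into contents encode" fst first_state targets update result Valid
proof
  show "first_state r a \<in> Valid" for r a
    using slot_less[of 0 r] n_ge by (auto simp: first_state_def Valid_def contents_def single_def)
  show "0 < bits" by (simp add: bits_def)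
  show "inv_into contents encode (encode (fst st)) = fst st" "length (encode (fst st)) = bits" if "st \<in> Valid" for st
    using that encode by (auto simp: Valid_def)
  show "update t r st f \<in> Valid"
    if st: "st \<in> Valid" and f: "\<And>u m. f u = Some m \<Longrightarrow> m \<in> fst ` Valid" for t r st f
  proof -
    have f': "m \<in> contents" if "f u = Some m" for u m using f[OF that] by (auto simp: Valid_def)
    have st': "fst st \<in> contents" using st by (auto simp: Valid_def)
    have k: "(\<forall>j. j \<ge> x \<longrightarrow> merge (fst (fst st)) f j = None) \<and> (\<forall>j v. merge (fst (fst st)) f j = Some v \<longrightarrow> v \<le> n)"
    proof (intro conjI allI impI)
      fix j assume "x \<le> j"
      thus "merge (fst (fst st)) f j = None"
        unfolding merge_None using st' f' by (fastforce simp: contents_def)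
    next
      fix j v assume "merge (fst (fst st)) f j = Some v"
      from merge_Some[OF this] show "v \<le> n" using st' f' by (fastforce simp: contents_def)
    qed
    have e: "step_est m (fst (snd (fst st))) c \<le> L" for m c
      using st' by (auto simp: step_est_def contents_def)
    show ?thesis
      using k e slot_less[of "Suc t div stage_len" r]
      by (auto simp: update_def Let_def Valid_def contents_def single_def total_def)
  qed
qed

lemma block_div: "block (Suc l) r = block l r div x" and slot_mod: "slot l r = block l r mod x"
  unfolding block_def slot_def by (simp_all only: power_Suc2 div_mult2_eq)

lemma card_block_sum:
  assumes X: "finite X"
  shows "card {q \<in> X. block (Suc l) q = c \<and> a q} = (\<Sum>j<x. card {q \<in> X. block l q = x * c + j \<and> a q})"
proof -
  define Y where "Y = {q \<in> X. block (Suc l) q = c \<and> a q}"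
  have "(\<Sum>q\<in>Y. 1::nat) = (\<Sum>j<x. \<Sum>q\<in>{q \<in> Y. slot l q = j}. 1)"
    by (rule sum.group[symmetric]) (use X slot_less in \<open>auto simp: Y_def\<close>)
  hence "card Y = (\<Sum>j<x. card {q \<in> Y. slot l q = j})" by simp
  moreover have Yj: "{q \<in> Y. slot l q = j} = {q \<in> X. block l q = x * c + j \<and> a q}" if "j \<in> {..<x}" for j
  proof -
    have "block l q = x * c + j \<longleftrightarrow> block (Suc l) q = c \<and> slot l q = j" for q
      using block_slot[of l q] that by (auto simp: block_div slot_mod)
    thus ?thesis by (auto simp: Y_def)
  qed
  hence "(\<Sum>j<x. card {q \<in> Y. slot l q = j}) = (\<Sum>j<x. card {q \<in> X. block l q = x * c + j \<and> a q})"
    by (intro sum.cong refl arg_cong[where f = card])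
  ultimately show ?thesis unfolding Y_def by (rule trans)
qed

end

section \<open>The counting protocol against a fixed adversary\<close>

locale counting_run = counting +
  fixes a :: "nat \<Rightarrow> bool" and adv :: adversary
begin

sublocale protocol_run n "s * stage_len" bits encode "inv_into contents encode" fst first_state targets update result Valid a adv
  by unfold_locales

definition kn :: "nat \<Rightarrow> nat \<Rightarrow> nat \<Rightarrow> nat option" where "kn t q = fst (fst (st t q))"
definition es :: "nat \<Rightarrow> nat \<Rightarrow> nat" where "es t q = fst (snd (fst (st t q)))"
definition ac :: "nat \<Rightarrow> nat \<Rightarrow> bool" where "ac t q = snd (snd (fst (st t q)))"
definition Hd :: "nat \<Rightarrow> nat \<Rightarrow> nat set" where "Hd t q = {u. heard t q u \<noteq> None}"
definition W :: "nat \<Rightarrow> nat \<Rightarrow> nat set" where "W l c = {q \<in> {1..n}. block (Suc l) q = c}"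

lemma S_sub: "S t \<subseteq> {1..n}"
  using alive_sub by (simp add: S_def)

lemma S_in: "q \<in> S t \<Longrightarrow> q \<in> {1..n}"
  using S_sub by (rule subsetD)

lemma S_anti: "t \<le> t' \<Longrightarrow> S t' \<subseteq> S t"
  unfolding S_def by (rule alive_antimono) simp

lemma heard_state: "t < s * stage_len \<Longrightarrow> u \<in> Hd t q \<Longrightarrow> heard t q u = Some (kn t u, es t u, ac t u) \<and> u \<in> S t"
  using heard_sound[of t q u] by (auto simp: Hd_def kn_def es_def ac_def)

lemma heard_linked:
  assumes "t < s * stage_len" "u \<in> Hd t q"
  shows "(u \<in> target (t mod len) (level (snd (st t q))) q (es t q) (ac t q) \<or>
          q \<in> target (t mod len) (level (snd (st t u))) u (es t u) (ac t u)) \<and>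
         block (Suc (t div stage_len)) u = block (Suc (t div stage_len)) q"
  using assms heard_sound(3)[of t q u] by (auto simp: Hd_def targets_def es_def ac_def)

lemma linked_heard:
  assumes t: "t < s * stage_len" and q: "q \<in> S (Suc t)" "u \<in> S (Suc t)"
    and "u \<in> target (t mod len) (level (snd (st t q))) q (es t q) (ac t q) \<or>
          q \<in> target (t mod len) (level (snd (st t u))) u (es t u) (ac t u)"
    and "block (Suc (t div stage_len)) u = block (Suc (t div stage_len)) q"
  shows "u \<in> Hd t q"
  using heard_complete[OF t q] assms(4,5) by (auto simp: Hd_def targets_def es_def ac_def)

lemma happy_iff: "t < s * stage_len \<Longrightarrow> happy_state (st t q) (heard t q) \<longleftrightarrow> ac t q \<or> (\<exists>u\<in>Hd t q. ac t u)"
  using heard_state[of t _ q] by (fastforce simp: happy_state_def ac_def Hd_def)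

lemma es_Suc:
  assumes "t < s * stage_len" "q \<in> S (Suc t)"
  shows "es (Suc t) q = step_est (t mod len) (es t q) (card (Hd t q \<inter> nbr (t mod len) q))"
  using st_Suc[OF assms] by (simp add: update_def Let_def es_def Hd_def)

lemma ac_Suc:
  assumes "t < s * stage_len" "q \<in> S (Suc t)"
  shows "ac (Suc t) q = step_ok (t mod len) (es t q) (ac t q) (card {u \<in> Hd t q \<inter> nbr (es t q) q. es t u = es t q \<and> ac t u})"
proof -
  have "{u \<in> {u. heard t q u \<noteq> None} \<inter> nbr (es t q) q. fst (snd (the (heard t q u))) = es t q \<and> snd (snd (the (heard t q u)))}
        = {u \<in> Hd t q \<inter> nbr (es t q) q. es t u = es t q \<and> ac t u}"
    using heard_state[OF assms(1), of _ q] by (force simp: Hd_def)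
  thus ?thesis using st_Suc[OF assms] by (simp add: update_def Let_def es_def ac_def)
qed

lemma cnt_Suc:
  assumes "t < s * stage_len" "q \<in> S (Suc t)"
  shows "snd (st (Suc t) q) = (if Suc t mod stage_len = 0 then 0
           else step_cnt (t mod len) (snd (st t q)) (ac t q \<or> (\<exists>u\<in>Hd t q. ac t u)))"
  using st_Suc[OF assms] happy_iff[OF assms(1)] by (simp add: update_def Let_def)

lemma kn_Suc:
  assumes "t < s * stage_len" "q \<in> S (Suc t)"
  shows "kn (Suc t) q = (if Suc t mod stage_len = 0
           then single (slot (Suc t div stage_len) q) (total (merge (kn t q) (heard t q))) else merge (kn t q) (heard t q))"
  using st_Suc[OF assms] by (simp add: update_def Let_def kn_def)

lemma time_in_stage:
  assumes "l < s" "t < stage_len"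
  shows "l * stage_len + t < s * stage_len" "(l * stage_len + t) div stage_len = l"
    "(l * stage_len + t) mod len = t mod len" "Suc (l * stage_len + t) mod stage_len = 0 \<longleftrightarrow> Suc t = stage_len"
proof -
  have "l * stage_len + t < Suc l * stage_len" using assms by simp
  also have "\<dots> \<le> s * stage_len" using assms by (intro mult_right_mono) auto
  finally show "l * stage_len + t < s * stage_len" .
  show "(l * stage_len + t) div stage_len = l" using assms by simp
  show "(l * stage_len + t) mod len = t mod len" by (simp add: stage_len_def mult.assoc[symmetric])
  have "Suc (l * stage_len + t) mod stage_len = Suc t mod stage_len" by (simp flip: add_Suc_right)
  thus "Suc (l * stage_len + t) mod stage_len = 0 \<longleftrightarrow> Suc t = stage_len"
    using assms by (cases "Suc t = stage_len") auto
qed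

lemma stage_start:
  assumes "l \<le> s" "q \<in> S (l * stage_len)"
  shows "es (l * stage_len) q = 0 \<and> ac (l * stage_len) q \<and> snd (st (l * stage_len) q) = 0"
proof (cases l)
  case 0
  thus ?thesis by (simp add: es_def ac_def st_0 first_state_def)
next
  case (Suc k)
  define t where "t = k * stage_len + (stage_len - 1)"
  have k: "k < s" "stage_len - 1 < stage_len" using assms Suc stage_len_pos by auto
  note time = time_in_stage[OF k, folded t_def]
  have Suct: "Suc t = l * stage_len" using stage_len_pos by (simp add: t_def Suc)
  \<comment> \<open>A stage ends together with an attempt, so estimate and activity are reset by the
    same step that resets the counter.\<close>
  have "(stage_len - 1) mod len = last_pos"
  proof -
    obtain m where m: "attempts = Suc m" using h_pos by (cases attempts) (auto simp: attempts_def)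
    have "stage_len - 1 = m * len + last_pos" by (simp add: stage_len_def m len_def)
    moreover have "last_pos < len" by (simp add: len_def)
    ultimately show ?thesis by simp
  qed
  hence tm: "t mod len = last_pos" using time(3) by simp
  have q: "q \<in> S (Suc t)" using assms Suct by simp
  show ?thesis
    unfolding Suct[symmetric] es_Suc[OF time(1) q] ac_Suc[OF time(1) q] cnt_Suc[OF time(1) q] tm
    using time(4) stage_len_pos by (simp add: step_est_def step_ok_def last_pos_def)
qed

text \<open>
  The counter of unhappy attempts is reset at the end of a stage; this variant also has the
  value before the reset.
\<close>

definition cnt :: "nat \<Rightarrow> nat \<Rightarrow> nat \<Rightarrow> nat" where
  "cnt l t q = (if t = 0 then 0 else
     let t' = l * stage_len + (t - 1) in step_cnt (t' mod len) (snd (st t' q)) (ac t' q \<or> (\<exists>u\<in>Hd t' q. ac t' u)))"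

lemma cnt_eq:
  assumes "l < s" "t < stage_len" "q \<in> S (l * stage_len + t)"
  shows "cnt l t q = snd (st (l * stage_len + t) q)"
proof (cases t)
  case 0
  thus ?thesis using stage_start[of l q] assms by (simp add: cnt_def)
next
  case (Suc k)
  have k: "k < stage_len" using Suc assms by simp
  have "Suc k \<noteq> stage_len" using Suc assms by simp
  thus ?thesis using cnt_Suc[OF time_in_stage(1)[OF assms(1) k], of q] time_in_stage(4)[OF assms(1) k] assms Suc
    by (simp add: cnt_def Let_def)
qed

lemma stage:
  assumes l: "l < s"
  shows "stage n b g h L E (W l c) (\<lambda>t. S (l * stage_len + t) \<inter> W l c) (\<lambda>t. Hd (l * stage_len + t))
           (\<lambda>t. es (l * stage_len + t)) (\<lambda>t. ac (l * stage_len + t)) (cnt l)"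
proof -
  note time = time_in_stage[OF l]
  note ce = cnt_eq[OF l]
  have down: "q \<in> S (l * stage_len + Suc t) \<Longrightarrow> q \<in> S (l * stage_len + t)" for q t
    using S_anti[of "l * stage_len + t" "l * stage_len + Suc t"] by auto
  show ?thesis
  proof (unfold_locales, unfold stage_len_def[symmetric])
    show "W l c \<subseteq> {1..n}" by (auto simp: W_def)
    show "S (l * stage_len + 0) \<inter> W l c \<subseteq> W l c" by simp
    show "S (l * stage_len + Suc t) \<inter> W l c \<subseteq> S (l * stage_len + t) \<inter> W l c" for t
      using down by auto
    fix q assume "q \<in> S (l * stage_len + 0) \<inter> W l c"
    thus "es (l * stage_len + 0) q = 0 \<and> ac (l * stage_len + 0) q \<and> cnt l 0 q = 0"
      using stage_start[of l q] l by (simp add: cnt_def)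
  next
    fix t q u assume t: "t < stage_len"
      and q: "q \<in> S (l * stage_len + Suc t) \<inter> W l c" and u: "u \<in> S (l * stage_len + Suc t) \<inter> W l c"
      and T: "u \<in> target (t mod len) (level (cnt l t q)) q (es (l * stage_len + t) q) (ac (l * stage_len + t) q) \<or>
        q \<in> target (t mod len) (level (cnt l t u)) u (es (l * stage_len + t) u) (ac (l * stage_len + t) u)"
    show "u \<in> Hd (l * stage_len + t) q"
      by (rule linked_heard) (use time[OF t] q u T ce[OF t] down in \<open>auto simp: W_def\<close>)
  next
    fix t q u assume t: "t < stage_len"
      and q: "q \<in> S (l * stage_len + Suc t) \<inter> W l c" and u: "u \<in> Hd (l * stage_len + t) q"
    have uS: "u \<in> S (l * stage_len + t)" using heard_state[OF time(1)[OF t] u] by simp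
    note lk = heard_linked[OF time(1)[OF t] u]
    show "u \<in> S (l * stage_len + t) \<inter> W l c"
      using uS S_sub[of "l * stage_len + t"] lk time(2)[OF t] q by (auto simp: W_def)
    show "u \<in> target (t mod len) (level (cnt l t q)) q (es (l * stage_len + t) q) (ac (l * stage_len + t) q) \<or>
        q \<in> target (t mod len) (level (cnt l t u)) u (es (l * stage_len + t) u) (ac (l * stage_len + t) u)"
      using lk time(3)[OF t] ce[OF t uS] ce[OF t down[of q]] q by auto
  next
    fix t q assume t: "t < stage_len" and q: "q \<in> S (l * stage_len + Suc t) \<inter> W l c"
    have q': "q \<in> S (Suc (l * stage_len + t))" using q by simp
    show "es (l * stage_len + Suc t) q
        = step_est (t mod len) (es (l * stage_len + t) q) (card (Hd (l * stage_len + t) q \<inter> nbr (t mod len) q))"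
      using es_Suc[OF time(1)[OF t] q'] time(3)[OF t] by simp
    show "ac (l * stage_len + Suc t) q = step_ok (t mod len) (es (l * stage_len + t) q) (ac (l * stage_len + t) q)
        (card {u \<in> Hd (l * stage_len + t) q \<inter> nbr (es (l * stage_len + t) q) q.
            es (l * stage_len + t) u = es (l * stage_len + t) q \<and> ac (l * stage_len + t) u})"
      using ac_Suc[OF time(1)[OF t] q'] time(3)[OF t] by simp
    show "cnt l (Suc t) q = step_cnt (t mod len) (cnt l t q)
        (ac (l * stage_len + t) q \<or> (\<exists>u\<in>Hd (l * stage_len + t) q. ac (l * stage_len + t) u))"
      using ce[OF t down[of q]] q time(3)[OF t] by (simp add: cnt_def Let_def)
  qed
qed

text \<open>In every stage the survivors are those at the end of the whole run. The lower bounds of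
  the sub-blocks thus add up exactly to that of the block, regardless of crashes between the
  stages.\<close>

definition lo :: "nat \<Rightarrow> nat \<Rightarrow> nat" where "lo l c = card {q \<in> S (s * stage_len). block l q = c \<and> a q}"
definition hi :: "nat \<Rightarrow> nat \<Rightarrow> nat" where "hi l c = card {q \<in> {1..n}. block l q = c \<and> a q}"

definition known :: "nat \<Rightarrow> nat \<Rightarrow> nat \<Rightarrow> nat \<Rightarrow> bool" where
  "known l c j v \<longleftrightarrow> j < x \<and> lo l (x * c + j) \<le> v \<and> v \<le> hi l (x * c + j)"

definition counted :: "nat \<Rightarrow> bool" where
  "counted l \<longleftrightarrow> (\<forall>q \<in> S (l * stage_len). \<exists>v. kn (l * stage_len) q = single (slot l q) v \<and>
                     lo l (block l q) \<le> v \<and> v \<le> hi l (block l q))"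

lemma lo_Suc: "lo (Suc l) c = (\<Sum>j<x. lo l (x * c + j))" and hi_Suc: "hi (Suc l) c = (\<Sum>j<x. hi l (x * c + j))"
  unfolding lo_def hi_def by (rule card_block_sum, use finite_subset[OF S_sub] in simp)+

lemma counted_0: "counted 0"
  unfolding counted_def
proof
  fix q assume "q \<in> S (0 * stage_len)"
  hence q: "q \<in> {1..n}" by (rule S_in)
  have "{r \<in> S (s * stage_len). block 0 r = block 0 q \<and> a r} \<subseteq> {r. r = q \<and> a q}" by (auto simp: block_def)
  hence "lo 0 (block 0 q) \<le> card {r. r = q \<and> a q}" unfolding lo_def by (intro card_mono) auto
  moreover have "{r \<in> {1..n}. block 0 r = block 0 q \<and> a r} = {r. r = q \<and> a q}" using q by (auto simp: block_def)
  moreover have "card {r. r = q \<and> a q} = (if a q then 1 else 0)" by (cases "a q") auto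
  ultimately have "lo 0 (block 0 q) \<le> (if a q then 1 else 0)" "(if a q then 1 else 0) \<le> hi 0 (block 0 q)"
    by (simp_all add: hi_def)
  thus "\<exists>v. kn (0 * stage_len) q = single (slot 0 q) v \<and> lo 0 (block 0 q) \<le> v \<and> v \<le> hi 0 (block 0 q)"
    by (intro exI[of _ "if a q then 1 else 0"]) (simp add: kn_def st_0 first_state_def)
qed

lemma merge_known:
  assumes l: "l < s" and t: "t < stage_len"
    and all: "\<And>u j v. u \<in> S (l * stage_len + t) \<Longrightarrow> kn (l * stage_len + t) u j = Some v \<Longrightarrow> known l (block (Suc l) u) j v"
    and q: "q \<in> S (l * stage_len + Suc t)"
    and v: "merge (kn (l * stage_len + t) q) (heard (l * stage_len + t) q) j = Some v"
  shows "known l (block (Suc l) q) j v"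
proof -
  note time = time_in_stage[OF l t]
  have qS: "q \<in> S (l * stage_len + t)" using q S_anti[of "l * stage_len + t" "l * stage_len + Suc t"] by auto
  consider "kn (l * stage_len + t) q j = Some v"
    | u m where "heard (l * stage_len + t) q u = Some m" "fst m j = Some v"
    using merge_Some[OF v] by blast
  thus ?thesis
  proof cases
    case 1
    thus ?thesis using all qS by blast
  next
    case 2
    hence u: "u \<in> Hd (l * stage_len + t) q" unfolding Hd_def by blast
    have "kn (l * stage_len + t) u j = Some v" "u \<in> S (l * stage_len + t)"
      using heard_state[OF time(1) u] 2 by auto
    hence "known l (block (Suc l) u) j v" using all by blast
    thus ?thesis using heard_linked[OF time(1) u] time(2) by simp
  qed
qed

lemma kn_known:
  assumes l: "l < s" and c: "counted l"
  shows "t < stage_len \<Longrightarrow> q \<in> S (l * stage_len + t) \<Longrightarrow> kn (l * stage_len + t) q j = Some v \<Longrightarrow> known l (block (Suc l) q) j v"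
proof (induction t arbitrary: q j v)
  case 0
  then obtain w where "kn (l * stage_len) q = single (slot l q) w" "lo l (block l q) \<le> w" "w \<le> hi l (block l q)"
    using c unfolding counted_def by auto
  thus ?case using 0 slot_less[of l q] block_slot[of l q] by (auto simp: single_def known_def split: if_splits)
next
  case (Suc t)
  have t: "t < stage_len" "Suc t \<noteq> stage_len" using Suc.prems by auto
  note time = time_in_stage[OF l t(1)]
  have "merge (kn (l * stage_len + t) q) (heard (l * stage_len + t) q) j = Some v"
    using kn_Suc[OF time(1), of q] time(4) t(2) Suc.prems by simp
  thus ?case using merge_known[OF l t(1) Suc.IH[OF t(1)] Suc.prems(2)] by blast
qed

text \<open>The process r survives the whole run, hence this stage, and it knows the entry of its
  own slot from the start; \<open>dissemination\<close> carries this entry to q.\<close>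

lemma merge_complete:
  assumes l: "l < s" and c: "counted l" and q: "q \<in> S (Suc l * stage_len)"
    and r: "r \<in> S (s * stage_len)" "block l r = x * block (Suc l) q + j" and j: "j < x"
  shows "merge (kn (l * stage_len + (stage_len - 1)) q) (heard (l * stage_len + (stage_len - 1)) q) j \<noteq> None"
proof -
  \<comment> \<open>The informed sets refer to the result of merging in the preceding step instead
    of \<open>kn\<close>, since at the end of the stage \<open>kn\<close> has already been replaced
    by the total.\<close>
  define I where "I t = {u. if t = 0 then kn (l * stage_len) u j \<noteq> None
     else merge (kn (l * stage_len + (t - 1)) u) (heard (l * stage_len + (t - 1)) u) j \<noteq> None}" for t
  interpret stage n b g h L E "W l (block (Suc l) q)" "\<lambda>t. S (l * stage_len + t) \<inter> W l (block (Suc l) q)"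
    "\<lambda>t. Hd (l * stage_len + t)" "\<lambda>t. es (l * stage_len + t)" "\<lambda>t. ac (l * stage_len + t)" "cnt l"
    by (rule stage[OF l])
  have end_eq: "l * stage_len + attempts * len = Suc l * stage_len" by (simp add: stage_len_def)
  have le: "Suc l * stage_len \<le> s * stage_len" using l by (intro mult_right_mono) auto
  have rS: "r \<in> S (Suc l * stage_len)" "r \<in> S (l * stage_len)"
    using S_anti[OF le] S_anti[of "l * stage_len" "s * stage_len"] r l by auto
  have "block (Suc l) r = (x * block (Suc l) q + j) div x" by (simp only: block_div[of l r] r(2))
  hence br: "block (Suc l) r = block (Suc l) q" using j by simp
  have rW: "r \<in> W l (block (Suc l) q)" "q \<in> W l (block (Suc l) q)"
    using S_in[OF rS(1)] S_in[OF q] br unfolding W_def by blast+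
  have "slot l r = j" unfolding slot_mod r(2) using j by simp
  moreover obtain v where "kn (l * stage_len) r = single (slot l r) v" using c rS unfolding counted_def by blast
  ultimately have rI: "r \<in> I 0" by (simp add: I_def single_def)
  have "q \<in> I (attempts * len)"
  proof (rule dissemination[where I = I and r = r and q = q])
    show "r \<in> S (l * stage_len + attempts * len) \<inter> W l (block (Suc l) q)"
         "q \<in> S (l * stage_len + attempts * len) \<inter> W l (block (Suc l) q)" "r \<in> I 0"
      unfolding end_eq using rS rW q rI by auto
    fix t q' u assume t: "t < attempts * len" and q': "q' \<in> S (l * stage_len + Suc t) \<inter> W l (block (Suc l) q)"
      and u: "u \<in> insert q' (Hd (l * stage_len + t) q')" "u \<in> I t"
    have t': "t < stage_len" using t by (simp add: stage_len_def)
    note time = time_in_stage[OF l t']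
    have uS: "u \<in> S (l * stage_len + t)"
      using u(1) heard_state[OF time(1), of u q'] q' S_anti[of "l * stage_len + t" "l * stage_len + Suc t"] by auto
    have ukn: "kn (l * stage_len + t) u j \<noteq> None"
    proof (cases t)
      case 0
      thus ?thesis using u(2) by (simp add: I_def)
    next
      case (Suc t0)
      hence t0: "t0 < stage_len" "Suc t0 \<noteq> stage_len" using t' by auto
      show ?thesis using u(2) kn_Suc[OF time_in_stage(1)[OF l t0(1)], of u] time_in_stage(4)[OF l t0(1)] t0(2) Suc uS
        by (simp add: I_def)
    qed
    have "merge (kn (l * stage_len + t) q') (heard (l * stage_len + t) q') j \<noteq> None"
    proof (cases "u = q'")
      case True
      thus ?thesis using ukn by (simp add: merge_None)
    next
      case False
      hence "heard (l * stage_len + t) q' u = Some (kn (l * stage_len + t) u, es (l * stage_len + t) u, ac (l * stage_len + t) u)"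
        using heard_state[OF time(1), of u q'] u(1) by simp
      thus ?thesis using ukn unfolding merge_None by fastforce
    qed
    thus "q' \<in> I (Suc t)" by (simp add: I_def)
  qed
  thus ?thesis using stage_len_pos unfolding stage_len_def[symmetric] by (simp add: I_def)
qed

lemma counted_Suc:
  assumes l: "l < s" and c: "counted l"
  shows "counted (Suc l)"
  unfolding counted_def
proof
  fix q assume q: "q \<in> S (Suc l * stage_len)"
  define t where "t = l * stage_len + (stage_len - 1)"
  define k where "k = merge (kn t q) (heard t q)"
  have sl: "stage_len - 1 < stage_len" "Suc (stage_len - 1) = stage_len" using stage_len_pos by auto
  note time = time_in_stage[OF l sl(1), folded t_def]
  have Suct: "Suc t = Suc l * stage_len" using stage_len_pos by (simp add: t_def)
  have q': "q \<in> S (l * stage_len + Suc (stage_len - 1))" using q unfolding sl(2) by (simp add: add.commute)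
  have div: "Suc t div stage_len = Suc l" unfolding Suct using stage_len_pos by simp
  have known: "known l (block (Suc l) q) j v" if "k j = Some v" for j v
    using merge_known[OF l sl(1) kn_known[OF l c sl(1)] q'] that by (simp add: k_def t_def)
  define f where "f j = (case k j of None \<Rightarrow> 0 | Some v \<Rightarrow> v)" for j
  have bounds: "lo l (x * block (Suc l) q + j) \<le> f j \<and> f j \<le> hi l (x * block (Suc l) q + j)" if j: "j < x" for j
  proof (cases "k j")
    case None
    have "{r \<in> S (s * stage_len). block l r = x * block (Suc l) q + j \<and> a r} = {}"
      using merge_complete[OF l c q _ _ j] None by (auto simp: k_def t_def)
    hence "lo l (x * block (Suc l) q + j) = 0" unfolding lo_def by (simp only: card.empty)
    thus ?thesis using None by (simp add: f_def)
  next
    case (Some v)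
    thus ?thesis using known[OF Some] by (simp add: f_def known_def)
  qed
  have "lo (Suc l) (block (Suc l) q) \<le> (\<Sum>j<x. f j)" unfolding lo_Suc using bounds by (intro sum_mono) auto
  moreover have "(\<Sum>j<x. f j) \<le> hi (Suc l) (block (Suc l) q)" unfolding hi_Suc using bounds by (intro sum_mono) auto
  moreover have "hi (Suc l) (block (Suc l) q) \<le> n"
  proof -
    have "hi (Suc l) (block (Suc l) q) \<le> card {1..n}" unfolding hi_def by (intro card_mono) auto
    thus ?thesis by simp
  qed
  ultimately have tot: "lo (Suc l) (block (Suc l) q) \<le> total k" "total k \<le> hi (Suc l) (block (Suc l) q)"
    by (simp_all add: total_def f_def[symmetric])
  have qt: "q \<in> S (Suc t)" using q Suct by simp
  have "kn (Suc l * stage_len) q = single (slot (Suc l) q) (total k)"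
    using kn_Suc[OF time(1) qt] time(4) sl(2) div unfolding Suct[symmetric] by (simp add: k_def)
  thus "\<exists>v. kn (Suc l * stage_len) q = single (slot (Suc l) q) v \<and> lo (Suc l) (block (Suc l) q) \<le> v \<and>
       v \<le> hi (Suc l) (block (Suc l) q)" using tot by blast
qed

lemma counted: "l \<le> s \<Longrightarrow> counted l"
  by (induction l) (simp_all add: counted_0 counted_Suc)

lemma result_correct:
  assumes q: "q \<in> S (s * stage_len)"
  shows "card {u \<in> S (s * stage_len). a u} \<le> result (st (s * stage_len) q) \<and>
         result (st (s * stage_len) q) \<le> card {u \<in> {1..n}. a u}"
proof -
  have b0: "block s u = 0" if "u \<in> {1..n}" for u
    using that n_less_x by (simp add: block_def)
  obtain v where v: "kn (s * stage_len) q = single (slot s q) v" "lo s (block s q) \<le> v" "v \<le> hi s (block s q)"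
    using counted[OF order_refl] q unfolding counted_def by blast
  have q0: "block s q = 0" using b0[OF S_in[OF q]] .
  have "slot s q = 0" unfolding slot_mod q0 by simp
  hence "result (st (s * stage_len) q) = v" using v(1) by (simp add: result_def kn_def single_def)
  moreover have "lo s 0 = card {u \<in> S (s * stage_len). a u}"
    unfolding lo_def using b0[OF S_in] by (intro arg_cong[where f = card]) auto
  moreover have "hi s 0 = card {u \<in> {1..n}. a u}"
    unfolding hi_def using b0 by (intro arg_cong[where f = card]) auto
  ultimately show ?thesis using v q0 by simp
qed

text \<open>Within a stage the load of a block is proportional to its size, and the blocks partition
  the identifiers. So every stage costs the same multiple of n.\<close>

lemma message_load:
  "(\<Sum>t<s * stage_len. \<Sum>q\<in>S t. card (targets t q (st t q) \<inter> {1..n}))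
    \<le> s * (280 * (real h + 1) ^ 2 * (real L + 1) ^ 2 * (g * real b ^ 8) * n)"
proof -
  define f where "f t = (\<Sum>q\<in>S t. real (card (targets t q (st t q) \<inter> {1..n})))" for t
  define M where "M = 280 * (real h + 1) ^ 2 * (real L + 1) ^ 2 * (g * real b ^ 8)"
  have stage_sum: "(\<Sum>t<stage_len. f (l * stage_len + t)) \<le> M * n" if l: "l < s" for l
  proof -
    define w where "w c t = (\<Sum>q\<in>S (l * stage_len + t) \<inter> W l c.
        card (target (t mod len) (level (cnt l t q)) q (es (l * stage_len + t) q) (ac (l * stage_len + t) q) \<inter> W l c))" for c t
    have block_le: "block (Suc l) q \<le> n" if "q \<in> {1..n}" for q
      using that order_trans[OF div_le_dividend[of q "x ^ Suc l"], of n] unfolding block_def by auto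
    have ft: "f (l * stage_len + t) = (\<Sum>c\<le>n. real (w c t))" if t: "t < stage_len" for t
    proof -
      note time = time_in_stage[OF l t]
      have "f (l * stage_len + t) = (\<Sum>c\<le>n. \<Sum>q\<in>{q \<in> S (l * stage_len + t). block (Suc l) q = c}.
            real (card (targets (l * stage_len + t) q (st (l * stage_len + t) q) \<inter> {1..n})))"
        unfolding f_def
        by (rule sum.group[symmetric]) (use finite_subset[OF S_sub] block_le[OF S_in] in auto)
      also have "\<dots> = (\<Sum>c\<le>n. real (w c t))"
        unfolding w_def of_nat_sum
      proof (intro sum.cong refl)
        fix c
        show "{q \<in> S (l * stage_len + t). block (Suc l) q = c} = S (l * stage_len + t) \<inter> W l c"
          unfolding W_def using S_in by blast
        fix q assume q: "q \<in> S (l * stage_len + t) \<inter> W l c"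
        have "targets (l * stage_len + t) q (st (l * stage_len + t) q) \<inter> {1..n}
              = target (t mod len) (level (cnt l t q)) q (es (l * stage_len + t) q) (ac (l * stage_len + t) q) \<inter> W l c"
          using q cnt_eq[OF l t, of q] time by (auto simp: targets_def es_def ac_def W_def)
        thus "real (card (targets (l * stage_len + t) q (st (l * stage_len + t) q) \<inter> {1..n}))
          = real (card (target (t mod len) (level (cnt l t q)) q (es (l * stage_len + t) q) (ac (l * stage_len + t) q) \<inter> W l c))"
          by simp
      qed
      finally show ?thesis .
    qed
    have wsum: "(\<Sum>t<stage_len. real (w c t)) \<le> M * card (W l c)" for c
    proof -
      interpret stage n b g h L E "W l c" "\<lambda>t. S (l * stage_len + t) \<inter> W l c"
        "\<lambda>t. Hd (l * stage_len + t)" "\<lambda>t. es (l * stage_len + t)" "\<lambda>t. ac (l * stage_len + t)" "cnt l"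
        by (rule stage[OF l])
      have "load t = w c t" for t unfolding load_def w_def ..
      thus ?thesis using stage_load unfolding stage_len_def[symmetric] M_def by simp
    qed
    have "(\<Sum>t<stage_len. f (l * stage_len + t)) = (\<Sum>t<stage_len. \<Sum>c\<le>n. real (w c t))" using ft by simp
    also have "\<dots> = (\<Sum>c\<le>n. \<Sum>t<stage_len. real (w c t))" by (rule sum.swap)
    also have "\<dots> \<le> (\<Sum>c\<le>n. M * card (W l c))" using wsum by (intro sum_mono)
    also have "\<dots> = M * (\<Sum>c\<le>n. card (W l c))" by (simp add: sum_distrib_left)
    also have "(\<Sum>c\<le>n. card (W l c)) = n"
    proof -
      have "(\<Sum>q\<in>{1..n}. 1::nat) = (\<Sum>c\<le>n. \<Sum>q\<in>{q \<in> {1..n}. block (Suc l) q = c}. 1)"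
        by (rule sum.group[symmetric]) (use block_le in auto)
      thus ?thesis by (simp add: W_def)
    qed
    finally show ?thesis .
  qed
  have split: "(\<Sum>t<m * stage_len. f t) = (\<Sum>l<m. \<Sum>t<stage_len. f (l * stage_len + t))" for m
  proof (induction m)
    case (Suc m)
    have "(\<Sum>t<Suc m * stage_len. f t) = (\<Sum>t<m * stage_len. f t) + (\<Sum>t\<in>{m * stage_len..<m * stage_len + stage_len}. f t)"
      by (subst sum.union_disjoint[symmetric]) (auto intro!: sum.cong)
    also have "(\<Sum>t\<in>{m * stage_len..<m * stage_len + stage_len}. f t) = (\<Sum>t<stage_len. f (m * stage_len + t))"
      using sum.shift_bounds_nat_ivl[of f 0 "m * stage_len" stage_len]
      by (simp add: atLeast0LessThan add.commute)
    finally show ?case using Suc by simp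
  qed simp
  have "(\<Sum>t<s * stage_len. f t) \<le> (\<Sum>l<s. M * n)" unfolding split using stage_sum by (intro sum_mono) auto
  thus ?thesis by (simp add: f_def M_def)
qed

end

context counting begin

lemma fuzzy_counting:
  "\<exists>A. solves_fuzzy_counting n A \<and> (\<forall>a adv. rounds n A a adv \<le> 2 * (s * stage_len) \<and>
     amortized_bits n A a adv \<le> 2 * bits * (s * (280 * (real h + 1) ^ 2 * (real L + 1) ^ 2 * (g * real b ^ 8))))"
proof (intro exI[of _ alg] conjI allI)
  show "solves_fuzzy_counting n alg"
  proof (rule solves)
    fix a adv q
    interpret counting_run n b g h L E x s a adv by unfold_locales
    assume "q \<in> S (s * stage_len)"
    thus "card {u \<in> S (s * stage_len). a u} \<le> result (st (s * stage_len) q) \<and>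
         result (st (s * stage_len) q) \<le> card {u \<in> {1..n}. a u}" by (rule result_correct)
  qed
  fix a adv
  interpret counting_run n b g h L E x s a adv by unfold_locales
  show "rounds n alg a adv \<le> 2 * (s * stage_len)" by (rule rounds_le)
  define M where "M = s * (280 * (real h + 1) ^ 2 * (real L + 1) ^ 2 * (g * real b ^ 8))"
  have "real (total_bits n alg a adv) \<le> real (\<Sum>t<s * stage_len. 2 * bits * (\<Sum>q\<in>S t. card (targets t q (st t q) \<inter> {1..n})))"
    using bits_le by (rule of_nat_mono)
  also have "\<dots> = 2 * real bits * (\<Sum>t<s * stage_len. \<Sum>q\<in>S t. card (targets t q (st t q) \<inter> {1..n}))"
    by (simp add: sum_distrib_left)
  also have "\<dots> \<le> 2 * real bits * (M * n)"
    using message_load by (intro mult_left_mono) (auto simp: M_def mult_ac)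
  finally have "real (total_bits n alg a adv) \<le> (2 * real bits * M) * n" by simp
  thus "amortized_bits n alg a adv \<le> 2 * bits * (s * (280 * (real h + 1) ^ 2 * (real L + 1) ^ 2 * (g * real b ^ 8)))"
    using n_ge unfolding amortized_bits_def M_def[symmetric] by (simp add: pos_divide_le_eq)
qed

end

subsection \<open>Parameters and asymptotics\<close>

lemma overlay_exists:
  assumes "2 \<le> n" "1 \<le> g" "n \<le> 2 ^ g" "8 \<le> b" "2000 * (L + 1) \<le> b ^ 5" "n < b ^ h" "L \<le> h"
    "n \<le> 4 * g * b ^ (L + 8)" and degree: "\<And>i. i < L \<Longrightarrow> 4 * g * b ^ (i + 8) \<le> n"
  shows "\<exists>E. overlay n b g h L E"
proof -
  have "\<exists>E. (\<forall>u v. E u v = E v u) \<and> (\<forall>A \<subseteq> {1..n}. \<forall>B \<subseteq> {1..n}.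
           edges E A B \<le> 4 * (4 * g * b ^ (i + 8) / n) * card A * card B + 6 * g * (card A + card B) \<and>
           (4 * g * b ^ (i + 8) / n) * card A * card B / 2 \<le> edges E A B + 3 * g * (card A + card B))"
    if i: "i < L" for i
  proof (rule discrepancy_graph)
    have "real (4 * g * b ^ (i + 8)) \<le> real n" using degree[OF i] by (rule of_nat_mono)
    thus "4 * g * b ^ (i + 8) / real n \<le> 1" using assms(1) by (simp add: divide_le_eq)
  qed (use assms in auto)
  then obtain E where E: "\<And>i. i < L \<Longrightarrow> (\<forall>u v. E i u v = E i v u) \<and> (\<forall>A \<subseteq> {1..n}. \<forall>B \<subseteq> {1..n}.
           edges (E i) A B \<le> 4 * (4 * g * b ^ (i + 8) / n) * card A * card B + 6 * g * (card A + card B) \<and>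
           (4 * g * b ^ (i + 8) / n) * card A * card B / 2 \<le> edges (E i) A B + 3 * g * (card A + card B))"
    by metis
  have "overlay n b g h L E"
    by unfold_locales (use assms E in \<open>simp_all\<close>)
  thus ?thesis by blast
qed

text \<open>A logarithm rounded to the least sufficient exponent: in base b it gives the number h of
  layers of a ball, in base x the number of stages.\<close>

definition height :: "nat \<Rightarrow> nat \<Rightarrow> nat" where "height b n = (LEAST h. n < b ^ h)"

definition log_size :: "nat \<Rightarrow> nat" where "log_size n = (LEAST g. n \<le> 2 ^ g)"

lemma less_self_power: "2 \<le> b \<Longrightarrow> n < b ^ n" for b n :: nat
  using less_exp[of n] power_mono[of 2 b n] by linarith

lemma less_power_height: "2 \<le> b \<Longrightarrow> n < b ^ height b n"
  unfolding height_def by (rule LeastI) (rule less_self_power)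

lemma height_bound:
  assumes b: "2 \<le> b" and n: "1 \<le> n"
  shows "real (height b n) \<le> 1 + ln n / ln b"
proof (cases "height b n")
  case 0
  thus ?thesis using b n by simp
next
  case (Suc h)
  hence "\<not> n < b ^ h" using not_less_Least[of h "\<lambda>h. n < b ^ h"] by (simp add: height_def)
  hence "real (b ^ h) \<le> real n" by (simp only: not_less of_nat_le_iff)
  hence "ln (real b ^ h) \<le> ln (real n)" using b n by (subst ln_le_cancel_iff) auto
  hence "h * ln b \<le> ln n" using b by (simp add: ln_realpow)
  thus ?thesis using Suc b by (simp add: field_simps)
qed

lemma log_size: "n \<le> 2 ^ log_size n"
  unfolding log_size_def by (rule LeastI[of _ n]) (simp add: less_imp_le)

lemma log_size_pos: "2 \<le> n \<Longrightarrow> 1 \<le> log_size n"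
  using log_size[of n] by (cases "log_size n") auto

lemma log_size_bound:
  assumes n: "2 \<le> n"
  shows "real (log_size n) \<le> 4 * ln n"
proof -
  have ln2: "1 / 2 \<le> ln (2::real)" using ln_le_minus_one[of "1 / 2"] by (simp add: ln_div)
  have lnn: "ln 2 \<le> ln (real n)" using n by simp
  obtain k where k: "log_size n = Suc k" using log_size_pos[OF n] by (cases "log_size n") auto
  hence "\<not> n \<le> 2 ^ k" using not_less_Least[of k "\<lambda>g. n \<le> 2 ^ g"] by (simp add: log_size_def)
  hence "real (2 ^ k) \<le> real n" by (subst of_nat_le_iff) simp
  hence "ln (2 ^ k) \<le> ln (real n)" using n by (subst ln_le_cancel_iff) auto
  hence "k * ln 2 \<le> ln n" by (simp add: ln_realpow)
  moreover have "k * (1 / 2) \<le> k * ln 2" using ln2 by (intro mult_left_mono) auto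
  ultimately show ?thesis using k ln2 lnn by simp
qed

lemma exists_counting_algorithm:
  assumes x: "2 \<le> x" "x \<le> n" and b: "8 \<le> b" "2000 * (height b n + 1) \<le> b ^ 5"
  shows "\<exists>A. solves_fuzzy_counting n A \<and> (\<forall>a adv.
     rounds n A a adv \<le> 12 * (real (height x n) * (real (height b n) + 1) ^ 3) \<and>
     amortized_bits n A a adv \<le> 2240 * (real (log_size n) ^ 2 * x * height x n * (real (height b n) + 1) ^ 4 * real b ^ 8))"
proof -
  define g h s where "g = log_size n" and "h = height b n" and "s = height x n"
  \<comment> \<open>The first index at which the intended degree would reach n: there the complete
    graph is affordable, and below it the density is at most 1 by minimality.\<close>
  define L where "L = (LEAST L. n \<le> 4 * g * b ^ (L + 8))"
  have n: "2 \<le> n" and g: "1 \<le> g" "n \<le> 2 ^ g" and h: "n < b ^ h" and s: "n < x ^ s"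
    using x b log_size[of n] log_size_pos[of n] less_power_height by (auto simp: g_def h_def s_def)
  have "b ^ h * 1 \<le> b ^ (h + 8) * (4 * g)" using b g by (intro mult_le_mono power_increasing) auto
  hence Lh': "n \<le> 4 * g * b ^ (h + 8)" using h by (simp add: mult.commute)
  have L: "n \<le> 4 * g * b ^ (L + 8)" unfolding L_def by (rule LeastI[of _ h]) (rule Lh')
  have Lh: "L \<le> h" unfolding L_def by (rule Least_le) (rule Lh')
  have small: "4 * g * b ^ (i + 8) \<le> n" if "i < L" for i
    using not_less_Least[of i "\<lambda>L. n \<le> 4 * g * b ^ (L + 8)"] that by (simp add: L_def)
  have bL: "2000 * (L + 1) \<le> b ^ 5" using b(2) Lh by (simp add: h_def)
  obtain E where "overlay n b g h L E"
    using overlay_exists[OF n g b(1) bL h Lh L small] by blast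
  then interpret overlay n b g h L E .
  interpret counting n b g h L E x s by unfold_locales (use x s in auto)
  define R where "R = 280 * (real h + 1) ^ 2 * (real L + 1) ^ 2 * (g * real b ^ 8)"
  have LhR: "real L + 1 \<le> real h + 1" using Lh by simp
  have "real stage_len \<le> 6 * (real h + 1) ^ 3"
  proof -
    have "real stage_len = 2 * (real h * (real L + 1)) * (real L + 2 * real h + 3)"
      by (simp add: stage_len_def attempts_def len_def last_pos_def algebra_simps)
    also have "\<dots> \<le> 2 * ((real h + 1) * (real h + 1)) * (3 * (real h + 1))"
      using LhR by (intro mult_mono) auto
    also have "\<dots> = 6 * (real h + 1) ^ 3"
      using power3_eq_cube[of "real h + 1"] by (simp only: mult_ac)
    finally show ?thesis .
  qed
  hence "2 * s * real stage_len \<le> 2 * s * (6 * (real h + 1) ^ 3)" by (intro mult_left_mono) auto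
  hence rnd: "real (2 * (s * stage_len)) \<le> 12 * (real s * (real h + 1) ^ 3)" by simp
  have bits4: "real bits \<le> 4 * (real g * real x)"
  proof -
    have "h \<le> g + 1"
    proof (cases h)
      case (Suc k)
      hence "\<not> n < b ^ k" using not_less_Least[of k "\<lambda>h. n < b ^ h"] by (simp add: h_def height_def)
      moreover have "2 ^ k \<le> b ^ k" using b by (intro power_mono) auto
      ultimately have "(2::nat) ^ k \<le> 2 ^ g" using g by linarith
      thus ?thesis using Suc by simp
    qed simp
    hence "bits \<le> g * x + x + g + 2" by (simp add: bits_def)
    moreover have "1 * x \<le> g * x" "g * 2 \<le> g * x" using g x by (auto intro: mult_le_mono)
    ultimately have "bits \<le> 4 * (g * x)" using g by linarith
    hence "real bits \<le> real (4 * (g * x))" by (rule of_nat_mono)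
    thus ?thesis by simp
  qed
  have R: "R \<le> 280 * (real h + 1) ^ 4 * (g * real b ^ 8)"
  proof -
    have "(real h + 1) ^ 2 * (real L + 1) ^ 2 \<le> (real h + 1) ^ 2 * (real h + 1) ^ 2"
      using LhR by (intro mult_left_mono power_mono) auto
    hence "280 * ((real h + 1) ^ 2 * (real L + 1) ^ 2) * (g * real b ^ 8)
          \<le> 280 * ((real h + 1) ^ 2 * (real h + 1) ^ 2) * (g * real b ^ 8)"
      using Lh by (intro mult_right_mono mult_left_mono) auto
    thus ?thesis unfolding R_def by (simp add: power_add[symmetric] mult.assoc)
  qed
  have "2 * bits * (s * R) \<le> 2 * (4 * (real g * real x)) * (s * (280 * (real h + 1) ^ 4 * (g * real b ^ 8)))"
    using bits4 R by (intro mult_mono mult_left_mono) (auto simp: R_def)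
  also have "\<dots> = 2240 * (real g ^ 2 * x * s * (real h + 1) ^ 4 * real b ^ 8)"
    by (simp add: power2_eq_square)
  finally have am: "2 * bits * (s * R) \<le> 2240 * (real g ^ 2 * x * s * (real h + 1) ^ 4 * real b ^ 8)" .
  obtain A where A: "solves_fuzzy_counting n A"
    "\<And>a adv. rounds n A a adv \<le> 2 * (s * stage_len)" "\<And>a adv. amortized_bits n A a adv \<le> 2 * bits * (s * R)"
    using fuzzy_counting unfolding R_def by blast
  show ?thesis
  proof (intro exI[of _ A] conjI allI A(1))
    fix a adv
    have "real (rounds n A a adv) \<le> real (2 * (s * stage_len))" using A(2) by (rule of_nat_mono)
    thus "rounds n A a adv \<le> 12 * (real (height x n) * (real (height b n) + 1) ^ 3)"
      using rnd unfolding s_def h_def by linarith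
    show "amortized_bits n A a adv \<le> 2240 * (real (log_size n) ^ 2 * x * height x n * (real (height b n) + 1) ^ 4 * real b ^ 8)"
      using A(3)[of a adv] am unfolding g_def s_def h_def by linarith
  qed
qed

section \<open>Choice of b and bounds uniform in x\<close>

lemma eventually_size_filter:
  assumes "\<forall>\<^sub>F n in at_top. \<forall>x. 2 \<le> x \<longrightarrow> x \<le> n \<longrightarrow> P n x"
  shows "\<forall>\<^sub>F (n, x) in size_filter. P n x"
  unfolding size_filter_def eventually_inf_principal eventually_filtercomap
  by (rule exI, rule conjI, rule assms) auto

text \<open>The fallback n + 2000 makes the algorithm correct for the finitely many n to which the asymptotic bounds do not apply.\<close>

definition width :: "(nat \<Rightarrow> real) \<Rightarrow> nat \<Rightarrow> nat" where
  "width \<alpha> n = (let \<beta> = nat \<lfloor>\<alpha> n powr (1 / 4)\<rfloor> in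
     if 8 \<le> \<beta> \<and> 2000 * (height \<beta> n + 1) \<le> \<beta> ^ 5 then \<beta> else n + 2000)"

lemma width_admissible: "8 \<le> width \<alpha> n" "2000 * (height (width \<alpha> n) n + 1) \<le> width \<alpha> n ^ 5"
proof -
  have "height (n + 2000) n \<le> 1" unfolding height_def by (rule Least_le) simp
  moreover have "(2000::nat) ^ 5 \<le> (n + 2000) ^ 5" by (intro power_mono) auto
  ultimately have "2000 * (height (n + 2000) n + 1) \<le> (n + 2000) ^ 5" by simp
  thus "8 \<le> width \<alpha> n" "2000 * (height (width \<alpha> n) n + 1) \<le> width \<alpha> n ^ 5"
    by (auto simp: width_def Let_def)
qed

lemma eventually_width:
  assumes c: "c > 0" and \<alpha>: "\<forall>\<^sub>F n in at_top. c * ln (real n) \<le> \<alpha> n"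
  shows "\<forall>\<^sub>F n in at_top. real (width \<alpha> n) \<le> \<alpha> n powr (1 / 4) \<and> ln (\<alpha> n) \<ge> 1 \<and>
           real (height (width \<alpha> n) n) \<le> 1 + 8 * (ln n / ln (\<alpha> n))"
proof -
  \<comment> \<open>This makes the fourth root at least 16. Rounding it down then costs at most a
    factor 2, and its logarithm remains at least \<open>ln (\<alpha> n) / 8\<close>.\<close>
  have 1: "\<forall>\<^sub>F n in at_top. 16 ^ 4 \<le> c * ln (real n)" using c by real_asymp
  \<comment> \<open>The constant is 2000 times 32, where 32 comes from the fifth power of y / 2 and
    2 + ln n bounds the height plus one. The exponent 5/4 being larger than 1 lets \<alpha> of order
    ln n suffice.\<close>
  have 2: "\<forall>\<^sub>F n in at_top. 64000 * (2 + ln (real n)) \<le> (c * ln (real n)) powr (5 / 4)" using c by real_asymp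
  show ?thesis
    using 1 2 \<alpha> eventually_ge_at_top[of 2]
  proof eventually_elim
    case (elim n)
    define y where "y = \<alpha> n powr (1 / 4)"
    define \<beta> where "\<beta> = nat \<lfloor>y\<rfloor>"
    have \<alpha>1: "16 ^ 4 \<le> \<alpha> n" using elim by linarith
    have "(16 ^ 4) powr (1 / 4) \<le> y" unfolding y_def using \<alpha>1 by (intro powr_mono2) auto
    moreover have "((16::real) ^ 4) powr (1 / 4) = 16" by (subst powr_realpow[symmetric]) (auto simp: powr_powr)
    ultimately have y: "16 \<le> y" by simp
    have \<beta>y: "real \<beta> \<le> y" "y < real \<beta> + 1" using y by (auto simp: \<beta>_def)
    hence \<beta>2: "y / 2 \<le> real \<beta>" and \<beta>8: "8 \<le> real \<beta>" using y by linarith+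
    have ln2: "1 / 2 \<le> ln (2::real)" "ln 2 \<le> (1::real)"
      using ln_le_minus_one[of "1 / 2"] ln_le_minus_one[of 2] by (simp_all add: ln_div)
    have "ln 8 \<le> ln (real \<beta>)" using \<beta>8 by (subst ln_le_cancel_iff) auto
    moreover have "ln (8::real) = 3 * ln 2" using ln_realpow[of 2 3] by simp
    ultimately have ln\<beta>1: "1 \<le> ln (real \<beta>)" using ln2 by linarith
    have "ln (16 ^ 4) \<le> ln (\<alpha> n)" using \<alpha>1 by (subst ln_le_cancel_iff) auto
    moreover have "ln ((16::real) ^ 4) = 16 * ln 2" 
    proof -
      have "(16::real) ^ 4 = 2 ^ 16" by simp
      thus ?thesis by (simp only: ln_realpow)
    qed
    ultimately have ln\<alpha>: "8 \<le> ln (\<alpha> n)" "16 * ln 2 \<le> ln (\<alpha> n)" using ln2 by linarith+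
    have "ln (y / 2) \<le> ln (real \<beta>)" using \<beta>2 y by (subst ln_le_cancel_iff) auto
    moreover have "ln (y / 2) = ln (\<alpha> n) / 4 - ln 2" using y \<alpha>1 by (simp add: ln_div y_def ln_powr)
    ultimately have ln\<beta>: "ln (\<alpha> n) / 8 \<le> ln (real \<beta>)" using ln\<alpha>(2) ln2 by linarith
    have n1: "0 \<le> ln (real n)" using elim by simp
    have ht: "real (height \<beta> n) \<le> 1 + ln n / ln \<beta>" using \<beta>8 elim by (intro height_bound) auto
    have "ln n / ln \<beta> \<le> ln n / (ln (\<alpha> n) / 8)" using ln\<beta> ln\<alpha> n1 by (intro divide_left_mono mult_pos_pos) auto
    also have "ln n / (ln (\<alpha> n) / 8) = 8 * (ln n / ln (\<alpha> n))" by simp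
    finally have ht8: "real (height \<beta> n) \<le> 1 + 8 * (ln n / ln (\<alpha> n))"
      using order_trans[OF ht add_left_mono] by blast
    have "ln n / ln \<beta> \<le> ln n / 1" using ln\<beta>1 n1 by (intro divide_left_mono) auto
    hence "real (2000 * (height \<beta> n + 1)) \<le> 2000 * (2 + ln n)" using ht by simp
    also have "\<dots> \<le> (c * ln n) powr (5 / 4) / 32" using elim by simp
    also have "\<dots> \<le> \<alpha> n powr (5 / 4) / 32" using elim c n1 by (intro divide_right_mono powr_mono2) auto
    also have "\<dots> = (y / 2) ^ 5"
    proof -
      have "y ^ 5 = y powr real 5" by (rule powr_realpow[symmetric]) (use y in simp)
      also have "\<dots> = \<alpha> n powr (5 / 4)" by (simp add: y_def powr_powr)
      finally have "y ^ 5 = \<alpha> n powr (5 / 4)" .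
      thus ?thesis by (simp add: power_divide)
    qed
    also have "\<dots> \<le> real \<beta> ^ 5" using \<beta>2 y by (intro power_mono) auto
    finally have "real (2000 * (height \<beta> n + 1)) \<le> real (\<beta> ^ 5)" by simp
    hence "2000 * (height \<beta> n + 1) \<le> \<beta> ^ 5" by (simp only: of_nat_le_iff)
    moreover have "8 \<le> \<beta>" using \<beta>8 by simp
    ultimately have "width \<alpha> n = \<beta>" by (simp add: width_def Let_def \<beta>_def y_def)
    thus ?case using \<beta>y(1) ln\<alpha> ht8 by (simp add: y_def)
  qed
qed

theorem theorem5:
  fixes d \<alpha> :: "nat \<Rightarrow> real"
  assumes pos: "\<forall>\<^sub>F n in at_top. d n > 0 \<and> \<alpha> n > 0"
    and d: "d \<in> \<Omega>(\<lambda>n. ln (real n))"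
    and \<alpha>: "\<alpha> \<in> \<Omega>(\<lambda>n. ln (real n))"
    and \<alpha>_poly: "(\<lambda>n. ln (\<alpha> n)) \<in> O(\<lambda>n. ln (real n))"
  shows "\<exists>(A :: nat \<Rightarrow> nat \<Rightarrow> algorithm) (T :: nat \<times> nat \<Rightarrow> real) (B :: nat \<times> nat \<Rightarrow> real).
      (\<forall>n x. 2 \<le> x \<and> x \<le> n \<longrightarrow>
         solves_fuzzy_counting n (A n x) \<and>
         (\<forall>a adv. real (rounds n (A n x) a adv) \<le> T (n, x) \<and>
                  amortized_bits n (A n x) a adv \<le> B (n, x))) \<and>
      T \<in> O[size_filter](\<lambda>(n, x). (ln n / ln x) * (ln n / ln (\<alpha> n)) ^ 3) \<and>
      B \<in> O[size_filter](\<lambda>(n, x). (ln n / ln x) * (ln n / ln (\<alpha> n)) ^ 4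
                                   * d n * (\<alpha> n)\<^sup>2 * x * ln n)"
proof -
  define h where "h n = real (height (width \<alpha> n) n) + 1" for n
  define T where "T = (\<lambda>(n, x). 12 * (real (height x n) * h n ^ 3))"
  define B where "B = (\<lambda>(n, x). 2240 * (real (log_size n) ^ 2 * x * height x n * h n ^ 4 * real (width \<alpha> n) ^ 8))"
  define P where "P n x A \<longleftrightarrow> solves_fuzzy_counting n A \<and> (\<forall>a adv.
     real (rounds n A a adv) \<le> T (n, x) \<and> amortized_bits n A a adv \<le> B (n, x))" for n x A
  define A where "A n x = (SOME A. P n x A)" for n x
  have A: "P n x (A n x)" if "2 \<le> x" "x \<le> n" for n x
  proof -
    have "\<exists>A. P n x A"
      using exists_counting_algorithm[OF that width_admissible, of \<alpha>] unfolding P_def T_def B_def h_def by simp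
    thus ?thesis unfolding A_def by (rule someI_ex)
  qed
  obtain c where c: "c > 0" "\<forall>\<^sub>F n in at_top. c * norm (ln (real n)) \<le> norm (\<alpha> n)"
    using \<alpha> by (rule landau_omega.bigE)
  obtain c' where c': "c' > 0" "\<forall>\<^sub>F n in at_top. c' * norm (ln (real n)) \<le> norm (d n)"
    using d by (rule landau_omega.bigE)
  obtain C where C: "C > 0" "\<forall>\<^sub>F n in at_top. norm (ln (\<alpha> n)) \<le> C * norm (ln (real n))"
    using \<alpha>_poly by (rule landau_o.bigE)
  have "\<forall>\<^sub>F n in at_top. c * ln (real n) \<le> \<alpha> n"
    using c(2) pos eventually_ge_at_top[of 1] by eventually_elim auto
  note width = eventually_width[OF c(1) this]
  \<comment> \<open>Here h is at most 2 + 8 k with k = ln n / ln \<alpha>, and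
    \<open>\<alpha>_poly\<close> gives 1 \<le> C k, which absorbs the additive 2.\<close>
  define D where "D = 8 + 2 * C"
  have key: "\<forall>\<^sub>F n in at_top. 2 \<le> n \<and> 1 \<le> ln (\<alpha> n) \<and> h n \<le> D * (ln n / ln (\<alpha> n)) \<and>
      real (width \<alpha> n) ^ 8 \<le> (\<alpha> n)\<^sup>2 \<and> ln n \<le> d n / c' \<and> 0 < d n"
    using width C(2) c'(2) pos eventually_ge_at_top[of 2]
  proof eventually_elim
    case (elim n)
    have n: "0 \<le> ln (real n)" and \<alpha>1: "1 \<le> ln (\<alpha> n)" and \<alpha>0: "0 < \<alpha> n" using elim by auto
    have "ln (\<alpha> n) \<le> C * ln n" using elim n by simp
    hence "ln (\<alpha> n) / ln (\<alpha> n) \<le> C * ln n / ln (\<alpha> n)" using \<alpha>1 by (intro divide_right_mono) auto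
    hence "1 \<le> C * (ln n / ln (\<alpha> n))" using \<alpha>1 by simp
    moreover have "h n \<le> 2 + 8 * (ln n / ln (\<alpha> n))" using elim by (simp add: h_def)
    ultimately have "h n \<le> 2 * (C * (ln n / ln (\<alpha> n))) + 8 * (ln n / ln (\<alpha> n))" by linarith
    hence "h n \<le> D * (ln n / ln (\<alpha> n))" by (simp only: D_def distrib_right mult.assoc)
    moreover have "real (width \<alpha> n) ^ 8 \<le> (\<alpha> n powr (1 / 4)) ^ 8" using elim by (intro power_mono) auto
    moreover have "(\<alpha> n powr (1 / 4)) ^ 8 = (\<alpha> n)\<^sup>2"
    proof -
      have "(\<alpha> n powr (1 / 4)) ^ 8 = (\<alpha> n powr (1 / 4)) powr real 8" by (rule powr_realpow[symmetric]) (use \<alpha>0 in simp)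
      also have "\<dots> = \<alpha> n powr real 2" by (simp add: powr_powr)
      also have "\<dots> = (\<alpha> n)\<^sup>2" by (rule powr_realpow) (rule \<alpha>0)
      finally show ?thesis .
    qed
    moreover have "ln n \<le> d n / c'" using elim n c'(1) by (simp add: field_simps)
    ultimately show ?case using elim by simp
  qed
  have height2: "real (height x n) \<le> 2 * (ln n / ln x)" if "2 \<le> x" "x \<le> n" for n x
  proof -
    have "1 \<le> ln n / ln x" using that by (simp add: field_simps)
    moreover have "real (height x n) \<le> 1 + ln n / ln x" using that by (intro height_bound) auto
    ultimately have "real (height x n) \<le> ln n / ln x + ln n / ln x" by (rule order_trans[OF _ add_right_mono, rotated])
    thus ?thesis by (simp only: mult_2)
  qed
  have T: "T \<in> O[size_filter](\<lambda>(n, x). (ln n / ln x) * (ln n / ln (\<alpha> n)) ^ 3)"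
  proof (rule bigoI[where c = "24 * D ^ 3"])
    have "\<forall>\<^sub>F (n, x) in size_filter. T (n, x) \<le> 24 * D ^ 3 * ((ln n / ln x) * (ln n / ln (\<alpha> n)) ^ 3) \<and> 0 \<le> T (n, x)"
    proof (rule eventually_size_filter, use key in eventually_elim, intro allI impI)
      fix n x :: nat
      assume n: "2 \<le> n \<and> 1 \<le> ln (\<alpha> n) \<and> h n \<le> D * (ln n / ln (\<alpha> n)) \<and>
          real (width \<alpha> n) ^ 8 \<le> (\<alpha> n)\<^sup>2 \<and> ln n \<le> d n / c' \<and> 0 < d n" and x: "2 \<le> x" "x \<le> n"
      have h0: "0 \<le> h n" by (simp add: h_def)
      have "12 * (real (height x n) * h n ^ 3) \<le> 12 * (2 * (ln n / ln x) * (D * (ln n / ln (\<alpha> n))) ^ 3)"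
        using n x h0 height2 by (intro mult_left_mono mult_mono power_mono) auto
      also have "\<dots> = 24 * D ^ 3 * ((ln n / ln x) * (ln n / ln (\<alpha> n)) ^ 3)"
      proof -
        have "12 * (2 * q * (D * k) ^ 3) = 24 * D ^ 3 * (q * k ^ 3)" for q k
          by (simp add: power_mult_distrib)
        thus ?thesis .
      qed
      finally show "T (n, x) \<le> 24 * D ^ 3 * ((ln n / ln x) * (ln n / ln (\<alpha> n)) ^ 3) \<and> 0 \<le> T (n, x)"
        using h0 by (simp add: T_def)
    qed
    thus "\<forall>\<^sub>F z in size_filter. norm (T z) \<le> 24 * D ^ 3 * norm (case z of (n, x) \<Rightarrow> (ln n / ln x) * (ln n / ln (\<alpha> n)) ^ 3)"
    proof eventually_elim
      case (elim z)
      obtain n x where z: "z = (n, x)" by (cases z)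
      have "24 * D ^ 3 * ((ln n / ln x) * (ln n / ln (\<alpha> n)) ^ 3)
            \<le> 24 * D ^ 3 * \<bar>(ln n / ln x) * (ln n / ln (\<alpha> n)) ^ 3\<bar>"
        by (rule mult_left_mono[OF abs_ge_self]) (use C(1) in \<open>simp add: D_def\<close>)
      thus ?case using elim unfolding z by simp
    qed
  qed
  have B: "B \<in> O[size_filter](\<lambda>(n, x). (ln n / ln x) * (ln n / ln (\<alpha> n)) ^ 4 * d n * (\<alpha> n)\<^sup>2 * x * ln n)"
  proof (rule bigoI[where c = "71680 * D ^ 4 / c'"])
    define M where "M n x = (ln n / ln x) * (ln n / ln (\<alpha> n)) ^ 4 * d n * (\<alpha> n)\<^sup>2 * x * ln n" for n x :: nat
    have "\<forall>\<^sub>F (n, x) in size_filter. B (n, x) \<le> 71680 * D ^ 4 / c' * M n x \<and> 0 \<le> B (n, x)"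
    proof (rule eventually_size_filter, use key in eventually_elim, intro allI impI)
      fix n x :: nat
      assume n: "2 \<le> n \<and> 1 \<le> ln (\<alpha> n) \<and> h n \<le> D * (ln n / ln (\<alpha> n)) \<and>
          real (width \<alpha> n) ^ 8 \<le> (\<alpha> n)\<^sup>2 \<and> ln n \<le> d n / c' \<and> 0 < d n" and x: "2 \<le> x" "x \<le> n"
      have h0: "0 \<le> h n" by (simp add: h_def)
      have ln0: "0 \<le> ln (real n)" using n by simp
      have "real (log_size n) ^ 2 \<le> (4 * ln n) ^ 2" using log_size_bound[of n] n by (intro power_mono) auto
      also have "\<dots> = 16 * (ln n * ln n)" by (simp add: power2_eq_square)
      \<comment> \<open>One of the two logarithms, from degree and message length, is charged to
        d.\<close>
      also have "\<dots> \<le> 16 * (d n / c' * ln n)" using n ln0 by (intro mult_left_mono mult_right_mono) auto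
      finally have g2: "real (log_size n) ^ 2 \<le> 16 * (d n / c' * ln n)" .
      have "B (n, x) \<le> 2240 * (16 * (d n / c' * ln n) * x * (2 * (ln n / ln x)) * (D * (ln n / ln (\<alpha> n))) ^ 4 * (\<alpha> n)\<^sup>2)"
        unfolding B_def prod.case
        using n x h0 height2 g2 ln0 c'(1) by (intro mult_left_mono mult_mono power_mono mult_nonneg_nonneg) auto
      also have "\<dots> = 71680 * D ^ 4 / c' * M n x"
      proof -
        have "2240 * (16 * (e / c' * z) * w * (2 * q) * (D * k) ^ 4 * y) = 71680 * D ^ 4 / c' * (q * k ^ 4 * e * y * w * z)"
          for e z w q k y by (simp add: power_mult_distrib)
        thus ?thesis unfolding M_def .
      qed
      finally show "B (n, x) \<le> 71680 * D ^ 4 / c' * M n x \<and> 0 \<le> B (n, x)"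
        using h0 by (simp add: B_def)
    qed
    thus "\<forall>\<^sub>F z in size_filter. norm (B z) \<le> 71680 * D ^ 4 / c' *
        norm (case z of (n, x) \<Rightarrow> (ln n / ln x) * (ln n / ln (\<alpha> n)) ^ 4 * d n * (\<alpha> n)\<^sup>2 * x * ln n)"
    proof eventually_elim
      case (elim z)
      obtain n x where z: "z = (n, x)" by (cases z)
      have "71680 * D ^ 4 / c' * M n x \<le> 71680 * D ^ 4 / c' * \<bar>M n x\<bar>"
        by (rule mult_left_mono[OF abs_ge_self]) (use C(1) c'(1) in \<open>simp add: D_def\<close>)
      thus ?case using elim unfolding z M_def by simp
    qed
  qed
  show ?thesis
  proof (rule exI[of _ A], rule exI[of _ T], rule exI[of _ B], intro conjI allI impI)
    fix n x :: nat assume x: "2 \<le> x \<and> x \<le> n"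
    hence P: "P n x (A n x)" using A by simp
    show "solves_fuzzy_counting n (A n x)" using P by (simp only: P_def)
    show "real (rounds n (A n x) a adv) \<le> T (n, x)" "amortized_bits n (A n x) a adv \<le> B (n, x)" for a adv
      using P by (simp_all only: P_def)
  qed (rule T, rule B)
qed

end
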